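(* Let $n\ge1$, $s\in(0,1)$, let $\Omega\subset\mathbb{R}^n$ be a bounded domain, $\psi$ a measurable function on $\Omega$, $f\in\widetilde H^s(\Omega)'$, and let $u\in K^s_\psi$. The following are equivalent. (a) $u$ is the solution to problem $\mathcal P(\psi,f)$. (b) $u$ is the smallest supersolution for $(-\Delta)^s v=f$ in the convex set $K^s_\psi$; that is, $u$ is a supersolution and $\mathcal U\ge u$ almost everywhere in $\Omega$ for any supersolution $\mathcal U\in K^s_\psi$. (c) $u$ is a supersolution for $(-\Delta)^s v=f$ and $\langle(-\Delta)^s u-f,(v-u)^-\rangle=0$ for any $v\in K^s_\psi$. (d) $\langle(-\Delta)^s v-f,v-u\rangle\ge0$ for any $v\in K^s_\psi$.
   Context: No regularity of $\partial\Omega$ is assumed. The fractional Laplacian is defined through the Fourier transform, $\mathcal F[(-\Delta)^s u]=|\xi|^{2s}\mathcal F[u]$. $H^s(\mathbb{R}^n)=\{u\in L^2(\mathbb{R}^n): (-\Delta)^{s/2}u\in L^2(\mathbb{R}^n)\}$ and $\widetilde H^s(\Omega)=\{u\in H^s(\mathbb{R}^n): u\equiv0 \text{ on }\mathbb{R}^n\setminus\overline\Omega\}$, a Hilbert space with norm $\|(-\Delta)^{s/2}u\|_{L^2(\mathbb{R}^n)}$; $\widetilde H^s(\Omega)'$ is its dual and $\langle\cdot,\cdot\rangle$ the duality product. For $u\in\widetilde H^s(\Omega)$, $\langle(-\Delta)^s u,v\rangle=\int_{\mathbb{R}^n}(-\Delta)^{s/2}u\,(-\Delta)^{s/2}v\,dx$.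 Let $K^s_\psi=\{v\in\widetilde H^s(\Omega): v\ge\psi\text{ a.e. on }\Omega\}$. The problem $\mathcal P(\psi,f)$ is: find $u\in K^s_\psi$ such that $\langle(-\Delta)^s u-f,v-u\rangle\ge0$ for all $v\in K^s_\psi$. When $K^s_\psi\neq\emptyset$ it has a unique solution. A function $\mathcal U\in\widetilde H^s(\Omega)$ is a supersolution for $(-\Delta)^s v=f$ if $\langle(-\Delta)^s\mathcal U-f,\varphi\rangle\ge0$ for any $\varphi\in\widetilde H^s(\Omega)$ with $\varphi\ge0$. Notation: $v^-=-\min\{v,0\}$.
   Formalization: In the definition of supersolution, "φ ≥ 0" is taken almost everywhere in Ω; with φ ≥ 0 almost everywhere in ℝⁿ, (b) would not imply (a) for some domains whose boundary has positive measure. The two agree when ∂Ω has measure zero. *)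

theory Defs
  imports "HOL-Analysis.Analysis"
begin

definition L2 :: "('a::euclidean_space \<Rightarrow> 'b::euclidean_space) set" where
  "L2 = {u. u \<in> borel_measurable lebesgue \<and> integrable lebesgue (\<lambda>x. (norm (u x))\<^sup>2)}"

definition L2_norm :: "('a::euclidean_space \<Rightarrow> 'b::euclidean_space) \<Rightarrow> real" where
  "L2_norm u = sqrt (\<integral>x. (norm (u x))\<^sup>2 \<partial>lebesgue)"

definition fourier_integral :: "('a::euclidean_space \<Rightarrow> complex) \<Rightarrow> 'a \<Rightarrow> complex" where
  "fourier_integral g \<xi> =
     complex_of_real ((2 * pi) powr (- (real DIM('a) / 2))) *
     (\<integral>x. cis (- (\<xi> \<bullet> x)) * g x \<partial>lebesgue)"

text \<open>The Fourier--Plancherel transform on \<open>L\<^sup>2\<close>: \<open>h\<close> is the \<open>L\<^sup>2\<close>-limit of the Fourier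
  integrals of the truncations of \<open>g\<close> to balls (which are integrable). The transform is determined
  only up to null sets, hence a relation. The nonnegative integral is used so that the squared
  distance is infinite, rather than 0 by convention, when the difference is not square integrable.\<close>

definition has_fourier_transform ::
    "('a::euclidean_space \<Rightarrow> complex) \<Rightarrow> ('a \<Rightarrow> complex) \<Rightarrow> bool" where
  "has_fourier_transform g h \<longleftrightarrow> g \<in> L2 \<and> h \<in> L2 \<and>
     ((\<lambda>R::real. \<integral>\<^sup>+\<xi>. ennreal ((norm
         (fourier_integral (\<lambda>x. indicator (cball 0 R) x * g x) \<xi> - h \<xi>))\<^sup>2) \<partial>lebesgue)
       \<longlongrightarrow> 0) at_top"

text \<open>\<open>w = (-\<Delta>)\<^sup>\<sigma> u\<close> with \<open>w\<close> in \<open>L\<^sup>2\<close>, that is \<open>F[w] = |\<xi>|^(2\<sigma>) F[u]\<close>. All functions are real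
  valued; since the multiplier is real and even, \<open>(-\<Delta>)\<^sup>\<sigma> u\<close> is real whenever \<open>u\<close> is.\<close>

definition has_frac_laplacian ::
    "real \<Rightarrow> ('a::euclidean_space \<Rightarrow> real) \<Rightarrow> ('a \<Rightarrow> real) \<Rightarrow> bool" where
  "has_frac_laplacian \<sigma> u w \<longleftrightarrow> u \<in> L2 \<and> w \<in> L2 \<and>
     (\<exists>g h. has_fourier_transform (\<lambda>x. complex_of_real (u x)) g \<and>
            has_fourier_transform (\<lambda>x. complex_of_real (w x)) h \<and>
            (AE \<xi> in lebesgue. h \<xi> = complex_of_real (norm \<xi> powr (2 * \<sigma>)) * g \<xi>))"

text \<open>A representative of \<open>(-\<Delta>)\<^sup>\<sigma> u\<close>, unique up to null sets; meaningful only if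
  \<open>(-\<Delta>)\<^sup>\<sigma> u\<close> belongs to \<open>L\<^sup>2\<close>.\<close>

definition frac_laplacian :: "real \<Rightarrow> ('a::euclidean_space \<Rightarrow> real) \<Rightarrow> 'a \<Rightarrow> real" where
  "frac_laplacian \<sigma> u = (SOME w. has_frac_laplacian \<sigma> u w)"

definition Hs :: "real \<Rightarrow> ('a::euclidean_space \<Rightarrow> real) set" where
  "Hs s = {u \<in> L2. \<exists>w \<in> L2. has_frac_laplacian (s / 2) u w}"

definition Hs_tilde :: "real \<Rightarrow> 'a::euclidean_space set \<Rightarrow> ('a \<Rightarrow> real) set" where
  "Hs_tilde s \<Omega> = {u \<in> Hs s. AE x in lebesgue. x \<notin> closure \<Omega> \<longrightarrow> u x = 0}"

definition Hs_tilde_norm :: "real \<Rightarrow> ('a::euclidean_space \<Rightarrow> real) \<Rightarrow> real" where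
  "Hs_tilde_norm s u = L2_norm (frac_laplacian (s / 2) u)"

text \<open>Bounded linear functionals. Elements of \<open>Hs_tilde\<close> are functions rather than equivalence
  classes; linearity and the bound force \<open>f\<close> to agree on functions that are equal almost
  everywhere.\<close>

definition Hs_tilde_dual :: "real \<Rightarrow> 'a::euclidean_space set \<Rightarrow> (('a \<Rightarrow> real) \<Rightarrow> real) set" where
  "Hs_tilde_dual s \<Omega> = {f.
     (\<forall>u \<in> Hs_tilde s \<Omega>. \<forall>v \<in> Hs_tilde s \<Omega>. f (\<lambda>x. u x + v x) = f u + f v) \<and>
     (\<forall>u \<in> Hs_tilde s \<Omega>. \<forall>c. f (\<lambda>x. c * u x) = c * f u) \<and>
     (\<exists>C. \<forall>u \<in> Hs_tilde s \<Omega>. \<bar>f u\<bar> \<le> C * Hs_tilde_norm s u)}"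

text \<open>The duality pairing \<open>\<langle>(-\<Delta>)\<^sup>s u, v\<rangle>\<close>.\<close>

definition frac_pairing ::
    "real \<Rightarrow> ('a::euclidean_space \<Rightarrow> real) \<Rightarrow> ('a \<Rightarrow> real) \<Rightarrow> real" where
  "frac_pairing s u v =
     (\<integral>x. frac_laplacian (s / 2) u x * frac_laplacian (s / 2) v x \<partial>lebesgue)"

definition obstacle_set ::
    "real \<Rightarrow> 'a::euclidean_space set \<Rightarrow> ('a \<Rightarrow> real) \<Rightarrow> ('a \<Rightarrow> real) set" where
  "obstacle_set s \<Omega> \<psi> = {v \<in> Hs_tilde s \<Omega>. AE x in lebesgue. x \<in> \<Omega> \<longrightarrow> \<psi> x \<le> v x}"

definition obstacle_solution ::
    "real \<Rightarrow> 'a::euclidean_space set \<Rightarrow> ('a \<Rightarrow> real) \<Rightarrow> (('a \<Rightarrow> real) \<Rightarrow> real) \<Rightarrow> ('a \<Rightarrow> real) \<Rightarrow> bool"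
  where
  "obstacle_solution s \<Omega> \<psi> f u \<longleftrightarrow> u \<in> obstacle_set s \<Omega> \<psi> \<and>
     (\<forall>v \<in> obstacle_set s \<Omega> \<psi>.
        frac_pairing s u (\<lambda>x. v x - u x) - f (\<lambda>x. v x - u x) \<ge> 0)"

text \<open>As in the constraint defining \<open>obstacle_set\<close>, the order on \<open>Hs_tilde\<close> is the one almost
  everywhere on \<open>\<Omega>\<close>. This differs from the order almost everywhere on the whole space only if the
  boundary of \<open>\<Omega>\<close> has positive measure. In that case a supersolution in the sense of the order on
  the whole space that is smallest on \<open>\<Omega>\<close> need not solve the obstacle problem, because its values
  on the boundary are not controlled.\<close>

definition supersolution ::
    "real \<Rightarrow> 'a::euclidean_space set \<Rightarrow> (('a \<Rightarrow> real) \<Rightarrow> real) \<Rightarrow> ('a \<Rightarrow> real) \<Rightarrow> bool" where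
  "supersolution s \<Omega> f U \<longleftrightarrow> U \<in> Hs_tilde s \<Omega> \<and>
     (\<forall>\<phi> \<in> Hs_tilde s \<Omega>. (AE x in lebesgue. x \<in> \<Omega> \<longrightarrow> 0 \<le> \<phi> x) \<longrightarrow>
        frac_pairing s U \<phi> - f \<phi> \<ge> 0)"

definition neg_part :: "('a \<Rightarrow> real) \<Rightarrow> 'a \<Rightarrow> real" where
  "neg_part v = (\<lambda>x. - min (v x) 0)"

end

theory Submission imports Defs "HOL-Probability.Characteristic_Functions" begin

text \<open>
  Write \<open>E u v\<close> for the pairing of \<open>(-\<Delta>)\<^sup>s u\<close> with \<open>v\<close>. Once \<open>E\<close> is known to be a bilinear,
  symmetric, positive definite form for which \<open>Hs_tilde\<close> is complete, the equivalence of (a) and (d) is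
  Minty's argument, which uses monotonicity of \<open>E\<close> and convexity of the obstacle set only (\<open>Minty\<close>). The
  other two conditions use the order. If \<open>u\<close> solves the problem, then \<open>u + \<phi>\<close> for nonnegative \<open>\<phi>\<close>, and
  \<open>min u v = u - (v - u)\<^sup>-\<close>, are admissible; this makes \<open>u\<close> a supersolution whose residual vanishes on
  \<open>(v - u)\<^sup>-\<close>, which is (c). Conversely, (c) gives (a) by splitting \<open>v - u\<close> into its positive and
  negative parts. For (b), testing with \<open>n = (U - u)\<^sup>-\<close> and the inequality
  \<open>E w (w\<^sup>-) \<le> - E (w\<^sup>-) (w\<^sup>-)\<close> show that the solution lies below every supersolution \<open>U\<close>. A
  least supersolution is then compared with the solution, whose existence follows by minimising
  \<open>E v v / 2 - f v\<close>; the two agree on \<open>\<Omega>\<close>, and a test with their difference removes a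
  possible discrepancy on the boundary (\<open>least_supersolution_solution\<close>).

  The analytic core is therefore the following. First, the fractional Laplacian must be well defined
  and linear, and truncated functions must again have one. This needs the Fourier transform on
  \<open>L\<^sup>2\<close> to be an isometry onto \<open>L\<^sup>2\<close> (\<open>Plancherel\<close>, \<open>fourier_transform_surjective\<close>). Secondly,
  \<open>E \<bar>u\<bar> \<bar>u\<bar> \<le> E u u\<close> (\<open>Hs_tilde_abs\<close>), from which the inequality for \<open>w\<^sup>-\<close> follows by
  bilinearity. Thirdly, a Poincare inequality (\<open>fractional_Poincare\<close>), which gives completeness.

  The first two rest on one formula, the heat identity (\<open>Fourier_heat_identity\<close>): for integrable \<open>g\<close>
  with Fourier integral \<open>G\<close>,
  \<open>\<integral> exp (- t \<bar>\<xi>\<bar>\<^sup>2) \<bar>G \<xi>\<bar>\<^sup>2 d\<xi> = \<integral>\<integral> heat t (x - y) g(x) cnj (g(y)) dx dy\<close>, with the Gaussian heat kernel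
  on the right-hand side. Letting \<open>t\<close> tend to 0 gives Plancherel, because the heat kernel is an
  approximate identity. For fixed \<open>t\<close> the right-hand side does not decrease when a real \<open>g\<close> is
  replaced by \<open>\<bar>g\<bar>\<close>; integrating over \<open>t\<close> with the weight \<open>t\<^sup>-\<^sup>1\<^sup>-\<^sup>s\<close> turns this into the inequality
  for \<open>E\<close>, since \<open>\<bar>\<xi>\<bar>\<^sup>2\<^sup>s\<close> is a multiple of the integral of \<open>(1 - exp (- t \<bar>\<xi>\<bar>\<^sup>2)) t\<^sup>-\<^sup>1\<^sup>-\<^sup>s\<close>. The
  Poincare inequality uses the same weight: for large \<open>t\<close> the factor \<open>exp (- t \<bar>\<xi>\<bar>\<^sup>2)\<close> isolates low
  frequencies, and these carry at most half of the energy of a function of bounded support, because its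
  Fourier integral is bounded by a multiple of its \<open>L\<^sup>2\<close> norm.
\<close>

section \<open>Square integrable functions\<close>

text \<open>Squared norms are kept in the extended nonnegative reals: they are then defined for every
  function, convergence in \<open>L\<^sup>2\<close> is the single statement that an energy tends to 0, and estimates
  hold without integrability side conditions.\<close>

definition energy :: "'a measure \<Rightarrow> ('a \<Rightarrow> 'b::real_normed_vector) \<Rightarrow> ennreal" where
  "energy M f = (\<integral>\<^sup>+x. ennreal ((norm (f x))\<^sup>2) \<partial>M)"

lemma energy_cong_AE:
  "AE x in M. norm (f x) = norm (g x) \<Longrightarrow> energy M f = energy M g"
  unfolding energy_def by (rule nn_integral_cong_AE) auto

lemma energy_mono_AE:
  "AE x in M. norm (f x) \<le> norm (g x) \<Longrightarrow> energy M f \<le> energy M g"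
  unfolding energy_def
  by (rule nn_integral_mono_AE) (auto elim!: AE_mp intro!: ennreal_leI power_mono AE_I2)

lemma sq_add_weighted:
  fixes a b e :: real assumes "0 < e" "0 \<le> a" "0 \<le> b"
  shows "(a + b)\<^sup>2 \<le> (1 + e) * a\<^sup>2 + (1 + 1/e) * b\<^sup>2"
proof -
  have "0 \<le> (sqrt e * a - b / sqrt e)\<^sup>2" by simp
  also have "\<dots> = e * a\<^sup>2 + b\<^sup>2 / e - 2 * a * b"
    using assms by (simp add: power2_eq_square field_simps)
  finally show ?thesis by (simp add: power2_eq_square algebra_simps)
qed

text \<open>A substitute for the triangle inequality that stays with squared norms: the best
  choice of \<open>e\<close> recovers it, small \<open>e\<close> gives continuity of the norm, and \<open>e = 1\<close> the bound with
  factors 2.\<close>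

lemma energy_add_weighted:
  fixes f g :: "'a \<Rightarrow> 'b::{real_normed_vector, second_countable_topology}"
  assumes [measurable]: "f \<in> borel_measurable M" "g \<in> borel_measurable M" and e: "0 < e"
  shows "energy M (\<lambda>x. f x + g x) \<le> ennreal (1 + e) * energy M f + ennreal (1 + 1/e) * energy M g"
proof -
  have "(norm (f x + g x))\<^sup>2 \<le> (1 + e) * (norm (f x))\<^sup>2 + (1 + 1/e) * (norm (g x))\<^sup>2" for x
  proof -
    have "(norm (f x + g x))\<^sup>2 \<le> (norm (f x) + norm (g x))\<^sup>2"
      by (intro power_mono norm_triangle_ineq) auto
    also have "\<dots> \<le> (1 + e) * (norm (f x))\<^sup>2 + (1 + 1/e) * (norm (g x))\<^sup>2"
      by (rule sq_add_weighted) (use e in auto)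
    finally show ?thesis .
  qed
  then have "energy M (\<lambda>x. f x + g x) \<le>
      (\<integral>\<^sup>+x. ennreal (1 + e) * ennreal ((norm (f x))\<^sup>2) + ennreal (1 + 1/e) * ennreal ((norm (g x))\<^sup>2) \<partial>M)"
    unfolding energy_def using e
    by (intro nn_integral_mono) (simp flip: ennreal_mult ennreal_plus add: ennreal_leI)
  also have "\<dots> = ennreal (1 + e) * energy M f + ennreal (1 + 1/e) * energy M g"
    unfolding energy_def by (simp add: nn_integral_add nn_integral_cmult)
  finally show ?thesis .
qed

lemma energy_add:
  fixes f g :: "'a \<Rightarrow> 'b::{real_normed_vector, second_countable_topology}"
  assumes "f \<in> borel_measurable M" "g \<in> borel_measurable M"
  shows "energy M (\<lambda>x. f x + g x) \<le> 2 * energy M f + 2 * energy M g"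
  using energy_add_weighted[OF assms, of 1] by simp

lemma energy_uminus [simp]: "energy M (\<lambda>x. - f x) = energy M f"
  by (simp add: energy_def)

lemma energy_commute: "energy M (\<lambda>x. f x - g x) = energy M (\<lambda>x. g x - f x)"
  by (simp add: energy_def norm_minus_commute)

lemma energy_diff:
  fixes f g :: "'a \<Rightarrow> 'b::{real_normed_vector, second_countable_topology}"
  assumes "f \<in> borel_measurable M" "g \<in> borel_measurable M"
  shows "energy M (\<lambda>x. f x - g x) \<le> 2 * energy M f + 2 * energy M g"
  using energy_add[of f M "\<lambda>x. - g x"] assms by simp

lemma energy_scaleR: 
  fixes f :: "'a \<Rightarrow> 'b::{real_normed_vector, second_countable_topology}"
  assumes [measurable]: "f \<in> borel_measurable M"
  shows "energy M (\<lambda>x. c *\<^sub>R f x) = ennreal (c\<^sup>2) * energy M f"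
  unfolding energy_def
  by (subst nn_integral_cmult[symmetric]) (auto simp: power_mult_distrib ennreal_mult)

lemma energy_eq_0_iff:
  fixes f :: "'a \<Rightarrow> 'b::{real_normed_vector, second_countable_topology}"
  assumes [measurable]: "f \<in> borel_measurable M"
  shows "energy M f = 0 \<longleftrightarrow> (AE x in M. f x = 0)"
  unfolding energy_def by (subst nn_integral_0_iff_AE) (auto simp: ennreal_eq_0_iff)

lemma integrable_norm_sq_iff:
  fixes f :: "'a \<Rightarrow> 'b::{real_normed_vector, second_countable_topology}"
  assumes [measurable]: "f \<in> borel_measurable M"
  shows "integrable M (\<lambda>x. (norm (f x))\<^sup>2) \<longleftrightarrow> energy M f < \<infinity>"
  unfolding energy_def integrable_iff_bounded by simp

lemma energy_cnj: "energy M (\<lambda>x. cnj (f x)) = energy M f"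
  by (simp add: energy_def)

lemma energy_of_real: "energy M (\<lambda>x. complex_of_real (f x)) = energy M f"
  by (simp add: energy_def)

lemma integral_norm_sq:
  fixes f :: "'a \<Rightarrow> 'b::{real_normed_vector, second_countable_topology}"
  assumes "f \<in> borel_measurable M"
  shows "(\<integral>x. (norm (f x))\<^sup>2 \<partial>M) = enn2real (energy M f)"
  unfolding energy_def using assms by (intro integral_eq_nn_integral) auto

lemma L2_iff: "u \<in> L2 \<longleftrightarrow> u \<in> borel_measurable lebesgue \<and> energy lebesgue u < \<infinity>"
  unfolding L2_def using integrable_norm_sq_iff[of u lebesgue] by auto

lemma tendsto_0_le_ennreal:
  fixes f g :: "'i \<Rightarrow> ennreal"
  assumes "\<And>i. f i \<le> g i" "(g \<longlongrightarrow> 0) F" shows "(f \<longlongrightarrow> 0) F"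
  using assms by (intro tendsto_sandwich[of "\<lambda>_. 0" f F g 0]) auto

lemma ennreal_le_all_weighted:
  fixes A B :: ennreal
  assumes "\<And>e. 0 < e \<Longrightarrow> A \<le> ennreal (1 + e) * B"
  shows "A \<le> B"
proof (cases "B = \<infinity>")
  case False
  have "((\<lambda>e. ennreal (1 + e) * B) \<longlongrightarrow> ennreal (1 + 0) * B) (at_right 0)"
    using False by (intro tendsto_mult_ennreal tendsto_ennrealI tendsto_intros) auto
  moreover have "\<forall>\<^sub>F e in at_right 0. A \<le> ennreal (1 + e) * B"
    by (auto intro!: assms eventually_at_rightI[of 0 1])
  ultimately have "A \<le> ennreal (1 + 0) * B"
    by (rule tendsto_lowerbound) simp
  then show ?thesis by simp
qed simp

text \<open>Continuity of the norm. The weighted inequality bounds each of \<open>energy g\<close> and \<open>A\<close> by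
  \<open>1 + e\<close> times the other one plus a term that vanishes in the limit.\<close>

lemma energy_limit_unique:
  fixes f :: "'i \<Rightarrow> 'a \<Rightarrow> 'b::{real_normed_vector, second_countable_topology}"
  assumes f[measurable]: "\<And>i. f i \<in> borel_measurable M" and g[measurable]: "g \<in> borel_measurable M"
    and d: "((\<lambda>i. energy M (\<lambda>x. f i x - g x)) \<longlongrightarrow> 0) F"
    and A: "((\<lambda>i. energy M (f i)) \<longlongrightarrow> A) F" and F: "F \<noteq> bot"
  shows "energy M g = A"
proof (rule antisym)
  show "energy M g \<le> A"
  proof (rule ennreal_le_all_weighted)
    fix e :: real assume e: "0 < e"
    have "energy M g \<le> ennreal (1 + e) * energy M (f i) + ennreal (1 + 1/e) * energy M (\<lambda>x. f i x - g x)" for i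
      using energy_add_weighted[of "f i" M "\<lambda>x. g x - f i x" e] e by (simp add: energy_commute)
    moreover have "((\<lambda>i. ennreal (1 + e) * energy M (f i) + ennreal (1 + 1/e) * energy M (\<lambda>x. f i x - g x))
        \<longlongrightarrow> ennreal (1 + e) * A + ennreal (1 + 1/e) * 0) F"
      using e by (intro tendsto_add tendsto_mult_ennreal tendsto_const A d) (auto simp: ennreal_eq_0_iff)
    ultimately show "energy M g \<le> ennreal (1 + e) * A"
      by (intro tendsto_lowerbound[OF _ _ F]) (auto)
  qed
  show "A \<le> energy M g"
  proof (rule ennreal_le_all_weighted)
    fix e :: real assume e: "0 < e"
    have "energy M (f i) \<le> ennreal (1 + e) * energy M g + ennreal (1 + 1/e) * energy M (\<lambda>x. f i x - g x)" for i
      using energy_add_weighted[of g M "\<lambda>x. f i x - g x" e] e by simp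
    moreover have "((\<lambda>i. ennreal (1 + e) * energy M g + ennreal (1 + 1/e) * energy M (\<lambda>x. f i x - g x))
        \<longlongrightarrow> ennreal (1 + e) * energy M g + ennreal (1 + 1/e) * 0) F"
      using e by (intro tendsto_add tendsto_mult_ennreal tendsto_const A d) (auto simp: ennreal_eq_0_iff)
    ultimately show "A \<le> ennreal (1 + e) * energy M g"
      by (intro tendsto_le[OF F _ A, of "\<lambda>i. ennreal (1 + e) * energy M g + ennreal (1 + 1/e) * energy M (\<lambda>x. f i x - g x)"]) auto
  qed
qed

lemma energy_dominated:
  fixes f :: "nat \<Rightarrow> 'a \<Rightarrow> 'b::{real_normed_vector, second_countable_topology}"
  assumes [measurable]: "\<And>i. f i \<in> borel_measurable M" "g \<in> borel_measurable M"
    and C: "0 \<le> C" and bound: "\<And>i. AE x in M. norm (f i x) \<le> C * norm (g x)"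
    and lim: "AE x in M. (\<lambda>i. f i x) \<longlonglongrightarrow> g x" and g: "energy M g < \<infinity>"
  shows "(\<lambda>i. energy M (\<lambda>x. f i x - g x)) \<longlonglongrightarrow> 0"
proof -
  have "(\<lambda>i. \<integral>\<^sup>+x. ennreal ((norm (f i x - g x))\<^sup>2) \<partial>M) \<longlonglongrightarrow> (\<integral>\<^sup>+x. 0 \<partial>M)"
  proof (rule nn_integral_dominated_convergence[where w="\<lambda>x. ennreal ((C + 1)\<^sup>2) * ennreal ((norm (g x))\<^sup>2)"])
    show "AE x in M. ennreal ((norm (f i x - g x))\<^sup>2) \<le> ennreal ((C + 1)\<^sup>2) * ennreal ((norm (g x))\<^sup>2)" for i
      using bound[of i]
    proof eventually_elim
      fix x assume "norm (f i x) \<le> C * norm (g x)"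
      then have "norm (f i x - g x) \<le> (C + 1) * norm (g x)"
        using norm_triangle_ineq4[of "f i x" "g x"] by (simp add: distrib_right)
      then have "(norm (f i x - g x))\<^sup>2 \<le> ((C + 1) * norm (g x))\<^sup>2" by (intro power_mono) auto
      then show "ennreal ((norm (f i x - g x))\<^sup>2) \<le> ennreal ((C + 1)\<^sup>2) * ennreal ((norm (g x))\<^sup>2)"
        by (simp add: power_mult_distrib ennreal_leI flip: ennreal_mult)
    qed
    show "(\<integral>\<^sup>+x. ennreal ((C + 1)\<^sup>2) * ennreal ((norm (g x))\<^sup>2) \<partial>M) < \<infinity>"
      using g by (simp add: nn_integral_cmult energy_def ennreal_mult_less_top)
    show "AE x in M. (\<lambda>i. ennreal ((norm (f i x - g x))\<^sup>2)) \<longlonglongrightarrow> 0"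
      using lim
    proof eventually_elim
      fix x assume "(\<lambda>i. f i x) \<longlonglongrightarrow> g x"
      then have "(\<lambda>i. (norm (f i x - g x))\<^sup>2) \<longlonglongrightarrow> (norm (g x - g x))\<^sup>2" by (intro tendsto_intros)
      then have "(\<lambda>i. (norm (f i x - g x))\<^sup>2) \<longlonglongrightarrow> 0" by simp
      then show "(\<lambda>i. ennreal ((norm (f i x - g x))\<^sup>2)) \<longlonglongrightarrow> 0" by (subst ennreal_tendsto_0_iff) auto
    qed
  qed measurable
  then show ?thesis by (simp add: energy_def)
qed

text \<open>The almost everywhere convergent subsequence is part of the statement because pointwise
  constraints (the obstacle condition, vanishing outside the domain) are passed to the limit along it.\<close>

lemma Riesz_Fischer:
  fixes f :: "nat \<Rightarrow> 'a \<Rightarrow> 'b::{banach, second_countable_topology}"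
  assumes f[measurable]: "\<And>i. f i \<in> borel_measurable M"
    and Cauchy: "\<And>e. 0 < e \<Longrightarrow> \<exists>N. \<forall>m\<ge>N. \<forall>n\<ge>N. energy M (\<lambda>x. f m x - f n x) < ennreal e"
  obtains g r where "g \<in> borel_measurable M" "(\<lambda>n. energy M (\<lambda>x. f n x - g x)) \<longlonglongrightarrow> 0"
    "strict_mono r" "AE x in M. (\<lambda>k. f (r k) x) \<longlonglongrightarrow> g x"
proof -
  obtain N where N: "\<And>e m n. 0 < e \<Longrightarrow> m \<ge> N e \<Longrightarrow> n \<ge> N e \<Longrightarrow> energy M (\<lambda>x. f m x - f n x) < ennreal e"
    using Cauchy by metis
  \<comment> \<open>Consecutive terms of the subsequence have squared distance below \<open>4\<^sup>-\<^sup>k\<close>, so that their squared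
    pointwise distances remain summable with weights \<open>2\<^sup>k\<close>.\<close>
  define r where "r = rec_nat (N 1) (\<lambda>k p. max (Suc p) (N ((1/4)^Suc k)))"
  have r_Suc: "r (Suc k) = max (Suc (r k)) (N ((1/4)^Suc k))" for k by (simp add: r_def)
  have r_mono: "strict_mono r" by (simp add: strict_mono_Suc_iff r_Suc less_max_iff_disj)
  have r_N: "r k \<ge> N ((1/4)^k)" for k
    by (cases k) (auto simp: r_Suc, simp add: r_def)
  define d where "d k x = f (r (Suc k)) x - f (r k) x" for k x
  have [measurable]: "d k \<in> borel_measurable M" for k unfolding d_def by measurable
  have dk: "energy M (d k) \<le> ennreal ((1/4)^k)" for k
  proof -
    have "r (Suc k) \<ge> N ((1/4)^k)" 
      using r_N[of k] r_mono by (meson le_trans less_imp_le strict_mono_Suc_iff)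
    then show ?thesis unfolding d_def using N[of "(1/4)^k" "r (Suc k)" "r k"] r_N[of k] by simp
  qed
  have "(\<integral>\<^sup>+x. (\<Sum>k. ennreal (2^k * (norm (d k x))\<^sup>2)) \<partial>M) = (\<Sum>k. \<integral>\<^sup>+x. ennreal (2^k * (norm (d k x))\<^sup>2) \<partial>M)"
    by (rule nn_integral_suminf) measurable
  also have "\<dots> = (\<Sum>k. ennreal (2^k) * energy M (d k))"
    unfolding energy_def by (intro suminf_cong) (simp add: ennreal_mult nn_integral_cmult)
  also have "\<dots> \<le> (\<Sum>k. ennreal ((1/2)^k))"
  proof (intro suminf_le)
    fix k
    have "ennreal (2^k) * energy M (d k) \<le> ennreal (2^k) * ennreal ((1/4)^k)"
      by (intro mult_left_mono dk) auto
    also have "\<dots> = ennreal (2^k * (1/4)^k)" by (rule ennreal_mult[symmetric]) auto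
    also have "(2::real)^k * (1/4)^k = (1/2)^k" by (simp flip: power_mult_distrib)
    finally show "ennreal (2^k) * energy M (d k) \<le> ennreal ((1/2)^k)" .
  qed auto
  also have "\<dots> < \<infinity>" by (subst suminf_ennreal2) (auto simp: summable_geometric)
  finally have "AE x in M. (\<Sum>k. ennreal (2^k * (norm (d k x))\<^sup>2)) \<noteq> \<infinity>"
    by (intro nn_integral_PInf_AE) auto
  then have conv: "AE x in M. convergent (\<lambda>k. f (r k) x)"
  proof (eventually_elim)
    fix x assume fin: "(\<Sum>k. ennreal (2^k * (norm (d k x))\<^sup>2)) \<noteq> \<infinity>"
    have s1: "summable (\<lambda>k. 2^k * (norm (d k x))\<^sup>2)"
      using fin by (intro summable_suminf_not_top) auto
    have s2: "summable (\<lambda>k. (1/2)^k::real)" by (simp add: summable_geometric)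
    have "norm (d k x) \<le> 2^k * (norm (d k x))\<^sup>2 + (1/2)^k" for k
    proof -
      have "0 \<le> (2^k * norm (d k x) - 1/2)\<^sup>2" by simp
      then have "2^k * norm (d k x) \<le> (2^k)\<^sup>2 * (norm (d k x))\<^sup>2 + 1/4"
        by (simp add: power2_eq_square algebra_simps)
      also have "\<dots> \<le> 2^k * (2^k * (norm (d k x))\<^sup>2 + (1/2)^k)"
        by (simp add: power2_eq_square algebra_simps flip: power_mult_distrib)
      finally show ?thesis by simp
    qed
    then have "summable (\<lambda>k. norm (d k x))"
      by (intro summable_comparison_test'[OF summable_add[OF s1 s2], of 0]) auto
    then have "summable (\<lambda>k. d k x)" by (rule summable_norm_cancel)
    then have "convergent (\<lambda>n. \<Sum>k<n. d k x)" by (simp add: summable_iff_convergent)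
    then have "convergent (\<lambda>n. f (r 0) x + (\<Sum>k<n. d k x))" by (intro convergent_add convergent_const)
    moreover have "f (r 0) x + (\<Sum>k<n. d k x) = f (r n) x" for n
      unfolding d_def by (subst sum_lessThan_telescope) simp
    ultimately show "convergent (\<lambda>k. f (r k) x)" by simp
  qed
  define g where "g x = lim (\<lambda>k. f (r k) x)" for x
  have g[measurable]: "g \<in> borel_measurable M" unfolding g_def by (rule borel_measurable_lim_metric) measurable
  have lim: "AE x in M. (\<lambda>k. f (r k) x) \<longlonglongrightarrow> g x"
    using conv by eventually_elim (simp add: g_def convergent_LIMSEQ_iff)
  have small: "energy M (\<lambda>x. f n x - g x) \<le> ennreal e" if e: "0 < e" and n: "n \<ge> N e" for e n
  proof -
    have "energy M (\<lambda>x. f n x - g x) = (\<integral>\<^sup>+x. liminf (\<lambda>k. ennreal ((norm (f n x - f (r k) x))\<^sup>2)) \<partial>M)"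
      unfolding energy_def
    proof (rule nn_integral_cong_AE, use lim in eventually_elim)
      fix x assume "(\<lambda>k. f (r k) x) \<longlonglongrightarrow> g x"
      then have "(\<lambda>k. ennreal ((norm (f n x - f (r k) x))\<^sup>2)) \<longlonglongrightarrow> ennreal ((norm (f n x - g x))\<^sup>2)"
        by (intro tendsto_intros)
      then show "ennreal ((norm (f n x - g x))\<^sup>2) = liminf (\<lambda>k. ennreal ((norm (f n x - f (r k) x))\<^sup>2))"
        by (intro lim_imp_Liminf[symmetric]) auto
    qed
    also have "\<dots> \<le> liminf (\<lambda>k. energy M (\<lambda>x. f n x - f (r k) x))"
      unfolding energy_def by (rule nn_integral_liminf) measurable
    also have "\<dots> \<le> ennreal e"
    proof (rule Liminf_le)
      show "\<forall>\<^sub>F k in sequentially. energy M (\<lambda>x. f n x - f (r k) x) \<le> ennreal e"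
        using eventually_ge_at_top[of "N e"]
      proof eventually_elim
        fix k assume "k \<ge> N e"
        then have "r k \<ge> N e" using seq_suble[OF r_mono, of k] by linarith
        then show "energy M (\<lambda>x. f n x - f (r k) x) \<le> ennreal e" using N[OF e n] by (auto intro: less_imp_le)
      qed
    qed auto
    finally show ?thesis .
  qed
  have "(\<lambda>n. energy M (\<lambda>x. f n x - g x)) \<longlonglongrightarrow> 0"
  proof (rule order_tendstoI)
    fix a :: ennreal assume "0 < a"
    then obtain c where c: "0 < c" "c < a" using dense by blast
    then have "c < top" by (auto intro: less_le_trans)
    with c have e: "0 < enn2real c" "ennreal (enn2real c) < a"
      by (auto simp: enn2real_positive_iff)
    show "\<forall>\<^sub>F n in sequentially. energy M (\<lambda>x. f n x - g x) < a"
      using eventually_ge_at_top[of "N (enn2real c)"] by eventually_elim (rule le_less_trans[OF small[OF e(1)] e(2)])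
  qed auto
  with that[OF g _ r_mono lim] show thesis by blast
qed

text \<open>The Cauchy--Schwarz inequality, in a form that also yields integrability of products.\<close>

lemma energy_mult_le:
  fixes a b :: "'a \<Rightarrow> 'b::{real_normed_algebra, second_countable_topology}"
  assumes [measurable]: "a \<in> borel_measurable M" "b \<in> borel_measurable M"
  shows "(\<integral>\<^sup>+x. ennreal (norm (a x * b x)) \<partial>M)\<^sup>2 \<le> energy M a * energy M b"
proof -
  have "(\<integral>\<^sup>+x. ennreal (norm (a x * b x)) \<partial>M) \<le> (\<integral>\<^sup>+x. ennreal (norm (a x)) * ennreal (norm (b x)) \<partial>M)"
    by (intro nn_integral_mono) (simp flip: ennreal_mult add: ennreal_leI norm_mult_ineq)
  then have "(\<integral>\<^sup>+x. ennreal (norm (a x * b x)) \<partial>M)\<^sup>2 \<le> (\<integral>\<^sup>+x. ennreal (norm (a x)) * ennreal (norm (b x)) \<partial>M)\<^sup>2"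
    by (intro power_mono) auto
  also have "\<dots> \<le> (\<integral>\<^sup>+x. (ennreal (norm (a x)))\<^sup>2 \<partial>M) * (\<integral>\<^sup>+x. (ennreal (norm (b x)))\<^sup>2 \<partial>M)"
    by (rule Cauchy_Schwarz_nn_integral) measurable
  also have "\<dots> = energy M a * energy M b" unfolding energy_def by (simp add: ennreal_power)
  finally show ?thesis .
qed

lemma integrable_mult_L2:
  fixes a b :: "'a \<Rightarrow> 'b::{real_normed_algebra, second_countable_topology, banach}"
  assumes [measurable]: "a \<in> borel_measurable M" "b \<in> borel_measurable M"
    and "energy M a < \<infinity>" "energy M b < \<infinity>"
  shows "integrable M (\<lambda>x. a x * b x)"
proof -
  have "(\<integral>\<^sup>+x. ennreal (norm (a x * b x)) \<partial>M)\<^sup>2 < \<infinity>"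
    using energy_mult_le[of a M b] assms(3,4) by (auto simp: ennreal_mult_less_top intro: le_less_trans)
  then show ?thesis unfolding integrable_iff_bounded by (auto simp: power_less_top_ennreal)
qed

lemma integral_mult_tendsto:
  fixes a b :: "'a \<Rightarrow> 'b::{real_normed_algebra, second_countable_topology, banach}"
    and f h :: "nat \<Rightarrow> 'a \<Rightarrow> 'b"
  assumes [measurable]: "a \<in> borel_measurable M" "b \<in> borel_measurable M"
    "\<And>i. f i \<in> borel_measurable M" "\<And>i. h i \<in> borel_measurable M"
    and a: "energy M a < \<infinity>" and b: "energy M b < \<infinity>"
    and fi: "\<And>i. energy M (f i) < \<infinity>" and hi: "\<And>i. energy M (h i) < \<infinity>"
    and f: "(\<lambda>i. energy M (\<lambda>x. f i x - a x)) \<longlonglongrightarrow> 0"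
    and h: "(\<lambda>i. energy M (\<lambda>x. h i x - b x)) \<longlonglongrightarrow> 0"
  shows "(\<lambda>i. \<integral>x. f i x * h i x \<partial>M) \<longlonglongrightarrow> (\<integral>x. a x * b x \<partial>M)"
proof -
  let ?D = "\<lambda>i. \<integral>\<^sup>+x. ennreal (norm (f i x * h i x - a x * b x)) \<partial>M"
  let ?A = "\<lambda>i. \<integral>\<^sup>+x. ennreal (norm ((f i x - a x) * (h i x - b x))) \<partial>M"
  let ?B = "\<lambda>i. \<integral>\<^sup>+x. ennreal (norm ((f i x - a x) * b x)) \<partial>M"
  let ?C = "\<lambda>i. \<integral>\<^sup>+x. ennreal (norm (a x * (h i x - b x))) \<partial>M"
  have sq0: "X \<longlonglongrightarrow> 0" if "\<And>i. (X i)\<^sup>2 \<le> Y i" "Y \<longlonglongrightarrow> 0" for X Y :: "nat \<Rightarrow> ennreal"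
  proof (rule order_tendstoI)
    fix e :: ennreal assume e: "0 < e"
    then have "0 < e\<^sup>2" by (simp add: zero_less_iff_neq_zero)
    then have "\<forall>\<^sub>F i in sequentially. Y i < e\<^sup>2" using that(2) by (simp add: order_tendstoD)
    then show "\<forall>\<^sub>F i in sequentially. X i < e"
    proof eventually_elim
      fix i assume "Y i < e\<^sup>2"
      then have "(X i)\<^sup>2 < e\<^sup>2" using that(1)[of i] by (rule le_less_trans[rotated])
      then show "X i < e" by (metis linorder_not_le power_mono zero_le)
    qed
  qed auto
  have A0: "?A \<longlonglongrightarrow> 0"
  proof (rule sq0[OF energy_mult_le])
    show "(\<lambda>i. energy M (\<lambda>x. f i x - a x) * energy M (\<lambda>x. h i x - b x)) \<longlonglongrightarrow> 0"
      using tendsto_mult_ennreal[OF f h] by simp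
  qed auto
  have B0: "?B \<longlonglongrightarrow> 0"
  proof (rule sq0[OF energy_mult_le])
    show "(\<lambda>i. energy M (\<lambda>x. f i x - a x) * energy M b) \<longlonglongrightarrow> 0"
      using tendsto_mult_ennreal[OF f tendsto_const[of "energy M b"]] b by simp
  qed auto
  have C0: "?C \<longlonglongrightarrow> 0"
  proof (rule sq0[OF energy_mult_le])
    show "(\<lambda>i. energy M a * energy M (\<lambda>x. h i x - b x)) \<longlonglongrightarrow> 0"
      using tendsto_mult_ennreal[OF tendsto_const[of "energy M a"] h] a by simp
  qed auto
  have "?D i \<le> ?A i + ?B i + ?C i" for i
  proof -
    have "norm (f i x * h i x - a x * b x) \<le>
        norm ((f i x - a x) * (h i x - b x)) + norm ((f i x - a x) * b x) + norm (a x * (h i x - b x))" for x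
    proof -
      have "f i x * h i x - a x * b x = (f i x - a x) * (h i x - b x) + (f i x - a x) * b x + a x * (h i x - b x)"
        by (simp add: algebra_simps)
      then show ?thesis by (metis norm_triangle_le order_refl norm_triangle_mono)
    qed
    then have "?D i \<le> (\<integral>\<^sup>+x. ennreal (norm ((f i x - a x) * (h i x - b x))) + ennreal (norm ((f i x - a x) * b x))
        + ennreal (norm (a x * (h i x - b x))) \<partial>M)"
      by (intro nn_integral_mono) (simp flip: ennreal_plus add: ennreal_leI)
    then show ?thesis by (simp add: nn_integral_add)
  qed
  moreover have "(\<lambda>i. ?A i + ?B i + ?C i) \<longlonglongrightarrow> 0 + 0 + 0" by (intro tendsto_add A0 B0 C0)
  ultimately have D0: "?D \<longlonglongrightarrow> 0"
    by (intro tendsto_sandwich[of "\<lambda>_. 0" ?D _ "\<lambda>i. ?A i + ?B i + ?C i"]) auto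
  show ?thesis
    by (rule tendsto_L1_int[OF _ _ D0]) (auto intro!: integrable_mult_L2 fi hi a b)
qed

section \<open>The Fourier transform of a Gaussian and the heat kernel\<close>

lemma cnj_measurable [measurable]: "cnj \<in> borel_measurable borel"
  by (intro borel_measurable_continuous_onI continuous_intros)

lemma cis_measurable [measurable]: "cis \<in> borel_measurable borel"
  by (intro borel_measurable_continuous_onI continuous_intros)

text \<open>This is the characteristic function of the normal distribution, rescaled.\<close>

lemma Gaussian_char_real:
  fixes a r :: real assumes a: "0 < a"
  shows "integrable lborel (\<lambda>x. complex_of_real (exp (- a * x\<^sup>2)) * cis (r * x))"
    and "(\<integral>x. complex_of_real (exp (- a * x\<^sup>2)) * cis (r * x) \<partial>lborel)
        = complex_of_real (sqrt (pi / a) * exp (- r\<^sup>2 / (4 * a)))"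
proof -
  define c where "c = sqrt (2 * a)"
  have c: "c > 0" "c\<^sup>2 = 2 * a" using a by (auto simp: c_def)
  let ?F = "\<lambda>x. std_normal_density x *\<^sub>R cis ((r / c) * x)"
  have int: "integrable lborel ?F"
    by (rule Bochner_Integration.integrable_bound[OF integrable_normal_density[where \<mu>=0 and \<sigma>=1]]) auto
  have "char std_normal_distribution (r / c) = (\<integral>x. ?F x \<partial>lborel)"
    unfolding char_def by (subst integral_density) (auto simp: cis_conv_exp)
  then have val: "(\<integral>x. ?F x \<partial>lborel) = complex_of_real (exp (- ((r / c)\<^sup>2) / 2))"
    by (simp add: char_std_normal_distribution)
  have eq: "?F (0 + c * x) = (1 / sqrt (2 * pi)) *\<^sub>R (complex_of_real (exp (- a * x\<^sup>2)) * cis (r * x))" for x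
    using c by (simp add: std_normal_density_def scaleR_conv_of_real power_mult_distrib mult.assoc)
  have "integrable lborel (\<lambda>x. ?F (0 + c * x))"
    using lborel_integrable_real_affine[OF int, of c 0] c by simp
  then have "integrable lborel (\<lambda>x. sqrt (2 * pi) *\<^sub>R ?F (0 + c * x))"
    by (intro integrable_scaleR_right)
  then show "integrable lborel (\<lambda>x. complex_of_real (exp (- a * x\<^sup>2)) * cis (r * x))"
    unfolding eq by simp
  have "(\<integral>x. ?F x \<partial>lborel) = \<bar>c\<bar> *\<^sub>R (\<integral>x. ?F (0 + c * x) \<partial>lborel)"
    using c by (intro lborel_integral_real_affine) auto
  also have "(\<integral>x. ?F (0 + c * x) \<partial>lborel) =
      (1 / sqrt (2 * pi)) *\<^sub>R (\<integral>x. complex_of_real (exp (- a * x\<^sup>2)) * cis (r * x) \<partial>lborel)"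
    unfolding eq by simp
  finally have "(\<integral>x. complex_of_real (exp (- a * x\<^sup>2)) * cis (r * x) \<partial>lborel) =
      complex_of_real (sqrt (2 * pi) / c * exp (- ((r / c)\<^sup>2) / 2))"
    using c unfolding val by (simp add: scaleR_conv_of_real field_simps)
  also have "sqrt (2 * pi) / c = sqrt (pi / a)"
    by (simp add: c_def flip: real_sqrt_divide)
  also have "- ((r / c)\<^sup>2) / 2 = - r\<^sup>2 / (4 * a)" using c by (simp add: power_divide)
  finally show "(\<integral>x. complex_of_real (exp (- a * x\<^sup>2)) * cis (r * x) \<partial>lborel)
        = complex_of_real (sqrt (pi / a) * exp (- r\<^sup>2 / (4 * a)))" .
qed

lemma cis_sum: "finite A \<Longrightarrow> cis (\<Sum>b\<in>A. f b) = (\<Prod>b\<in>A. cis (f b))"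
  by (induction A rule: finite_induct) (auto simp: cis_mult[symmetric])

lemma norm_sq_Basis: "(norm (x::'a::euclidean_space))\<^sup>2 = (\<Sum>b\<in>Basis. (x \<bullet> b)\<^sup>2)"
  unfolding power2_norm_eq_inner by (subst euclidean_inner) (simp add: power2_eq_square)

text \<open>Both the Gaussian and the character are products over the coordinates, so Fubini reduces the
  integral to one dimension.\<close>

lemma Gaussian_char:
  fixes z :: "'a::euclidean_space" and a :: real assumes a: "0 < a"
  shows "integrable lborel (\<lambda>x. complex_of_real (exp (- a * (norm x)\<^sup>2)) * cis (x \<bullet> z))"
    and "(\<integral>x. complex_of_real (exp (- a * (norm x)\<^sup>2)) * cis (x \<bullet> z) \<partial>lborel)
        = complex_of_real ((pi / a) powr (real DIM('a) / 2) * exp (- (norm z)\<^sup>2 / (4 * a)))"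
proof -
  interpret product_sigma_finite "\<lambda>_::'a. lborel :: real measure" by standard
  let ?h = "\<lambda>b x. complex_of_real (exp (- a * x\<^sup>2)) * cis ((z \<bullet> b) * x)"
  let ?T = "\<lambda>f. \<Sum>b\<in>Basis. f b *\<^sub>R b :: 'a"
  let ?f = "\<lambda>x. complex_of_real (exp (- a * (norm x)\<^sup>2)) * cis (x \<bullet> z)"
  have f: "?f x = (\<Prod>b\<in>Basis. ?h b (x \<bullet> b))" for x :: 'a
  proof -
    have "exp (- a * (norm x)\<^sup>2) = (\<Prod>b\<in>Basis. exp (- a * (x \<bullet> b)\<^sup>2))"
      by (simp add: norm_sq_Basis sum_distrib_left exp_sum sum_negf[symmetric])
    moreover have "cis (x \<bullet> z) = (\<Prod>b\<in>Basis. cis ((z \<bullet> b) * (x \<bullet> b)))"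
      by (subst euclidean_inner) (simp add: cis_sum mult.commute)
    ultimately show ?thesis by (simp add: prod.distrib)
  qed
  have fT: "?f (?T g) = (\<Prod>b\<in>Basis. ?h b (g b))" for g
    unfolding f by (intro prod.cong) auto
  have [measurable]: "?T \<in> (\<Pi>\<^sub>M b\<in>Basis. lborel) \<rightarrow>\<^sub>M borel" by measurable
  have [measurable]: "?f \<in> borel_measurable borel" by measurable
  have "integrable (\<Pi>\<^sub>M b\<in>Basis. lborel) (\<lambda>g. \<Prod>b\<in>Basis. ?h b (g b))"
    by (intro product_integrable_prod Gaussian_char_real a) auto
  then show "integrable lborel ?f"
    by (subst lborel_eq, subst integrable_distr_eq) (measurable, simp only: fT)
  have "(\<integral>x. ?f x \<partial>lborel) = (\<integral>g. (\<Prod>b\<in>Basis. ?h b (g b)) \<partial>(\<Pi>\<^sub>M b\<in>Basis. lborel))"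
    by (subst lborel_eq, subst integral_distr) (measurable, simp only: fT)
  also have "\<dots> = (\<Prod>b\<in>(Basis::'a set). integral\<^sup>L lborel (?h b))"
    by (intro product_integral_prod Gaussian_char_real a) auto
  also have "\<dots> = (\<Prod>b\<in>(Basis::'a set). complex_of_real (sqrt (pi / a) * exp (- (z \<bullet> b)\<^sup>2 / (4 * a))))"
    by (intro prod.cong refl Gaussian_char_real a)
  also have "\<dots> = complex_of_real (sqrt (pi / a) ^ DIM('a) * exp (- (norm z)\<^sup>2 / (4 * a)))"
    by (simp add: norm_sq_Basis prod.distrib exp_sum sum_divide_distrib sum_negf[symmetric] flip: of_real_prod)
  also have "sqrt (pi / a) ^ DIM('a) = (pi / a) powr (real DIM('a) / 2)"
    using a by (simp add: powr_half_sqrt[symmetric] powr_powr flip: powr_realpow)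
  finally show "(\<integral>x. ?f x \<partial>lborel)
        = complex_of_real ((pi / a) powr (real DIM('a) / 2) * exp (- (norm z)\<^sup>2 / (4 * a)))" .
qed

lemma Gaussian_integral:
  fixes a :: real assumes a: "0 < a"
  shows "integrable lborel (\<lambda>x::'a::euclidean_space. exp (- a * (norm x)\<^sup>2))"
    and "(\<integral>x. exp (- a * (norm (x::'a))\<^sup>2) \<partial>lborel) = (pi / a) powr (real DIM('a) / 2)"
proof -
  show "integrable lborel (\<lambda>x::'a. exp (- a * (norm x)\<^sup>2))"
    using Gaussian_char(1)[OF a, of "0::'a"] by (simp add: complex_of_real_integrable_eq)
  show "(\<integral>x. exp (- a * (norm (x::'a))\<^sup>2) \<partial>lborel) = (pi / a) powr (real DIM('a) / 2)"
    using Gaussian_char(2)[OF a, of "0::'a"] by simp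
qed

text \<open>The Gauss--Weierstrass kernel: the fundamental solution of the heat equation at time \<open>t\<close>.\<close>

definition heat :: "real \<Rightarrow> 'a::euclidean_space \<Rightarrow> real" where
  "heat t z = (4 * pi * t) powr (- (real DIM('a) / 2)) * exp (- (norm z)\<^sup>2 / (4 * t))"

lemma heat_measurable [measurable]: "heat t \<in> borel_measurable borel"
  unfolding heat_def by measurable

lemma heat_nonneg [simp]: "0 \<le> heat t z" by (simp add: heat_def)

lemma heat_minus_commute: "heat t (x - y) = heat t (y - x)"
  by (simp add: heat_def norm_minus_commute)

lemma heat_integral:
  assumes t: "0 < t"
  shows "integrable lborel (heat t :: 'a::euclidean_space \<Rightarrow> real)"
    and "(\<integral>z. heat t (z::'a) \<partial>lborel) = 1"
proof -
  have e: "heat t = (\<lambda>z::'a. (4 * pi * t) powr (- (real DIM('a) / 2)) * exp (- (1 / (4 * t)) * (norm z)\<^sup>2))"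
    by (auto simp: heat_def)
  show "integrable lborel (heat t :: 'a \<Rightarrow> real)"
    unfolding e using Gaussian_integral(1)[of "1/(4*t)", where 'a='a] t by simp
  have "pi / (1 / (4 * t)) = 4 * pi * t" by simp
  then show "(\<integral>z. heat t (z::'a) \<partial>lborel) = 1"
    unfolding e using Gaussian_integral(2)[of "1/(4*t)", where 'a='a] t
    by (simp add: powr_minus field_simps)
qed

lemma heat_shift_integral:
  fixes y :: "'a::euclidean_space"
  assumes t: "0 < t"
  shows "integrable lborel (\<lambda>x. heat t (y - x))" "(\<integral>x. heat t (y - x) \<partial>lborel) = 1"
proof -
  have "has_bochner_integral (lborel :: 'a measure) (heat t) 1"
    using heat_integral[OF t, where 'a='a] by (simp add: has_bochner_integral_iff)
  then have "has_bochner_integral (distr lborel borel ((+) (- y))) (heat t) 1"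
    by (simp add: lborel_distr_plus)
  then have "has_bochner_integral lborel (\<lambda>x. heat t (- y + x)) 1"
    by (simp add: has_bochner_integral_iff integrable_distr_eq integral_distr)
  moreover have "heat t (- y + x) = heat t (y - x)" for x 
    using heat_minus_commute[of t x y] by simp
  ultimately have "has_bochner_integral lborel (\<lambda>x. heat t (y - x)) 1" by simp
  then show "integrable lborel (\<lambda>x. heat t (y - x))" "(\<integral>x. heat t (y - x) \<partial>lborel) = 1"
    by (auto simp: has_bochner_integral_iff)
qed

lemma nn_integral_heat_shift:
  fixes y :: "'a::euclidean_space"
  assumes t: "0 < t"
  shows "(\<integral>\<^sup>+x. ennreal (heat t (y - x)) \<partial>lborel) = 1"
  using heat_shift_integral[OF t, of y] by (subst nn_integral_eq_integral) auto

lemma integrable_pair_mult: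
  fixes f :: "'a \<Rightarrow> 'c::{real_normed_field, banach, second_countable_topology}"
  assumes "sigma_finite_measure M" "sigma_finite_measure N"
    and f: "integrable M f" and g: "integrable N g"
  shows "integrable (M \<Otimes>\<^sub>M N) (\<lambda>(x, y). f x * g y)"
proof -
  interpret pair_sigma_finite M N using assms(1,2) by (simp add: pair_sigma_finite_def)
  have [measurable]: "f \<in> borel_measurable M" "g \<in> borel_measurable N" using f g by auto
  show ?thesis
    by (rule Fubini_integrable) (use f g in \<open>auto simp: norm_mult\<close>)
qed

section \<open>The heat identity and the isometry of the Fourier integral\<close>

lemma fourier_integral_lborel:
  fixes g :: "'a::euclidean_space \<Rightarrow> complex"
  assumes [measurable]: "g \<in> borel_measurable borel"
  shows "fourier_integral g \<xi> = complex_of_real ((2 * pi) powr (- (real DIM('a) / 2))) *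
     (\<integral>x. cis (- (\<xi> \<bullet> x)) * g x \<partial>lborel)"
  unfolding fourier_integral_def by (subst integral_completion) auto

lemma fourier_integral_measurable:
  fixes g :: "'a::euclidean_space \<Rightarrow> complex"
  assumes [measurable]: "g \<in> borel_measurable borel"
  shows "fourier_integral g \<in> borel_measurable borel"
proof -
  have "(\<lambda>\<xi>. complex_of_real ((2 * pi) powr (- (real DIM('a) / 2))) *
     (\<integral>x. cis (- (\<xi> \<bullet> x)) * g x \<partial>lborel)) \<in> borel_measurable borel"
    by measurable
  also have "(\<lambda>\<xi>. complex_of_real ((2 * pi) powr (- (real DIM('a) / 2))) *
     (\<integral>x. cis (- (\<xi> \<bullet> x)) * g x \<partial>lborel)) = fourier_integral g"
    using fourier_integral_lborel[OF assms] by (intro ext) simp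
  finally show ?thesis .
qed

lemma Fourier_heat_const:
  fixes t :: real assumes t: "0 < t"
  shows "((2 * pi) powr (- (real n / 2)))\<^sup>2 * (pi / t) powr (real n / 2) = (4 * pi * t) powr (- (real n / 2))"
proof -
  have "((2 * pi) powr (- (real n / 2)))\<^sup>2 = ((2 * pi)\<^sup>2) powr (- (real n / 2))"
    by (simp only: power2_eq_square powr_mult)
  moreover have "(pi / t) powr (real n / 2) = (t / pi) powr (- (real n / 2))"
    using t by (simp add: powr_minus powr_divide field_simps)
  ultimately have "((2 * pi) powr (- (real n / 2)))\<^sup>2 * (pi / t) powr (real n / 2) =
      ((2 * pi)\<^sup>2 * (t / pi)) powr (- (real n / 2))"
    by (simp only: powr_mult)
  also have "(2 * pi)\<^sup>2 * (t / pi) = 4 * pi * t" by (simp add: power2_eq_square)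
  finally show ?thesis .
qed

text \<open>The Gaussian factor makes the triple integral in \<open>(\<xi>, x, y)\<close> absolutely convergent. Integrating
  first in \<open>\<xi>\<close> turns the Gaussian into the heat kernel. The left-hand side is the energy of the Fourier
  integral, damped; the right-hand side no longer contains a Fourier transform, so pointwise operations
  on \<open>g\<close> such as taking absolute values can be studied there.\<close>

lemma Fourier_heat_identity:
  fixes g :: "'a::euclidean_space \<Rightarrow> complex"
  assumes g[measurable]: "g \<in> borel_measurable borel" and gi: "integrable lborel g" and t: "0 < t"
  shows "integrable lborel (\<lambda>\<xi>. exp (- t * (norm \<xi>)\<^sup>2) * (norm (fourier_integral g \<xi>))\<^sup>2)"
    and "complex_of_real (\<integral>\<xi>. exp (- t * (norm \<xi>)\<^sup>2) * (norm (fourier_integral g \<xi>))\<^sup>2 \<partial>lborel) =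
      (\<integral>p. complex_of_real (heat t (fst p - snd p)) * (g (fst p) * cnj (g (snd p))) \<partial>(lborel \<Otimes>\<^sub>M lborel))"
proof -
  let ?P = "lborel \<Otimes>\<^sub>M lborel :: ('a \<times> 'a) measure"
  have P: "sigma_finite_measure ?P" by (intro sigma_finite_pair_measure lborel.sigma_finite_measure_axioms)
  interpret Q: pair_sigma_finite "lborel :: 'a measure" ?P
    using P by (simp add: pair_sigma_finite_def lborel.sigma_finite_measure_axioms)
  define c where "c = (2 * pi) powr (- (real DIM('a) / 2))"
  define G where "G p = g (fst p) * cnj (g (snd p))" for p
  have Gi: "integrable ?P G"
    using integrable_pair_mult[OF lborel.sigma_finite_measure_axioms lborel.sigma_finite_measure_axioms gi
        integrable_cnj[OF gi]]
    by (simp add: G_def[abs_def] case_prod_unfold)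
  have [measurable]: "G \<in> borel_measurable ?P" using Gi by auto
  have ci: "integrable lborel (\<lambda>x. cis (- (\<xi> \<bullet> x)) * g x)" for \<xi>
    by (rule Bochner_Integration.integrable_bound[OF gi]) (auto simp: norm_mult)
  let ?E = "\<lambda>\<xi>::'a. complex_of_real (exp (- t * (norm \<xi>)\<^sup>2))"
  have Ei: "integrable lborel ?E"
    using Gaussian_integral(1)[OF t, where 'a='a] by (simp add: complex_of_real_integrable_eq)
  have sq: "complex_of_real ((norm (fourier_integral g \<xi>))\<^sup>2) =
      c\<^sup>2 * (\<integral>p. cis (\<xi> \<bullet> (snd p - fst p)) * G p \<partial>?P)" for \<xi>
  proof -
    let ?h = "\<lambda>x. cis (- (\<xi> \<bullet> x)) * g x"
    have "integrable ?P (\<lambda>(x, y). ?h x * cnj (?h y))"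
      by (intro integrable_pair_mult lborel.sigma_finite_measure_axioms ci integrable_cnj)
    then have "(\<integral>p. (case p of (x, y) \<Rightarrow> ?h x * cnj (?h y)) \<partial>?P) = (\<integral>x. \<integral>y. ?h x * cnj (?h y) \<partial>lborel \<partial>lborel)"
      using lborel_pair.integral_fst'[of "\<lambda>(x, y). ?h x * cnj (?h y)"] by simp
    also have "\<dots> = (\<integral>x. ?h x \<partial>lborel) * (\<integral>y. cnj (?h y) \<partial>lborel)"
      by (simp only: integral_mult_right_zero integral_mult_left_zero)
    also have "(\<integral>y. cnj (?h y) \<partial>lborel) = cnj (\<integral>x. ?h x \<partial>lborel)"
      by (rule integral_bounded_linear[OF bounded_linear_cnj ci])
    also have "(\<lambda>p. (case p of (x, y) \<Rightarrow> ?h x * cnj (?h y))) = (\<lambda>p. cis (\<xi> \<bullet> (snd p - fst p)) * G p)"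
    proof (rule ext, clarify)
      fix x y :: 'a
      have "cis (\<xi> \<bullet> (y - x)) = cis (- (\<xi> \<bullet> x)) * cis (\<xi> \<bullet> y)"
        by (simp add: cis_mult inner_diff_right algebra_simps)
      then show "?h x * cnj (?h y) = cis (\<xi> \<bullet> (snd (x, y) - fst (x, y))) * G (x, y)"
        by (simp add: G_def cis_cnj)
    qed
    finally have "(\<integral>x. ?h x \<partial>lborel) * cnj (\<integral>x. ?h x \<partial>lborel) =
      (\<integral>p. cis (\<xi> \<bullet> (snd p - fst p)) * G p \<partial>?P)" by simp
    moreover have "complex_of_real ((norm (fourier_integral g \<xi>))\<^sup>2) =
        c\<^sup>2 * ((\<integral>x. ?h x \<partial>lborel) * cnj (\<integral>x. ?h x \<partial>lborel))"
      unfolding fourier_integral_lborel[OF g] complex_norm_square c_def[symmetric]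
      by (simp add: power2_eq_square)
    ultimately show ?thesis by simp
  qed
  have "integrable (lborel \<Otimes>\<^sub>M ?P) (\<lambda>(\<xi>, p). ?E \<xi> * G p)"
    by (intro integrable_pair_mult lborel.sigma_finite_measure_axioms P Ei Gi)
  then have I3: "integrable (lborel \<Otimes>\<^sub>M ?P) (\<lambda>(\<xi>, p). ?E \<xi> * (cis (\<xi> \<bullet> (snd p - fst p)) * G p))"
    by (rule Bochner_Integration.integrable_bound) (auto simp: norm_mult)
  have in1: "integrable lborel (\<lambda>\<xi>. \<integral>p. ?E \<xi> * (cis (\<xi> \<bullet> (snd p - fst p)) * G p) \<partial>?P)"
    using Q.integrable_fst'[OF I3] by simp
  have eq1: "c\<^sup>2 * (\<integral>p. ?E \<xi> * (cis (\<xi> \<bullet> (snd p - fst p)) * G p) \<partial>?P) =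
      complex_of_real (exp (- t * (norm \<xi>)\<^sup>2) * (norm (fourier_integral g \<xi>))\<^sup>2)" for \<xi>
  proof -
    have "c\<^sup>2 * (\<integral>p. ?E \<xi> * (cis (\<xi> \<bullet> (snd p - fst p)) * G p) \<partial>?P) =
        ?E \<xi> * (c\<^sup>2 * (\<integral>p. cis (\<xi> \<bullet> (snd p - fst p)) * G p \<partial>?P))"
      by simp
    also have "\<dots> = ?E \<xi> * complex_of_real ((norm (fourier_integral g \<xi>))\<^sup>2)"
      by (simp only: sq)
    finally show ?thesis by simp
  qed
  have "integrable lborel (\<lambda>\<xi>. complex_of_real (exp (- t * (norm \<xi>)\<^sup>2) * (norm (fourier_integral g \<xi>))\<^sup>2))"
    unfolding eq1[symmetric] by (intro integrable_mult_right in1)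
  then show "integrable lborel (\<lambda>\<xi>. exp (- t * (norm \<xi>)\<^sup>2) * (norm (fourier_integral g \<xi>))\<^sup>2)"
    by (simp add: complex_of_real_integrable_eq del: of_real_mult)
  have "complex_of_real (\<integral>\<xi>. exp (- t * (norm \<xi>)\<^sup>2) * (norm (fourier_integral g \<xi>))\<^sup>2 \<partial>lborel) =
     (\<integral>\<xi>. c\<^sup>2 * (\<integral>p. ?E \<xi> * (cis (\<xi> \<bullet> (snd p - fst p)) * G p) \<partial>?P) \<partial>lborel)"
    unfolding eq1 by (rule integral_complex_of_real[symmetric])
  also have "\<dots> = c\<^sup>2 * (\<integral>\<xi>. (\<integral>p. ?E \<xi> * (cis (\<xi> \<bullet> (snd p - fst p)) * G p) \<partial>?P) \<partial>lborel)"
    using in1 by simp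
  also have "(\<integral>\<xi>. (\<integral>p. ?E \<xi> * (cis (\<xi> \<bullet> (snd p - fst p)) * G p) \<partial>?P) \<partial>lborel) =
    (\<integral>p. (\<integral>\<xi>. ?E \<xi> * (cis (\<xi> \<bullet> (snd p - fst p)) * G p) \<partial>lborel) \<partial>?P)"
    by (rule Q.Fubini_integral[symmetric, OF I3])
  also have "c\<^sup>2 * \<dots> = (\<integral>p. c\<^sup>2 * (\<integral>\<xi>. ?E \<xi> * (cis (\<xi> \<bullet> (snd p - fst p)) * G p) \<partial>lborel) \<partial>?P)"
    by simp
  also have "\<dots> = (\<integral>p. complex_of_real (heat t (fst p - snd p)) * G p \<partial>?P)"
  proof (rule Bochner_Integration.integral_cong[OF refl])
    fix p :: "'a \<times> 'a"
    have "(\<integral>\<xi>. ?E \<xi> * (cis (\<xi> \<bullet> (snd p - fst p)) * G p) \<partial>lborel) =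
        (\<integral>\<xi>. ?E \<xi> * cis (\<xi> \<bullet> (snd p - fst p)) \<partial>lborel) * G p"
      by (simp flip: mult.assoc)
    also have "\<dots> = complex_of_real ((pi / t) powr (real DIM('a) / 2) * exp (- (norm (snd p - fst p))\<^sup>2 / (4 * t))) * G p"
      by (subst Gaussian_char(2)[OF t]) simp
    finally have "c\<^sup>2 * (\<integral>\<xi>. ?E \<xi> * (cis (\<xi> \<bullet> (snd p - fst p)) * G p) \<partial>lborel) =
       complex_of_real (c\<^sup>2 * (pi / t) powr (real DIM('a) / 2) * exp (- (norm (snd p - fst p))\<^sup>2 / (4 * t))) * G p"
      by simp
    also have "c\<^sup>2 * (pi / t) powr (real DIM('a) / 2) * exp (- (norm (snd p - fst p))\<^sup>2 / (4 * t)) = heat t (fst p - snd p)"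
      unfolding c_def Fourier_heat_const[OF t] heat_def by (simp add: norm_minus_commute)
    finally show "c\<^sup>2 * (\<integral>\<xi>. ?E \<xi> * (cis (\<xi> \<bullet> (snd p - fst p)) * G p) \<partial>lborel) =
      complex_of_real (heat t (fst p - snd p)) * G p" .
  qed
  finally show "complex_of_real (\<integral>\<xi>. exp (- t * (norm \<xi>)\<^sup>2) * (norm (fourier_integral g \<xi>))\<^sup>2 \<partial>lborel) =
      (\<integral>p. complex_of_real (heat t (fst p - snd p)) * (g (fst p) * cnj (g (snd p))) \<partial>?P)"
    unfolding G_def .
qed

text \<open>Twice the quadratic form of \<open>1 - e\<^sup>t\<^sup>\<Delta>\<close>. It measures how far the heat identity at time \<open>t\<close> is
  from the isometry of the Fourier transform.\<close>

definition heat_form :: "real \<Rightarrow> ('a::euclidean_space \<Rightarrow> complex) \<Rightarrow> ennreal" where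
  "heat_form t g = (\<integral>\<^sup>+x. \<integral>\<^sup>+y. ennreal (heat t (x - y) * (norm (g x - g y))\<^sup>2) \<partial>lborel \<partial>lborel)"

text \<open>Both marginals of the measure with density \<open>heat t (x - y)\<close> are Lebesgue measure, because
  the heat kernel has total mass 1.\<close>

lemma heat_form_weight:
  fixes g :: "'a::euclidean_space \<Rightarrow> complex"
  assumes [measurable]: "g \<in> borel_measurable borel" and t: "0 < t"
  shows "(\<integral>\<^sup>+x. \<integral>\<^sup>+y. ennreal (heat t (x - y) * (norm (g x))\<^sup>2) \<partial>lborel \<partial>lborel) = energy lborel g"
    and "(\<integral>\<^sup>+x. \<integral>\<^sup>+y. ennreal (heat t (x - y) * (norm (g y))\<^sup>2) \<partial>lborel \<partial>lborel) = energy lborel g"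
proof -
  have *: "(\<integral>\<^sup>+y. ennreal (heat t (x - y) * (norm (g x))\<^sup>2) \<partial>lborel) = ennreal ((norm (g x))\<^sup>2)" for x
    using nn_integral_heat_shift[OF t, of x] by (simp add: ennreal_mult nn_integral_multc)
  then show 1: "(\<integral>\<^sup>+x. \<integral>\<^sup>+y. ennreal (heat t (x - y) * (norm (g x))\<^sup>2) \<partial>lborel \<partial>lborel) = energy lborel g"
    by (simp add: energy_def)
  have "(\<integral>\<^sup>+x. \<integral>\<^sup>+y. ennreal (heat t (x - y) * (norm (g y))\<^sup>2) \<partial>lborel \<partial>lborel) =
    (\<integral>\<^sup>+y. \<integral>\<^sup>+x. ennreal (heat t (x - y) * (norm (g y))\<^sup>2) \<partial>lborel \<partial>lborel)"
    by (rule lborel_pair.Fubini') measurable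
  also have "\<dots> = energy lborel g"
    unfolding 1[symmetric] by (simp add: heat_minus_commute)
  finally show "(\<integral>\<^sup>+x. \<integral>\<^sup>+y. ennreal (heat t (x - y) * (norm (g y))\<^sup>2) \<partial>lborel \<partial>lborel) = energy lborel g" .
qed

text \<open>Expand \<open>\<bar>g x - g y\<bar>\<^sup>2\<close> under the heat kernel: the squares give the energy of \<open>g\<close> twice, the mixed term
  is the right-hand side of the heat identity.\<close>

lemma heat_form_identity:
  fixes g :: "'a::euclidean_space \<Rightarrow> complex"
  assumes g[measurable]: "g \<in> borel_measurable borel" and gi: "integrable lborel g" and t: "0 < t"
    and g2: "energy lborel g < \<infinity>"
  shows "2 * (\<integral>\<^sup>+\<xi>. ennreal (exp (- t * (norm \<xi>)\<^sup>2) * (norm (fourier_integral g \<xi>))\<^sup>2) \<partial>lborel) + heat_form t g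
     = 2 * energy lborel g"
proof -
  let ?P = "lborel \<Otimes>\<^sub>M lborel :: ('a \<times> 'a) measure"
  let ?K = "\<lambda>p::'a\<times>'a. heat t (fst p - snd p)"
  let ?A = "\<lambda>p. ?K p * (norm (g (fst p)))\<^sup>2" and ?B = "\<lambda>p. ?K p * (norm (g (snd p)))\<^sup>2"
  let ?C = "\<lambda>p. complex_of_real (?K p) * (g (fst p) * cnj (g (snd p)))"
  let ?D = "\<lambda>p. ?K p * (norm (g (fst p) - g (snd p)))\<^sup>2"
  have nA: "(\<integral>\<^sup>+p. ennreal (?A p) \<partial>?P) = energy lborel g"
    by (subst heat_form_weight(1)[OF g t, symmetric], subst lborel.nn_integral_fst[symmetric]) auto
  have nB: "(\<integral>\<^sup>+p. ennreal (?B p) \<partial>?P) = energy lborel g"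
    by (subst heat_form_weight(2)[OF g t, symmetric], subst lborel.nn_integral_fst[symmetric]) auto
  have iA: "integrable ?P ?A" and iB: "integrable ?P ?B"
    using g2 nA nB by (auto simp: integrable_iff_bounded abs_mult)
  have iC: "integrable ?P ?C"
  proof (rule Bochner_Integration.integrable_bound[OF Bochner_Integration.integrable_add[OF iA iB]])
    show "AE p in ?P. norm (?C p) \<le> norm (?A p + ?B p)"
    proof (rule AE_I2)
      fix p :: "'a\<times>'a"
      have "norm (g (fst p)) * norm (g (snd p)) \<le> (norm (g (fst p)))\<^sup>2 + (norm (g (snd p)))\<^sup>2"
      proof -
        have "0 \<le> (norm (g (fst p)) - norm (g (snd p)))\<^sup>2" "0 \<le> norm (g (fst p)) * norm (g (snd p))" by simp_all
        then show ?thesis unfolding power2_diff by linarith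
      qed
      then have "?K p * (norm (g (fst p)) * norm (g (snd p))) \<le> ?K p * ((norm (g (fst p)))\<^sup>2 + (norm (g (snd p)))\<^sup>2)"
        by (intro mult_left_mono) auto
      then show "norm (?C p) \<le> norm (?A p + ?B p)"
        by (simp add: norm_mult distrib_left)
    qed
  qed measurable
  have D: "?D p = ?A p + ?B p - 2 * Re (?C p)" for p
    by (simp add: cmod_power2 algebra_simps power2_diff)
  have iD: "integrable ?P ?D"
    unfolding D by (intro Bochner_Integration.integrable_diff Bochner_Integration.integrable_add iA iB integrable_mult_right integrable_Re iC)
  have lA: "ennreal (integral\<^sup>L ?P ?A) = energy lborel g" and lB: "ennreal (integral\<^sup>L ?P ?B) = energy lborel g"
    using nA nB nn_integral_eq_integral[OF iA] nn_integral_eq_integral[OF iB] by simp_all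
  let ?e = "enn2real (energy lborel g)"
  have e: "ennreal ?e = energy lborel g" using g2 by simp
  have rA: "integral\<^sup>L ?P ?A = ?e"
    unfolding lA[symmetric] by (intro enn2real_ennreal[symmetric] integral_nonneg_AE) simp
  have rB: "integral\<^sup>L ?P ?B = ?e"
    unfolding lB[symmetric] by (intro enn2real_ennreal[symmetric] integral_nonneg_AE) simp
  let ?q = "\<integral>\<xi>. exp (- t * (norm \<xi>)\<^sup>2) * (norm (fourier_integral g \<xi>))\<^sup>2 \<partial>lborel"
  have [measurable]: "fourier_integral g \<in> borel_measurable borel" by (rule fourier_integral_measurable) fact
  have q: "?q = Re (integral\<^sup>L ?P ?C)"
    using Fourier_heat_identity(2)[OF g gi t] by (metis Re_complex_of_real)
  have q0: "0 \<le> ?q" by (intro integral_nonneg_AE) auto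
  have nq: "(\<integral>\<^sup>+\<xi>. ennreal (exp (- t * (norm \<xi>)\<^sup>2) * (norm (fourier_integral g \<xi>))\<^sup>2) \<partial>lborel) = ennreal ?q"
    by (rule nn_integral_eq_integral[OF Fourier_heat_identity(1)[OF g gi t]]) auto
  have "integral\<^sup>L ?P ?D = integral\<^sup>L ?P ?A + integral\<^sup>L ?P ?B - 2 * Re (integral\<^sup>L ?P ?C)"
    unfolding D integral_Re[OF iC, symmetric] Bochner_Integration.integral_add[OF iA iB, symmetric] integral_mult_right_zero[symmetric]
    by (intro Bochner_Integration.integral_diff Bochner_Integration.integrable_add iA iB integrable_mult_right integrable_Re iC)
  then have rD: "integral\<^sup>L ?P ?D = 2 * ?e - 2 * ?q" unfolding rA rB q by simp
  have "heat_form t g = (\<integral>\<^sup>+p. ennreal (?D p) \<partial>?P)"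
    unfolding heat_form_def by (subst lborel.nn_integral_fst[symmetric]) auto
  also have "\<dots> = ennreal (2 * ?e - 2 * ?q)"
    unfolding rD[symmetric] by (rule nn_integral_eq_integral[OF iD]) auto
  finally have "heat_form t g = ennreal (2 * ?e - 2 * ?q)" .
  moreover have "0 \<le> 2 * ?e - 2 * ?q" unfolding rD[symmetric] by (intro integral_nonneg_AE) auto
  ultimately have "2 * ennreal ?q + heat_form t g = ennreal (2 * ?e)"
    using q0 by (simp flip: ennreal_plus ennreal_numeral ennreal_mult)
  then show ?thesis unfolding nq by (simp add: ennreal_mult e)
qed

lemma heat_form_add_le:
  fixes f g :: "'a::euclidean_space \<Rightarrow> complex"
  assumes [measurable]: "f \<in> borel_measurable borel" "g \<in> borel_measurable borel"
  shows "heat_form t (\<lambda>x. f x + g x) \<le> 2 * heat_form t f + 2 * heat_form t g"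
proof -
  have pt: "ennreal (heat t (x - y) * (norm (f x + g x - (f y + g y)))\<^sup>2) \<le>
     2 * ennreal (heat t (x - y) * (norm (f x - f y))\<^sup>2) + 2 * ennreal (heat t (x - y) * (norm (g x - g y))\<^sup>2)" for x y
  proof -
    have "(norm (f x + g x - (f y + g y)))\<^sup>2 \<le> (norm (f x - f y) + norm (g x - g y))\<^sup>2"
      using norm_triangle_ineq[of "f x - f y" "g x - g y"] by (intro power_mono) (auto simp: algebra_simps)
    also have "\<dots> \<le> 2 * (norm (f x - f y))\<^sup>2 + 2 * (norm (g x - g y))\<^sup>2"
      using sq_add_weighted[of 1 "norm (f x - f y)" "norm (g x - g y)"] by simp
    finally have "heat t (x - y) * (norm (f x + g x - (f y + g y)))\<^sup>2 \<le>
        heat t (x - y) * (2 * (norm (f x - f y))\<^sup>2 + 2 * (norm (g x - g y))\<^sup>2)"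
      by (intro mult_left_mono) auto
    then show ?thesis
      by (simp add: algebra_simps ennreal_leI flip: ennreal_mult' ennreal_plus ennreal_numeral)
  qed
  have "heat_form t (\<lambda>x. f x + g x) \<le>
     (\<integral>\<^sup>+x. \<integral>\<^sup>+y. 2 * ennreal (heat t (x - y) * (norm (f x - f y))\<^sup>2) + 2 * ennreal (heat t (x - y) * (norm (g x - g y))\<^sup>2) \<partial>lborel \<partial>lborel)"
    unfolding heat_form_def by (intro nn_integral_mono pt)
  also have "\<dots> = 2 * heat_form t f + 2 * heat_form t g"
    unfolding heat_form_def by (simp add: nn_integral_add nn_integral_cmult)
  finally show ?thesis .
qed

lemma heat_form_le_energy:
  fixes g :: "'a::euclidean_space \<Rightarrow> complex"
  assumes [measurable]: "g \<in> borel_measurable borel" and t: "0 < t"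
  shows "heat_form t g \<le> 4 * energy lborel g"
proof -
  have pt: "ennreal (heat t (x - y) * (norm (g x - g y))\<^sup>2) \<le>
     2 * ennreal (heat t (x - y) * (norm (g x))\<^sup>2) + 2 * ennreal (heat t (x - y) * (norm (g y))\<^sup>2)" for x y
  proof -
    have "(norm (g x - g y))\<^sup>2 \<le> (norm (g x) + norm (g y))\<^sup>2"
      by (intro power_mono norm_triangle_ineq4) auto
    also have "\<dots> \<le> 2 * (norm (g x))\<^sup>2 + 2 * (norm (g y))\<^sup>2"
      using sq_add_weighted[of 1 "norm (g x)" "norm (g y)"] by simp
    finally have "heat t (x - y) * (norm (g x - g y))\<^sup>2 \<le>
        heat t (x - y) * (2 * (norm (g x))\<^sup>2 + 2 * (norm (g y))\<^sup>2)"
      by (intro mult_left_mono) auto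
    then show ?thesis
      by (simp add: algebra_simps ennreal_leI flip: ennreal_mult' ennreal_plus ennreal_numeral)
  qed
  have "heat_form t g \<le>
     (\<integral>\<^sup>+x. \<integral>\<^sup>+y. 2 * ennreal (heat t (x - y) * (norm (g x))\<^sup>2) + 2 * ennreal (heat t (x - y) * (norm (g y))\<^sup>2) \<partial>lborel \<partial>lborel)"
    unfolding heat_form_def by (intro nn_integral_mono pt)
  also have "\<dots> = 2 * (\<integral>\<^sup>+x. \<integral>\<^sup>+y. ennreal (heat t (x - y) * (norm (g x))\<^sup>2) \<partial>lborel \<partial>lborel)
     + 2 * (\<integral>\<^sup>+x. \<integral>\<^sup>+y. ennreal (heat t (x - y) * (norm (g y))\<^sup>2) \<partial>lborel \<partial>lborel)"
    by (simp add: nn_integral_add nn_integral_cmult)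
  also have "\<dots> = 2 * energy lborel g + 2 * energy lborel g"
    by (simp only: heat_form_weight[OF assms])
  also have "\<dots> = 4 * energy lborel g" by (simp flip: distrib_right)
  finally show ?thesis .
qed

text \<open>Away from the origin the heat kernel is exponentially small in \<open>1 / t\<close> relative to the heat
  kernel at time \<open>2 t\<close>; comparing with another heat kernel, rather than computing the tail, keeps
  the total mass known.\<close>

lemma heat_tail:
  fixes z :: "'a::euclidean_space"
  assumes t: "0 < t" and d: "0 < d" "d \<le> norm z"
  shows "heat t z \<le> 2 powr (real DIM('a) / 2) * exp (- d\<^sup>2 / (8 * t)) * heat (2 * t) z"
proof -
  have "exp (- (norm z)\<^sup>2 / (4 * t)) = exp (- (norm z)\<^sup>2 / (8 * t)) * exp (- (norm z)\<^sup>2 / (4 * (2 * t)))"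
    by (simp flip: exp_add)
  also have "\<dots> \<le> exp (- d\<^sup>2 / (8 * t)) * exp (- (norm z)\<^sup>2 / (4 * (2 * t)))"
    using d t by (intro mult_right_mono) (auto simp: divide_simps power_mono)
  finally have e: "exp (- (norm z)\<^sup>2 / (4 * t)) \<le> exp (- d\<^sup>2 / (8 * t)) * exp (- (norm z)\<^sup>2 / (4 * (2 * t)))" .
  have "(4 * pi * t) powr (- (real DIM('a) / 2)) = 2 powr (real DIM('a) / 2) * (4 * pi * (2 * t)) powr (- (real DIM('a) / 2))"
  proof -
    have "2 powr (real DIM('a) / 2) * 2 powr (- (real DIM('a) / 2)) = (1::real)" by (simp flip: powr_add)
    then show ?thesis using powr_mult[of 2 "4 * pi * t" "- (real DIM('a) / 2)"] by (simp add: mult_ac)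
  qed
  then have "heat t z = 2 powr (real DIM('a) / 2) * (4 * pi * (2 * t)) powr (- (real DIM('a) / 2)) * exp (- (norm z)\<^sup>2 / (4 * t))"
    unfolding heat_def by simp
  also have "\<dots> \<le> 2 powr (real DIM('a) / 2) * (4 * pi * (2 * t)) powr (- (real DIM('a) / 2)) *
      (exp (- d\<^sup>2 / (8 * t)) * exp (- (norm z)\<^sup>2 / (4 * (2 * t))))"
    by (intro mult_left_mono e) auto
  also have "\<dots> = 2 powr (real DIM('a) / 2) * exp (- d\<^sup>2 / (8 * t)) * heat (2 * t) z"
    unfolding heat_def by (simp only: mult_ac)
  finally show ?thesis .
qed

text \<open>By regularity of Lebesgue measure \<open>A\<close> lies between a compact set \<open>K\<close> and an open set \<open>U\<close> such that
  \<open>U - K\<close> is small. Two points at distance less than that of \<open>K\<close> from the complement of \<open>U\<close> can only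
  be separated by \<open>A\<close> if one of them lies in \<open>U - K\<close>; pairs at a larger distance are handled by the
  Gaussian tail.\<close>

lemma heat_form_indicator_tendsto:
  fixes A :: "'a::euclidean_space set"
  assumes A[measurable]: "A \<in> sets borel" and bA: "bounded A"
  shows "(\<lambda>k. heat_form (inverse (real (Suc k))) (\<lambda>x. indicator A x *\<^sub>R c)) \<longlonglongrightarrow> 0"
proof (rule order_tendstoI)
  fix \<epsilon> :: ennreal assume \<epsilon>: "0 < \<epsilon>"
  let ?c = "(norm c)\<^sup>2"
  define m where "m = measure lborel A"
  have finA: "emeasure lborel A < \<infinity>" using bA by (rule emeasure_bounded_finite)
  then have m: "emeasure lborel A = ennreal m" "0 \<le> m" unfolding m_def
    by (auto simp: emeasure_eq_ennreal_measure)
  from \<epsilon> obtain e0 where e0: "0 < e0" "e0 < \<epsilon>" using dense by blast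
  then have "e0 < top" by (auto intro: less_le_trans)
  define e where "e = enn2real e0"
  have e: "0 < e" "ennreal e < \<epsilon>" using e0 \<open>e0 < top\<close> by (auto simp: e_def enn2real_positive_iff)
  \<comment> \<open>The final bound contains the measure of \<open>U - K\<close>, which is at most \<open>2 * r\<close>, twice, with the factor
    \<open>?c\<close>; the summand 1 only avoids division by 0.\<close>
  define r where "r = e / (8 * (?c + 1))"
  have c1: "0 < ?c + 1" by (simp add: add_nonneg_pos)
  have r: "0 < r" using e c1 by (simp add: r_def)
  have halve: "x * (4 * (e / (8 * x))) = e / 2" if "0 < x" for x :: real using that by simp
  have r': "?c * (4 * r) \<le> e / 2"
  proof -
    have "?c * (4 * r) \<le> (?c + 1) * (4 * r)" using r by (intro mult_right_mono) auto
    also have "\<dots> = e / 2" using halve[OF c1] by (simp only: r_def)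
    finally show ?thesis .
  qed
  have AL: "A \<in> sets lebesgue" by auto
  obtain U where U: "open U" "A \<subseteq> U" "emeasure lebesgue (U - A) < ennreal r"
    by (rule sets_lebesgue_outer_open[OF AL r]) (rule that; assumption)
  obtain K where K: "closed K" "K \<subseteq> A" "emeasure lebesgue (A - K) < ennreal r"
    by (rule sets_lebesgue_inner_closed[OF AL r]) (rule that; assumption)
  have cK: "compact K" using K(1) bounded_subset[OF bA K(2)] by (simp add: compact_eq_bounded_closed)
  obtain d where d: "0 < d" "(\<Union>x\<in>K. ball x d) \<subseteq> U"
    by (rule compact_subset_open_imp_ball_epsilon_subset[OF cK U(1) order_trans[OF K(2) U(2)]]) (rule that; assumption)
  \<comment> \<open>The exceptional set: nearby points separated by \<open>A\<close> meet it.\<close>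
  define V where "V = U - K"
  have [measurable]: "U \<in> sets borel" "K \<in> sets borel" "V \<in> sets borel"
    using U K by (auto simp: V_def)
  have "emeasure lborel V \<le> emeasure lborel ((U - A) \<union> (A - K))"
    by (intro emeasure_mono) (auto simp: V_def)
  also have "\<dots> \<le> emeasure lborel (U - A) + emeasure lborel (A - K)"
    by (intro emeasure_subadditive) auto
  also have "\<dots> \<le> ennreal r + ennreal r"
    using U(3) K(3) by (intro add_mono) auto
  finally have V: "emeasure lborel V \<le> ennreal (2 * r)" using r by (simp flip: ennreal_plus)
  let ?\<eta> = "\<lambda>t. 2 powr (real DIM('a) / 2) * exp (- d\<^sup>2 / (8 * t))"
  have eI: "energy lborel (\<lambda>x. complex_of_real (indicator B x)) = emeasure lborel B" if [measurable]: "B \<in> sets borel" for B :: "'a set"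
  proof -
    have "energy lborel (\<lambda>x. complex_of_real (indicator B x)) = (\<integral>\<^sup>+x. indicator B x \<partial>lborel)"
      unfolding energy_def by (intro nn_integral_cong) (auto simp: indicator_def)
    then show ?thesis by simp
  qed
  have sqI: "(norm (complex_of_real (indicator B x)))\<^sup>2 = indicator B x" for B and x :: 'a
    by (simp add: indicator_def)
  have main: "heat_form t (\<lambda>x. indicator A x *\<^sub>R c) \<le> ennreal (?c * (4 * r) + ?c * ?\<eta> t * (2 * m))" if t: "0 < t" for t
  proof -
    let ?W = "\<lambda>t B x y. ennreal (heat t (x - y) * (norm (complex_of_real (indicator B x)))\<^sup>2) +
           ennreal (heat t (x - y) * (norm (complex_of_real (indicator B y)))\<^sup>2)"
    have pt: "ennreal (heat t (x - y) * (norm (indicator A x *\<^sub>R c - indicator A y *\<^sub>R c))\<^sup>2) \<le>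
        ennreal ?c * ?W t V x y + ennreal (?c * ?\<eta> t) * ?W (2 * t) A x y" for x y
    proof -
      have n: "(norm (indicator A x *\<^sub>R c - indicator A y *\<^sub>R c))\<^sup>2 = ?c * (indicator A x - indicator A y)\<^sup>2"
        by (simp add: power_mult_distrib flip: scaleR_diff_left)
      have "heat t (x - y) * (indicator A x - indicator A y)\<^sup>2 \<le>
         heat t (x - y) * (indicator V x + indicator V y) + ?\<eta> t * heat (2 * t) (x - y) * (indicator A x + indicator A y)"
      proof (cases "dist x y < d")
        case True
        have "(indicator A x - indicator A y)\<^sup>2 \<le> (indicator V x + indicator V y :: real)"
        proof -
          have "y \<in> U" if "x \<in> K" using that d(2) True by (auto simp: subset_eq)
          moreover have "x \<in> U" if "y \<in> K" using that d(2) True by (auto simp: subset_eq dist_commute)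
          ultimately show ?thesis using K U by (auto simp: indicator_def V_def)
        qed
        then have "heat t (x - y) * (indicator A x - indicator A y)\<^sup>2 \<le> heat t (x - y) * (indicator V x + indicator V y)"
          by (intro mult_left_mono) auto
        moreover have "0 \<le> ?\<eta> t * heat (2 * t) (x - y) * (indicator A x + indicator A y)" by simp
        ultimately show ?thesis by linarith
      next
        case False
        then have "heat t (x - y) \<le> ?\<eta> t * heat (2 * t) (x - y)"
          using heat_tail[OF t d(1), of "x - y"] by (simp add: dist_norm)
        moreover have "(indicator A x - indicator A y)\<^sup>2 \<le> (indicator A x + indicator A y :: real)"
          by (auto simp: indicator_def)
        ultimately have "heat t (x - y) * (indicator A x - indicator A y)\<^sup>2 \<le> ?\<eta> t * heat (2 * t) (x - y) * (indicator A x + indicator A y)"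
          by (intro mult_mono) auto
        moreover have "0 \<le> heat t (x - y) * (indicator V x + indicator V y :: real)" by simp
        ultimately show ?thesis by linarith
      qed
      then have "?c * (heat t (x - y) * (indicator A x - indicator A y)\<^sup>2) \<le>
         ?c * (heat t (x - y) * (indicator V x + indicator V y) + ?\<eta> t * heat (2 * t) (x - y) * (indicator A x + indicator A y))"
        by (intro mult_left_mono) auto
      then have "heat t (x - y) * (norm (indicator A x *\<^sub>R c - indicator A y *\<^sub>R c))\<^sup>2 \<le>
        ?c * (heat t (x - y) * (norm (complex_of_real (indicator V x)))\<^sup>2 + heat t (x - y) * (norm (complex_of_real (indicator V y)))\<^sup>2)
         + ?c * ?\<eta> t * (heat (2 * t) (x - y) * (norm (complex_of_real (indicator A x)))\<^sup>2 + heat (2 * t) (x - y) * (norm (complex_of_real (indicator A y)))\<^sup>2)"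
        unfolding n sqI by (simp only: algebra_simps)
      then show ?thesis
        by (simp add: ennreal_leI flip: ennreal_plus ennreal_mult)
    qed
    have "heat_form t (\<lambda>x. indicator A x *\<^sub>R c) \<le>
       (\<integral>\<^sup>+x. \<integral>\<^sup>+y. ennreal ?c * ?W t V x y + ennreal (?c * ?\<eta> t) * ?W (2 * t) A x y \<partial>lborel \<partial>lborel)"
      unfolding heat_form_def by (intro nn_integral_mono pt)
    also have "\<dots> = ennreal ?c * (emeasure lborel V + emeasure lborel V)
        + ennreal (?c * ?\<eta> t) * (emeasure lborel A + emeasure lborel A)"
      using heat_form_weight[of "\<lambda>x. complex_of_real (indicator V x)" t] heat_form_weight[of "\<lambda>x. complex_of_real (indicator A x)" "2 * t"] t
      by (simp add: nn_integral_add nn_integral_cmult eI)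
    also have "\<dots> \<le> ennreal ?c * (ennreal (2 * r) + ennreal (2 * r)) + ennreal (?c * ?\<eta> t) * (ennreal m + ennreal m)"
      using V m by (intro add_mono mult_left_mono) auto
    also have "\<dots> = ennreal (?c * (4 * r) + ?c * ?\<eta> t * (2 * m))"
      using r m by (simp flip: ennreal_plus ennreal_mult add: algebra_simps)
    finally show ?thesis .
  qed
  have "(\<lambda>k. ?c * ?\<eta> (inverse (real (Suc k))) * (2 * m)) \<longlonglongrightarrow> 0"
  proof -
    have "?\<eta> (inverse (real (Suc k))) = 2 powr (real DIM('a) / 2) * exp (- d\<^sup>2 / 8) ^ Suc k" for k
      by (simp add: exp_of_nat_mult[symmetric] field_simps del: power_Suc)
    moreover have "(\<lambda>k. exp (- d\<^sup>2 / 8) ^ Suc k) \<longlonglongrightarrow> 0"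
      using d by (intro LIMSEQ_Suc LIMSEQ_power_zero) auto
    ultimately show ?thesis
      by (auto intro!: tendsto_mult_left_zero tendsto_mult_right_zero)
  qed
  then have "\<forall>\<^sub>F k in sequentially. ?c * ?\<eta> (inverse (real (Suc k))) * (2 * m) < e / 2"
    using e by (intro order_tendstoD) auto
  then show "\<forall>\<^sub>F k in sequentially. heat_form (inverse (real (Suc k))) (\<lambda>x. indicator A x *\<^sub>R c) < \<epsilon>"
  proof eventually_elim
    fix k assume "?c * ?\<eta> (inverse (real (Suc k))) * (2 * m) < e / 2"
    then have "?c * (4 * r) + ?c * ?\<eta> (inverse (real (Suc k))) * (2 * m) \<le> e" using r' by linarith
    then have "heat_form (inverse (real (Suc k))) (\<lambda>x. indicator A x *\<^sub>R c) \<le> ennreal e"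
      using main[of "inverse (real (Suc k))"] by (auto intro: order_trans ennreal_leI)
    then show "heat_form (inverse (real (Suc k))) (\<lambda>x. indicator A x *\<^sub>R c) < \<epsilon>" using e(2) by (rule le_less_trans)
  qed
qed auto

lemma heat_form_step_function_tendsto:
  fixes A :: "complex \<Rightarrow> 'a::euclidean_space set"
  assumes "finite S" and A: "\<And>y. y \<in> S \<Longrightarrow> A y \<in> sets borel" "\<And>y. y \<in> S \<Longrightarrow> bounded (A y)"
  shows "(\<lambda>k. heat_form (inverse (real (Suc k))) (\<lambda>x. \<Sum>y\<in>S. indicator (A y) x *\<^sub>R y)) \<longlonglongrightarrow> 0"
  using assms
proof (induction S rule: finite_induct)
  case empty
  then show ?case by (simp add: heat_form_def)
next
  case (insert z S)
  have [measurable]: "A y \<in> sets borel" if "y \<in> insert z S" for y using insert.prems that by auto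
  let ?t = "\<lambda>k. inverse (real (Suc k))"
  let ?f = "\<lambda>x. indicator (A z) x *\<^sub>R z" and ?g = "\<lambda>x. \<Sum>y\<in>S. indicator (A y) x *\<^sub>R y"
  have le: "heat_form (?t k) (\<lambda>x. ?f x + ?g x) \<le> 2 * heat_form (?t k) ?f + 2 * heat_form (?t k) ?g" for k
    by (intro heat_form_add_le) measurable
  have "(\<lambda>k. heat_form (?t k) ?f) \<longlonglongrightarrow> 0"
    using insert.prems by (intro heat_form_indicator_tendsto) auto
  moreover have "(\<lambda>k. heat_form (?t k) ?g) \<longlonglongrightarrow> 0"
    using insert by auto
  ultimately have "(\<lambda>k. 2 * heat_form (?t k) ?f + 2 * heat_form (?t k) ?g) \<longlonglongrightarrow> 2 * 0 + 2 * 0"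
    by (intro tendsto_add tendsto_mult_ennreal tendsto_const) auto
  then have "(\<lambda>k. heat_form (?t k) (\<lambda>x. ?f x + ?g x)) \<longlonglongrightarrow> 0"
    by (intro tendsto_sandwich[OF _ always_eventually[OF allI[OF le]] tendsto_const]) auto
  then show ?case by (simp only: sum.insert[OF insert.hyps])
qed

text \<open>Simple functions with bounded support are dense in \<open>L\<^sup>2\<close>, and the form is bounded by four times
  the energy uniformly in time, so convergence on simple functions suffices.\<close>

lemma heat_form_tendsto:
  fixes g :: "'a::euclidean_space \<Rightarrow> complex"
  assumes g[measurable]: "g \<in> borel_measurable borel" and g2: "energy lborel g < \<infinity>"
  shows "(\<lambda>k. heat_form (inverse (real (Suc k))) g) \<longlonglongrightarrow> 0"
proof -
  let ?t = "\<lambda>k. inverse (real (Suc k))"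
  obtain F where F: "\<And>i. simple_function lborel (F i)" "\<And>x. (\<lambda>i. F i x) \<longlonglongrightarrow> g x"
      "\<And>i x. norm (F i x) \<le> 2 * norm (g x)"
    using borel_measurable_implies_sequence_metric[of g lborel 0] by auto
  have [measurable]: "F i \<in> borel_measurable borel" for i
    using borel_measurable_simple_function[OF F(1)] by simp
  \<comment> \<open>Truncation gives the level sets bounded support, hence finite measure.\<close>
  define G where "G i x = indicator (ball 0 (real i)) x *\<^sub>R F i x" for i and x :: 'a
  have [measurable]: "G i \<in> borel_measurable borel" for i
    unfolding G_def using borel_measurable_simple_function[OF F(1)[of i]]
    by (intro borel_measurable_scaleR borel_measurable_indicator) auto
  have "(\<lambda>i. G i x) \<longlonglongrightarrow> g x" for x
  proof (rule Lim_transform_eventually[OF F(2)])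
    obtain N where "norm x < real N" using reals_Archimedean2 by blast
    then show "\<forall>\<^sub>F i in sequentially. F i x = G i x"
      by (intro eventually_sequentiallyI[of N]) (auto simp: G_def)
  qed
  moreover have "norm (G i x) \<le> 2 * norm (g x)" for i x
    using F(3)[of i x] by (simp add: G_def indicator_def)
  ultimately have dense: "(\<lambda>i. energy lborel (\<lambda>x. G i x - g x)) \<longlonglongrightarrow> 0"
    by (intro energy_dominated[where C=2]) (use g2 in auto)
  have lim: "(\<lambda>k. heat_form (?t k) (G i)) \<longlonglongrightarrow> 0" for i
  proof -
    let ?S = "G i ` UNIV - {0}" and ?A = "\<lambda>y. G i -` {y}"
    have "finite (F i ` UNIV)" using F(1)[of i] by (auto simp: simple_function_def)
    moreover have "G i ` UNIV \<subseteq> insert 0 (F i ` UNIV)" by (auto simp: G_def indicator_def)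
    ultimately have fin: "finite ?S" by (meson finite_Diff finite_insert finite_subset)
    have "?A y \<in> sets borel" for y
      using measurable_sets[of "G i" borel borel "{y}"] by simp
    moreover have "bounded (?A y)" if "y \<in> ?S" for y
      using that by (intro bounded_subset[OF bounded_ball[of 0 "real i"]]) (auto simp: G_def indicator_def split: if_splits)
    ultimately have "(\<lambda>k. heat_form (?t k) (\<lambda>x. \<Sum>y\<in>?S. indicator (?A y) x *\<^sub>R y)) \<longlonglongrightarrow> 0"
      by (intro heat_form_step_function_tendsto fin) auto
    moreover have "(\<Sum>y\<in>?S. indicator (?A y) x *\<^sub>R y) = G i x" for x
    proof -
      have "(\<Sum>y\<in>?S. indicator (?A y) x *\<^sub>R y) = (\<Sum>y\<in>?S. if y = G i x then y else 0)"
        by (intro sum.cong) auto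
      then show ?thesis using fin by (simp add: sum.delta)
    qed
    ultimately show ?thesis by simp
  qed
  show ?thesis
  proof (rule order_tendstoI)
    fix \<epsilon> :: ennreal assume "0 < \<epsilon>"
    then have \<epsilon>4: "0 < \<epsilon> / 4" "0 < \<epsilon> / 16"
      by (auto simp: zero_less_iff_neq_zero ennreal_divide_eq_0_iff)
    obtain i where i: "energy lborel (\<lambda>x. G i x - g x) < \<epsilon> / 16"
      using order_tendstoD(2)[OF dense \<epsilon>4(2)] by (meson eventually_sequentially order_refl)
    show "\<forall>\<^sub>F k in sequentially. heat_form (?t k) g < \<epsilon>"
      using order_tendstoD(2)[OF lim \<epsilon>4(1)]
    proof eventually_elim
      fix k assume k: "heat_form (?t k) (G i) < \<epsilon> / 4"
      have "heat_form (?t k) g \<le> 2 * heat_form (?t k) (G i) + 2 * heat_form (?t k) (\<lambda>x. g x - G i x)"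
        using heat_form_add_le[of "G i" "\<lambda>x. g x - G i x" "?t k"] by simp
      also have "heat_form (?t k) (\<lambda>x. g x - G i x) \<le> 4 * energy lborel (\<lambda>x. G i x - g x)"
        unfolding energy_commute[of _ "G i"] by (intro heat_form_le_energy) auto
      also have "2 * heat_form (?t k) (G i) + 2 * (4 * energy lborel (\<lambda>x. G i x - g x)) < 2 * (\<epsilon> / 4) + 2 * (4 * (\<epsilon> / 16))"
        using k i by (intro add_strict_mono ennreal_mult_strict_left_mono) auto
      also have "2 * (\<epsilon> / 4) + 2 * (4 * (\<epsilon> / 16)) = \<epsilon>"
      proof (cases \<epsilon>)
        case (real r)
        then show ?thesis by (simp add: divide_ennreal flip: ennreal_numeral ennreal_mult ennreal_plus)
      qed (simp add: ennreal_top_divide ennreal_mult_top)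
      finally show "heat_form (?t k) g < \<epsilon>" by (simp add: add_left_mono mult_left_mono)
    qed
  qed auto
qed

text \<open>Let \<open>t\<close> tend to 0 in the heat identity: the damped energy increases to the full energy of the
  Fourier integral, and the defect vanishes.\<close>

lemma Plancherel_borel:
  fixes g :: "'a::euclidean_space \<Rightarrow> complex"
  assumes g[measurable]: "g \<in> borel_measurable borel" and gi: "integrable lborel g" and g2: "energy lborel g < \<infinity>"
  shows "energy lborel (fourier_integral g) = energy lborel g"
proof -
  let ?t = "\<lambda>k. inverse (real (Suc k))"
  let ?q = "\<lambda>k \<xi>. ennreal (exp (- ?t k * (norm \<xi>)\<^sup>2) * (norm (fourier_integral g \<xi>))\<^sup>2)"
  have [measurable]: "fourier_integral g \<in> borel_measurable borel" by (rule fourier_integral_measurable) fact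
  have "(\<lambda>k. integral\<^sup>N lborel (?q k)) \<longlonglongrightarrow> energy lborel (fourier_integral g)"
    unfolding energy_def
  proof (rule nn_integral_LIMSEQ)
    show "incseq ?q"
    proof (intro incseq_SucI le_funI ennreal_leI mult_right_mono)
      fix k and \<xi> :: 'a
      have "?t (Suc k) * (norm \<xi>)\<^sup>2 \<le> ?t k * (norm \<xi>)\<^sup>2" by (intro mult_right_mono) auto
      then show "exp (- ?t k * (norm \<xi>)\<^sup>2) \<le> exp (- ?t (Suc k) * (norm \<xi>)\<^sup>2)" by simp
    qed auto
    show "(\<lambda>k. ?q k \<xi>) \<longlonglongrightarrow> ennreal ((norm (fourier_integral g \<xi>))\<^sup>2)" for \<xi>
    proof -
      have "(\<lambda>k. exp (- ?t k * (norm \<xi>)\<^sup>2) * (norm (fourier_integral g \<xi>))\<^sup>2) \<longlonglongrightarrow>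
           exp (- 0 * (norm \<xi>)\<^sup>2) * (norm (fourier_integral g \<xi>))\<^sup>2"
        by (intro tendsto_intros LIMSEQ_inverse_real_of_nat)
      then show ?thesis by (intro tendsto_ennrealI) simp
    qed
  qed auto
  then have "(\<lambda>k. 2 * integral\<^sup>N lborel (?q k) + heat_form (?t k) g) \<longlonglongrightarrow> 2 * energy lborel (fourier_integral g) + 0"
    by (intro tendsto_add tendsto_mult_ennreal heat_form_tendsto g g2 tendsto_const) auto
  moreover have "2 * integral\<^sup>N lborel (?q k) + heat_form (?t k) g = 2 * energy lborel g" for k
    by (rule heat_form_identity[OF g gi _ g2]) simp
  ultimately have "(\<lambda>k::nat. 2 * energy lborel g) \<longlonglongrightarrow> 2 * energy lborel (fourier_integral g)" by simp
  then have "2 * energy lborel g = 2 * energy lborel (fourier_integral g)"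
    by (simp add: LIMSEQ_const_iff)
  then show ?thesis by (simp add: ennreal_mult_cancel_left)
qed

section \<open>The Fourier transform of square integrable functions\<close>

lemma energy_lebesgue: "energy lebesgue f = energy lborel f"
  unfolding energy_def by (rule nn_integral_completion)

lemma L2_measurable: "u \<in> L2 \<Longrightarrow> u \<in> borel_measurable lebesgue"
  and L2_energy: "u \<in> L2 \<Longrightarrow> energy lebesgue u < \<infinity>"
  by (simp_all add: L2_iff)

lemma L2_add: assumes "u \<in> L2" "v \<in> L2" shows "(\<lambda>x. u x + v x) \<in> L2"
proof -
  have [measurable]: "u \<in> borel_measurable lebesgue" "v \<in> borel_measurable lebesgue" using assms by (auto simp: L2_iff)
  have "energy lebesgue (\<lambda>x. u x + v x) \<le> 2 * energy lebesgue u + 2 * energy lebesgue v"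
    by (intro energy_add) measurable
  also have "\<dots> < \<infinity>" using assms by (auto simp: L2_iff ennreal_mult_less_top)
  finally show ?thesis by (simp add: L2_iff)
qed

lemma L2_scaleR: assumes "u \<in> L2" shows "(\<lambda>x. c *\<^sub>R u x) \<in> L2"
  using assms by (auto simp: L2_iff energy_scaleR ennreal_mult_less_top)

lemma L2_mult: "u \<in> L2 \<Longrightarrow> (\<lambda>x. c * u x :: real) \<in> L2"
  using L2_scaleR[of u c] by simp

lemma L2_diff: assumes "u \<in> L2" "v \<in> L2" shows "(\<lambda>x. u x - v x) \<in> L2"
  using L2_add[OF assms(1) L2_scaleR[OF assms(2), of "-1"]] by simp

lemma L2_bound:
  assumes [measurable]: "u \<in> borel_measurable lebesgue" and "v \<in> L2" "AE x in lebesgue. norm (u x) \<le> norm (v x)"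
  shows "u \<in> L2"
  using le_less_trans[OF energy_mono_AE[OF assms(3)], of \<infinity>] assms(2) by (simp add: L2_iff)

lemma L2_of_real: "u \<in> L2 \<Longrightarrow> (\<lambda>x. complex_of_real (u x)) \<in> L2"
  by (auto simp: L2_iff energy_def)

lemma L2_cnj: "u \<in> L2 \<Longrightarrow> (\<lambda>x. cnj (u x)) \<in> L2"
  by (auto simp: L2_iff energy_def intro: measurable_compose[OF _ cnj_measurable])

text \<open>Fubini arguments need Borel functions on the uncompleted measure, while the Fourier transform is
  defined for Lebesgue measurable functions.\<close>

lemma borel_representative:
  fixes g :: "'a::euclidean_space \<Rightarrow> complex"
  assumes [measurable]: "g \<in> borel_measurable lebesgue"
  obtains g' where "g' \<in> borel_measurable borel" "AE x in lebesgue. g x = g' x"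
proof -
  have "(\<lambda>x. Re (g x)) \<in> borel_measurable lebesgue" "(\<lambda>x. Im (g x)) \<in> borel_measurable lebesgue" by measurable
  then obtain a b where ab[measurable]: "a \<in> borel_measurable borel" "b \<in> borel_measurable borel"
    and "AE x in lborel. Re (g x) = a x" "AE x in lborel. Im (g x) = b x"
    using completion_ex_borel_measurable_real by (metis measurable_lborel2)
  then have ae: "AE x in lebesgue. Re (g x) = a x" "AE x in lebesgue. Im (g x) = b x"
    by (auto intro: AE_completion)
  show thesis
  proof (rule that[of "\<lambda>x. complex_of_real (a x) + \<i> * complex_of_real (b x)"])
    show "AE x in lebesgue. g x = complex_of_real (a x) + \<i> * complex_of_real (b x)"
      using ae by eventually_elim (simp add: complex_eq_iff)
  qed measurable
qed

lemma fourier_integral_cong_AE: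
  assumes [measurable]: "g \<in> borel_measurable lebesgue" "g' \<in> borel_measurable lebesgue"
    and "AE x in lebesgue. g x = g' x"
  shows "fourier_integral g = fourier_integral g'"
proof
  fix \<xi> :: 'a
  have [measurable]: "(\<lambda>x. cis (- (\<xi> \<bullet> x))) \<in> borel_measurable lebesgue"
    by (rule measurable_completion) measurable
  have "(\<integral>x. cis (- (\<xi> \<bullet> x)) * g x \<partial>lebesgue) = (\<integral>x. cis (- (\<xi> \<bullet> x)) * g' x \<partial>lebesgue)"
    using assms(3) by (intro integral_cong_AE) auto
  then show "fourier_integral g \<xi> = fourier_integral g' \<xi>" by (simp add: fourier_integral_def)
qed

lemma integrable_representative:
  fixes g :: "'a::euclidean_space \<Rightarrow> complex"
  assumes gi: "integrable lebesgue g"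
  obtains g' where "g' \<in> borel_measurable borel" "integrable lborel g'" "AE x in lebesgue. g x = g' x"
    "fourier_integral g = fourier_integral g'"
proof -
  have gm: "g \<in> borel_measurable lebesgue" using gi by auto
  obtain g' where g': "g' \<in> borel_measurable borel" "AE x in lebesgue. g x = g' x"
    using borel_representative[OF gm] .
  have g'm: "g' \<in> borel_measurable lebesgue" using g'(1) by (intro measurable_completion) simp
  have "integrable lebesgue g'" using gi integrable_cong_AE[OF gm g'm g'(2)] by simp
  then have "integrable lborel g'" using g'(1) integrable_completion[of g' lborel] by simp
  with g' fourier_integral_cong_AE[OF gm g'm g'(2)] show thesis by (intro that) auto
qed

lemma fourier_integral_borel:
  assumes "integrable lebesgue g"
  shows "fourier_integral g \<in> borel_measurable borel"
proof -
  obtain g' where "g' \<in> borel_measurable borel" "fourier_integral g = fourier_integral g'"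
    by (rule integrable_representative[OF assms])
  then show ?thesis using fourier_integral_measurable[of g'] by simp
qed

lemma fourier_integral_borel_measurable:
  assumes "integrable lebesgue g"
  shows "fourier_integral g \<in> borel_measurable lebesgue"
  using fourier_integral_borel[OF assms] by (intro measurable_completion) simp

lemma Plancherel_integrable:
  assumes gi: "integrable lebesgue g" and g2: "energy lebesgue g < \<infinity>"
  shows "energy lebesgue (fourier_integral g) = energy lebesgue g"
proof -
  obtain g' where g': "g' \<in> borel_measurable borel" "integrable lborel g'" "AE x in lebesgue. g x = g' x"
    "fourier_integral g = fourier_integral g'" using integrable_representative[OF gi] .
  have e: "energy lebesgue g = energy lborel g'"
    unfolding energy_lebesgue[symmetric] using g'(3) by (intro energy_cong_AE) auto
  then show ?thesis using Plancherel_borel[OF g'(1,2)] g2 by (simp add: g'(4) energy_lebesgue)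
qed

lemma fourier_kernel_integrable:
  fixes g :: "'a::euclidean_space \<Rightarrow> complex"
  assumes "integrable lebesgue g"
  shows "integrable lebesgue (\<lambda>x. cis (- (\<xi> \<bullet> x)) * g x)"
proof -
  have [measurable]: "(\<lambda>x. cis (- (\<xi> \<bullet> x))) \<in> borel_measurable lebesgue"
    by (rule measurable_completion) measurable
  show ?thesis by (rule Bochner_Integration.integrable_bound[OF assms]) (use assms in \<open>auto simp: norm_mult\<close>)
qed

lemma fourier_integral_add:
  assumes "integrable lebesgue f" "integrable lebesgue g"
  shows "fourier_integral (\<lambda>x. f x + g x) \<xi> = fourier_integral f \<xi> + fourier_integral g \<xi>"
  unfolding fourier_integral_def distrib_left
    Bochner_Integration.integral_add[OF fourier_kernel_integrable[OF assms(1)] fourier_kernel_integrable[OF assms(2)]] ..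

lemma fourier_integral_mult:
  "fourier_integral (\<lambda>x. c * f x) \<xi> = c * fourier_integral f \<xi>"
  unfolding fourier_integral_def by (simp add: mult.left_commute[of _ c])

lemma fourier_integral_diff:
  assumes "integrable lebesgue f" "integrable lebesgue g"
  shows "fourier_integral (\<lambda>x. f x - g x) \<xi> = fourier_integral f \<xi> - fourier_integral g \<xi>"
  unfolding fourier_integral_def right_diff_distrib
    Bochner_Integration.integral_diff[OF fourier_kernel_integrable[OF assms(1)] fourier_kernel_integrable[OF assms(2)]] ..

text \<open>The truncation to balls that occurs in the definition of the Fourier transform.\<close>

definition cutoff :: "real \<Rightarrow> ('a::euclidean_space \<Rightarrow> complex) \<Rightarrow> 'a \<Rightarrow> complex" where
  "cutoff R g = (\<lambda>x. indicator (cball 0 R) x * g x)"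

lemma has_fourier_transform_iff:
  "has_fourier_transform g h \<longleftrightarrow> g \<in> L2 \<and> h \<in> L2 \<and>
     ((\<lambda>R. energy lebesgue (\<lambda>\<xi>. fourier_integral (cutoff R g) \<xi> - h \<xi>)) \<longlongrightarrow> 0) at_top"
  unfolding has_fourier_transform_def energy_def cutoff_def ..

lemma cutoff_L2: assumes "g \<in> L2" shows "cutoff R g \<in> L2"
proof (rule L2_bound[OF _ assms])
  have [measurable]: "g \<in> borel_measurable lebesgue" by (rule L2_measurable) fact
  have [measurable]: "cball 0 R \<in> sets lebesgue" by auto
  show "cutoff R g \<in> borel_measurable lebesgue" unfolding cutoff_def by measurable
qed (auto simp: cutoff_def indicator_def)

lemma integrable_bounded_support:
  fixes u :: "'a::euclidean_space \<Rightarrow> 'b::{euclidean_space, real_normed_field}"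
  assumes "u \<in> L2" and S: "S \<in> lmeasurable" and z: "AE x in lebesgue. x \<notin> S \<longrightarrow> u x = 0"
  shows "integrable lebesgue u"
proof -
  have [measurable]: "u \<in> borel_measurable lebesgue" by (rule L2_measurable) fact
  have [measurable]: "S \<in> sets lebesgue" using S by auto
  have "energy lebesgue (\<lambda>x. indicator S x :: 'b) = (\<integral>\<^sup>+x. indicator S x \<partial>lebesgue)"
    unfolding energy_def by (intro nn_integral_cong) (auto simp: indicator_def)
  also have "\<dots> < \<infinity>" using S by (simp add: fmeasurable_def)
  finally have "energy lebesgue (\<lambda>x. indicator S x :: 'b) < \<infinity>" .
  then have "integrable lebesgue (\<lambda>x. indicator S x * u x)"
    using assms(1) by (intro integrable_mult_L2) (auto simp: L2_iff)
  moreover have "AE x in lebesgue. indicator S x * u x = u x"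
    using z by eventually_elim (auto simp: indicator_def)
  ultimately show ?thesis by (subst (asm) integrable_cong_AE) auto
qed

lemma cutoff_integrable: assumes "g \<in> L2" shows "integrable lebesgue (cutoff R g)"
  by (rule integrable_bounded_support[OF cutoff_L2[OF assms], of "cball 0 R"])
     (auto simp: cutoff_def lmeasurable_cball)

lemma cutoff_fourier_measurable:
  "g \<in> L2 \<Longrightarrow> fourier_integral (cutoff R g) \<in> borel_measurable lebesgue"
  by (intro fourier_integral_borel_measurable cutoff_integrable)

lemma Plancherel_cutoff: "g \<in> L2 \<Longrightarrow> energy lebesgue (fourier_integral (cutoff R g)) = energy lebesgue (cutoff R g)"
  by (intro Plancherel_integrable cutoff_integrable L2_energy cutoff_L2)

lemma Plancherel_cutoff_diff:
  assumes g: "g \<in> L2"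
  shows "energy lebesgue (\<lambda>\<xi>. fourier_integral (cutoff R g) \<xi> - fourier_integral (cutoff S g) \<xi>)
     = energy lebesgue (\<lambda>x. cutoff R g x - cutoff S g x)"
proof -
  have "energy lebesgue (fourier_integral (\<lambda>x. cutoff R g x - cutoff S g x)) = energy lebesgue (\<lambda>x. cutoff R g x - cutoff S g x)"
    by (intro Plancherel_integrable Bochner_Integration.integrable_diff cutoff_integrable L2_energy L2_diff cutoff_L2 g)
  then show ?thesis
    unfolding fourier_integral_diff[OF cutoff_integrable[OF g] cutoff_integrable[OF g], abs_def] .
qed

lemma cutoff_tendsto_seq:
  assumes g: "g \<in> L2" and X: "filterlim X at_top sequentially"
  shows "(\<lambda>n. energy lebesgue (\<lambda>x. cutoff (X n) g x - g x)) \<longlonglongrightarrow> 0"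
proof (rule energy_dominated[where C=1])
  show "AE x in lebesgue. (\<lambda>n. cutoff (X n) g x) \<longlonglongrightarrow> g x"
  proof (rule AE_I2)
    fix x :: 'a
    have "\<forall>\<^sub>F n in sequentially. norm x \<le> X n" using X by (simp add: filterlim_at_top)
    then have "\<forall>\<^sub>F n in sequentially. cutoff (X n) g x = g x"
      by eventually_elim (simp add: cutoff_def)
    then show "(\<lambda>n. cutoff (X n) g x) \<longlonglongrightarrow> g x" by (rule tendsto_eventually)
  qed
  show "AE x in lebesgue. norm (cutoff (X n) g x) \<le> 1 * norm (g x)" for n
    by (simp add: cutoff_def indicator_def)
  show "energy lebesgue g < \<infinity>" by (rule L2_energy[OF g])
qed (use g in \<open>auto intro: L2_measurable cutoff_L2\<close>)

lemma cutoff_tendsto: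
  assumes g: "g \<in> L2"
  shows "((\<lambda>R. energy lebesgue (\<lambda>x. cutoff R g x - g x)) \<longlongrightarrow> 0) at_top"
  by (intro tendsto_at_topI_sequentially cutoff_tendsto_seq g)

text \<open>By the isometry on integrable functions the transforms of the truncations form a Cauchy sequence.
  The limit along integer radii is the limit along all radii, because the distance of two truncated
  transforms is controlled by that of the truncations.\<close>

lemma fourier_transform_exists:
  fixes g :: "'a::euclidean_space \<Rightarrow> complex"
  assumes g: "g \<in> L2"
  obtains h where "has_fourier_transform g h"
proof -
  let ?T = "\<lambda>R. cutoff R g" and ?F = "\<lambda>R. fourier_integral (cutoff R g)"
  have [measurable]: "g \<in> borel_measurable lebesgue" "\<And>R. ?T R \<in> borel_measurable lebesgue" "\<And>R. ?F R \<in> borel_measurable lebesgue"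
    using g by (auto intro: L2_measurable cutoff_L2 cutoff_fourier_measurable)
  have le: "energy lebesgue (\<lambda>\<xi>. ?F R \<xi> - ?F S \<xi>) \<le>
      2 * energy lebesgue (\<lambda>x. ?T R x - g x) + 2 * energy lebesgue (\<lambda>x. ?T S x - g x)" for R S
    unfolding Plancherel_cutoff_diff[OF g]
    using energy_diff[of "\<lambda>x. ?T R x - g x" lebesgue "\<lambda>x. ?T S x - g x"] by simp
  have seq: "(\<lambda>n. energy lebesgue (\<lambda>x. ?T (real n) x - g x)) \<longlonglongrightarrow> 0"
    by (intro cutoff_tendsto_seq g filterlim_real_sequentially)
  obtain h r where h[measurable]: "h \<in> borel_measurable lebesgue"
      and hlim: "(\<lambda>n. energy lebesgue (\<lambda>x. ?F (real n) x - h x)) \<longlonglongrightarrow> 0"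
  proof (rule Riesz_Fischer[of "\<lambda>n. ?F (real n)" lebesgue])
    fix e :: real assume "0 < e"
    then have "0 < ennreal (e / 4)" by simp
    from order_tendstoD(2)[OF seq this] obtain N where
      N: "\<And>n. n \<ge> N \<Longrightarrow> energy lebesgue (\<lambda>x. ?T (real n) x - g x) < ennreal (e / 4)"
      unfolding eventually_sequentially by blast
    show "\<exists>N. \<forall>m\<ge>N. \<forall>n\<ge>N. energy lebesgue (\<lambda>x. ?F (real m) x - ?F (real n) x) < ennreal e"
    proof (intro exI allI impI)
      fix m n assume "N \<le> m" "N \<le> n"
      then have "2 * energy lebesgue (\<lambda>x. ?T (real m) x - g x) + 2 * energy lebesgue (\<lambda>x. ?T (real n) x - g x)
          < 2 * ennreal (e / 4) + 2 * ennreal (e / 4)"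
        by (intro add_strict_mono ennreal_mult_strict_left_mono N) auto
      also have "\<dots> = ennreal e" using \<open>0 < e\<close>
        by (simp flip: ennreal_mult' ennreal_numeral ennreal_plus)
      finally show "energy lebesgue (\<lambda>x. ?F (real m) x - ?F (real n) x) < ennreal e"
        using le by (rule le_less_trans[rotated])
    qed
  qed auto
  have "energy lebesgue (\<lambda>\<xi>. ?F R \<xi> - h \<xi>) \<le> 4 * energy lebesgue (\<lambda>x. ?T R x - g x)" for R
  proof -
    let ?B = "\<lambda>n. 2 * (2 * energy lebesgue (\<lambda>x. ?T R x - g x) + 2 * energy lebesgue (\<lambda>x. ?T (real n) x - g x))
       + 2 * energy lebesgue (\<lambda>x. ?F (real n) x - h x)"
    have "energy lebesgue (\<lambda>\<xi>. ?F R \<xi> - h \<xi>) \<le> ?B n" for n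
    proof -
      have "energy lebesgue (\<lambda>\<xi>. ?F R \<xi> - h \<xi>) \<le> 2 * energy lebesgue (\<lambda>\<xi>. ?F R \<xi> - ?F (real n) \<xi>) + 2 * energy lebesgue (\<lambda>\<xi>. ?F (real n) \<xi> - h \<xi>)"
        using energy_add[of "\<lambda>\<xi>. ?F R \<xi> - ?F (real n) \<xi>" lebesgue "\<lambda>\<xi>. ?F (real n) \<xi> - h \<xi>"] by simp
      also have "\<dots> \<le> ?B n" by (intro add_mono mult_left_mono le) auto
      finally show ?thesis .
    qed
    moreover have "?B \<longlonglongrightarrow> 2 * (2 * energy lebesgue (\<lambda>x. ?T R x - g x) + 2 * 0) + 2 * 0"
      by (intro tendsto_add tendsto_mult_ennreal tendsto_const seq hlim) auto
    ultimately have "energy lebesgue (\<lambda>\<xi>. ?F R \<xi> - h \<xi>) \<le> 2 * (2 * energy lebesgue (\<lambda>x. ?T R x - g x) + 2 * 0) + 2 * 0"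
      by (intro LIMSEQ_le_const[of ?B]) auto
    then show ?thesis by (simp flip: mult.assoc)
  qed
  moreover have "((\<lambda>R. 4 * energy lebesgue (\<lambda>x. ?T R x - g x)) \<longlongrightarrow> 0) at_top"
    using tendsto_mult_ennreal[OF tendsto_const[of 4] cutoff_tendsto[OF g]] by simp
  ultimately have lim: "((\<lambda>R. energy lebesgue (\<lambda>\<xi>. ?F R \<xi> - h \<xi>)) \<longlongrightarrow> 0) at_top"
    by (rule tendsto_0_le_ennreal)
  have "h \<in> L2"
  proof -
    obtain n where n: "energy lebesgue (\<lambda>x. ?F (real n) x - h x) < 1"
      using order_tendstoD(2)[OF hlim, of 1] by (auto simp: eventually_sequentially)
    have "energy lebesgue h \<le> 2 * energy lebesgue (?F (real n)) + 2 * energy lebesgue (\<lambda>x. ?F (real n) x - h x)"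
      using energy_diff[of "?F (real n)" lebesgue "\<lambda>x. ?F (real n) x - h x"] by simp
    also have "\<dots> < \<infinity>"
      using less_trans[OF n ennreal_one_less_top] L2_energy[OF cutoff_L2[OF g]]
      by (auto simp: Plancherel_cutoff[OF g] ennreal_mult_less_top)
    finally show ?thesis by (simp add: L2_iff)
  qed
  with lim g show thesis by (intro that) (simp add: has_fourier_transform_iff)
qed

lemma has_fourier_transformD:
  assumes "has_fourier_transform g h"
  shows "g \<in> L2" "h \<in> L2" "g \<in> borel_measurable lebesgue" "h \<in> borel_measurable lebesgue"
    "energy lebesgue g < \<infinity>" "energy lebesgue h < \<infinity>"
    "(\<lambda>n. energy lebesgue (\<lambda>\<xi>. fourier_integral (cutoff (real n) g) \<xi> - h \<xi>)) \<longlonglongrightarrow> 0"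
proof -
  have *: "g \<in> L2" "h \<in> L2" "((\<lambda>R. energy lebesgue (\<lambda>\<xi>. fourier_integral (cutoff R g) \<xi> - h \<xi>)) \<longlongrightarrow> 0) at_top"
    using assms by (simp_all add: has_fourier_transform_iff)
  then show "g \<in> L2" "h \<in> L2" "g \<in> borel_measurable lebesgue" "h \<in> borel_measurable lebesgue"
    "energy lebesgue g < \<infinity>" "energy lebesgue h < \<infinity>"
    by (simp_all add: L2_iff)
  show "(\<lambda>n. energy lebesgue (\<lambda>\<xi>. fourier_integral (cutoff (real n) g) \<xi> - h \<xi>)) \<longlonglongrightarrow> 0"
    by (rule filterlim_compose[OF *(3) filterlim_real_sequentially])
qed

lemma Plancherel:
  assumes gh: "has_fourier_transform g h"
  shows "energy lebesgue h = energy lebesgue g"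
proof -
  note g = has_fourier_transformD[OF gh]
  have [measurable]: "cutoff (real n) g \<in> borel_measurable lebesgue" for n
    by (intro L2_measurable cutoff_L2 g)
  have inc: "incseq (\<lambda>n x. ennreal ((norm (cutoff (real n) g x))\<^sup>2))"
    by (intro incseq_SucI le_funI ennreal_leI power_mono) (auto simp: cutoff_def indicator_def)
  have pt: "(\<lambda>n. ennreal ((norm (cutoff (real n) g x))\<^sup>2)) \<longlonglongrightarrow> ennreal ((norm (g x))\<^sup>2)" for x
  proof (rule tendsto_eventually)
    obtain N where "norm x < real N" using reals_Archimedean2 by blast
    then show "\<forall>\<^sub>F n in sequentially. ennreal ((norm (cutoff (real n) g x))\<^sup>2) = ennreal ((norm (g x))\<^sup>2)"
      by (intro eventually_sequentiallyI[of N]) (auto simp: cutoff_def)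
  qed
  have "(\<lambda>n. energy lebesgue (cutoff (real n) g)) \<longlonglongrightarrow> energy lebesgue g"
    unfolding energy_def by (rule nn_integral_LIMSEQ[OF inc _ pt]) measurable
  then have lim: "(\<lambda>n. energy lebesgue (fourier_integral (cutoff (real n) g))) \<longlonglongrightarrow> energy lebesgue g"
    by (simp only: Plancherel_cutoff[OF g(1)])
  show ?thesis
    by (rule energy_limit_unique[OF _ g(4) g(7) lim]) (auto intro: cutoff_fourier_measurable g)
qed

lemma has_fourier_transform_add:
  assumes "has_fourier_transform g h" "has_fourier_transform g' h'"
  shows "has_fourier_transform (\<lambda>x. g x + g' x) (\<lambda>\<xi>. h \<xi> + h' \<xi>)"
proof -
  note g = has_fourier_transformD[OF assms(1)] and g' = has_fourier_transformD[OF assms(2)]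
  have [measurable]: "h \<in> borel_measurable lebesgue" "h' \<in> borel_measurable lebesgue" using g g' by auto
  have [measurable]: "fourier_integral (cutoff R g) \<in> borel_measurable lebesgue" "fourier_integral (cutoff R g') \<in> borel_measurable lebesgue" for R
    using g g' by (auto intro: cutoff_fourier_measurable)
  have "cutoff R (\<lambda>x. g x + g' x) = (\<lambda>x. cutoff R g x + cutoff R g' x)" for R
    by (auto simp: cutoff_def distrib_left)
  then have F: "fourier_integral (cutoff R (\<lambda>x. g x + g' x)) \<xi> = fourier_integral (cutoff R g) \<xi> + fourier_integral (cutoff R g') \<xi>" for R \<xi>
    using g g' by (simp add: fourier_integral_add cutoff_integrable)
  have "energy lebesgue (\<lambda>\<xi>. fourier_integral (cutoff R (\<lambda>x. g x + g' x)) \<xi> - (h \<xi> + h' \<xi>)) \<le>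
     2 * energy lebesgue (\<lambda>\<xi>. fourier_integral (cutoff R g) \<xi> - h \<xi>) + 2 * energy lebesgue (\<lambda>\<xi>. fourier_integral (cutoff R g') \<xi> - h' \<xi>)" for R
    using energy_add[of "\<lambda>\<xi>. fourier_integral (cutoff R g) \<xi> - h \<xi>" lebesgue "\<lambda>\<xi>. fourier_integral (cutoff R g') \<xi> - h' \<xi>"]
    by (simp add: F add_diff_add)
  moreover have "((\<lambda>R. 2 * energy lebesgue (\<lambda>\<xi>. fourier_integral (cutoff R g) \<xi> - h \<xi>) + 2 * energy lebesgue (\<lambda>\<xi>. fourier_integral (cutoff R g') \<xi> - h' \<xi>)) \<longlongrightarrow> 0) at_top"
  proof -
    have "((\<lambda>R. 2 * energy lebesgue (\<lambda>\<xi>. fourier_integral (cutoff R g) \<xi> - h \<xi>) + 2 * energy lebesgue (\<lambda>\<xi>. fourier_integral (cutoff R g') \<xi> - h' \<xi>)) \<longlongrightarrow> 2 * 0 + 2 * 0) at_top"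
      using assms by (intro tendsto_add tendsto_mult_ennreal tendsto_const) (auto simp: has_fourier_transform_iff)
    then show ?thesis by simp
  qed
  ultimately have "((\<lambda>R. energy lebesgue (\<lambda>\<xi>. fourier_integral (cutoff R (\<lambda>x. g x + g' x)) \<xi> - (h \<xi> + h' \<xi>))) \<longlongrightarrow> 0) at_top"
    by (rule tendsto_0_le_ennreal)
  then show ?thesis using g(1,2) g'(1,2) by (simp add: has_fourier_transform_iff L2_add)
qed

lemma has_fourier_transform_scaleR:
  assumes "has_fourier_transform g h"
  shows "has_fourier_transform (\<lambda>x. c *\<^sub>R g x) (\<lambda>\<xi>. c *\<^sub>R h \<xi>)"
proof -
  note g = has_fourier_transformD[OF assms(1)]
  have [measurable]: "h \<in> borel_measurable lebesgue" using g by auto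
  have [measurable]: "fourier_integral (cutoff R g) \<in> borel_measurable lebesgue" for R
    using g by (auto intro: cutoff_fourier_measurable)
  have "cutoff R (\<lambda>x. c *\<^sub>R g x) = (\<lambda>x. complex_of_real c * cutoff R g x)" for R
    by (auto simp: cutoff_def scaleR_conv_of_real)
  then have "energy lebesgue (\<lambda>\<xi>. fourier_integral (cutoff R (\<lambda>x. c *\<^sub>R g x)) \<xi> - c *\<^sub>R h \<xi>) =
     energy lebesgue (\<lambda>\<xi>. c *\<^sub>R (fourier_integral (cutoff R g) \<xi> - h \<xi>))" for R
    by (simp add: fourier_integral_mult scaleR_conv_of_real right_diff_distrib)
  then have "energy lebesgue (\<lambda>\<xi>. fourier_integral (cutoff R (\<lambda>x. c *\<^sub>R g x)) \<xi> - c *\<^sub>R h \<xi>) =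
     ennreal (c\<^sup>2) * energy lebesgue (\<lambda>\<xi>. fourier_integral (cutoff R g) \<xi> - h \<xi>)" for R
    by (simp add: energy_scaleR)
  moreover have "((\<lambda>R. ennreal (c\<^sup>2) * energy lebesgue (\<lambda>\<xi>. fourier_integral (cutoff R g) \<xi> - h \<xi>)) \<longlongrightarrow> ennreal (c\<^sup>2) * 0) at_top"
    using assms by (intro tendsto_mult_ennreal tendsto_const) (auto simp: has_fourier_transform_iff)
  ultimately show ?thesis using g(1,2) by (simp add: has_fourier_transform_iff L2_scaleR)
qed

lemma has_fourier_transform_diff:
  assumes "has_fourier_transform g h" "has_fourier_transform g' h'"
  shows "has_fourier_transform (\<lambda>x. g x - g' x) (\<lambda>\<xi>. h \<xi> - h' \<xi>)"
  using has_fourier_transform_add[OF assms(1) has_fourier_transform_scaleR[OF assms(2), of "-1"]] by simp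

lemma L2_cong_AE:
  assumes "u \<in> L2" "v \<in> borel_measurable lebesgue" "AE x in lebesgue. u x = v x"
  shows "v \<in> L2"
proof (rule L2_bound[OF assms(2,1)])
  show "AE x in lebesgue. norm (v x) \<le> norm (u x)"
    using assms(3) by eventually_elim simp
qed

lemma has_fourier_transform_cong_AE:
  assumes gh: "has_fourier_transform g h" and m: "g' \<in> borel_measurable lebesgue" "h' \<in> borel_measurable lebesgue"
    and ae: "AE x in lebesgue. g x = g' x" "AE x in lebesgue. h x = h' x"
  shows "has_fourier_transform g' h'"
proof -
  note g = has_fourier_transformD[OF gh]
  have L: "g' \<in> L2" "h' \<in> L2" using g m ae by (auto intro: L2_cong_AE)
  have "fourier_integral (cutoff R g) = fourier_integral (cutoff R g')" for R
  proof (intro fourier_integral_cong_AE L2_measurable cutoff_L2 g L)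
    show "AE x in lebesgue. cutoff R g x = cutoff R g' x"
      using ae(1) by eventually_elim (simp add: cutoff_def)
  qed
  moreover have "energy lebesgue (\<lambda>\<xi>. fourier_integral (cutoff R g') \<xi> - h \<xi>) =
     energy lebesgue (\<lambda>\<xi>. fourier_integral (cutoff R g') \<xi> - h' \<xi>)" for R
  proof (rule energy_cong_AE)
    show "AE \<xi> in lebesgue. norm (fourier_integral (cutoff R g') \<xi> - h \<xi>) = norm (fourier_integral (cutoff R g') \<xi> - h' \<xi>)"
      using ae(2) by eventually_elim simp
  qed
  ultimately show ?thesis using gh L by (simp add: has_fourier_transform_iff)
qed

text \<open>Plancherel applied to a difference; the same argument shows injectivity.\<close>

lemma fourier_transform_unique:
  assumes "has_fourier_transform g h" "has_fourier_transform g h'"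
  shows "AE \<xi> in lebesgue. h \<xi> = h' \<xi>"
proof -
  have d: "has_fourier_transform (\<lambda>x. g x - g x) (\<lambda>\<xi>. h \<xi> - h' \<xi>)"
    by (rule has_fourier_transform_diff[OF assms])
  have "energy lebesgue (\<lambda>\<xi>. h \<xi> - h' \<xi>) = 0"
    unfolding Plancherel[OF d] by (simp add: energy_def)
  then show ?thesis using has_fourier_transformD(4)[OF d] by (simp add: energy_eq_0_iff)
qed

lemma fourier_transform_injective:
  assumes "has_fourier_transform g h" "has_fourier_transform g' h'" "AE \<xi> in lebesgue. h \<xi> = h' \<xi>"
  shows "AE x in lebesgue. g x = g' x"
proof -
  have d: "has_fourier_transform (\<lambda>x. g x - g' x) (\<lambda>\<xi>. h \<xi> - h' \<xi>)"
    by (rule has_fourier_transform_diff[OF assms(1,2)])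
  have "energy lebesgue (\<lambda>\<xi>. h \<xi> - h' \<xi>) = 0"
    using assms(3) has_fourier_transformD(4)[OF d] by (subst energy_eq_0_iff) auto
  then show ?thesis using has_fourier_transformD(3)[OF d] Plancherel[OF d] by (simp add: energy_eq_0_iff)
qed

section \<open>Fourier inversion, surjectivity and real functions\<close>

text \<open>Fubini, and the symmetry of the kernel in \<open>\<xi>\<close> and \<open>x\<close>.\<close>

lemma multiplication_formula_integrable:
  fixes f g :: "'a::euclidean_space \<Rightarrow> complex"
  assumes "integrable lebesgue f" "integrable lebesgue g"
  shows "(\<integral>x. fourier_integral f x * g x \<partial>lebesgue) = (\<integral>x. f x * fourier_integral g x \<partial>lebesgue)"
proof -
  obtain f' where f': "f' \<in> borel_measurable borel" "integrable lborel f'" "AE x in lebesgue. f x = f' x"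
    "fourier_integral f = fourier_integral f'" by (rule integrable_representative[OF assms(1)])
  obtain g' where g': "g' \<in> borel_measurable borel" "integrable lborel g'" "AE x in lebesgue. g x = g' x"
    "fourier_integral g = fourier_integral g'" by (rule integrable_representative[OF assms(2)])
  note [measurable] = f'(1) g'(1) fourier_integral_measurable[OF f'(1)] fourier_integral_measurable[OF g'(1)]
  have [measurable]: "f \<in> borel_measurable lebesgue" "g \<in> borel_measurable lebesgue" using assms by auto
  have [measurable]: "f' \<in> borel_measurable lebesgue" "g' \<in> borel_measurable lebesgue"
     "fourier_integral f' \<in> borel_measurable lebesgue" "fourier_integral g' \<in> borel_measurable lebesgue"
    by (auto intro: measurable_completion)
  define c where "c = complex_of_real ((2 * pi) powr (- (real DIM('a) / 2)))"
  have FI: "integrable (lborel \<Otimes>\<^sub>M lborel) (\<lambda>(\<xi>, x). c * (cis (- (\<xi> \<bullet> x)) * f' x) * g' \<xi>)"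
  proof (rule Bochner_Integration.integrable_bound)
    show "integrable (lborel \<Otimes>\<^sub>M lborel) (\<lambda>(\<xi>, x). (c * g' \<xi>) * f' x)"
      by (intro integrable_pair_mult lborel.sigma_finite_measure_axioms f' integrable_mult_right g')
  qed (auto simp: norm_mult mult_ac)
  have "(\<integral>x. fourier_integral f x * g x \<partial>lebesgue) = (\<integral>x. fourier_integral f' x * g' x \<partial>lebesgue)"
    unfolding f'(4)
  proof (rule integral_cong_AE)
    show "AE x in lebesgue. fourier_integral f' x * g x = fourier_integral f' x * g' x"
      using g'(3) by eventually_elim simp
  qed measurable
  also have "\<dots> = (\<integral>\<xi>. fourier_integral f' \<xi> * g' \<xi> \<partial>lborel)" by (rule integral_completion) measurable
  also have "\<dots> = (\<integral>\<xi>. (\<integral>x. c * (cis (- (\<xi> \<bullet> x)) * f' x) * g' \<xi> \<partial>lborel) \<partial>lborel)"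
    by (simp add: fourier_integral_lborel c_def f'(1))
  also have "\<dots> = (\<integral>x. (\<integral>\<xi>. c * (cis (- (\<xi> \<bullet> x)) * f' x) * g' \<xi> \<partial>lborel) \<partial>lborel)"
    by (rule lborel_pair.Fubini_integral[symmetric, OF FI])
  also have "\<dots> = (\<integral>x. (\<integral>\<xi>. f' x * (c * (cis (- (x \<bullet> \<xi>)) * g' \<xi>)) \<partial>lborel) \<partial>lborel)"
    by (intro Bochner_Integration.integral_cong refl) (simp add: mult_ac inner_commute)
  also have "\<dots> = (\<integral>x. f' x * fourier_integral g' x \<partial>lborel)"
    by (simp add: fourier_integral_lborel c_def g'(1))
  also have "\<dots> = (\<integral>x. f' x * fourier_integral g' x \<partial>lebesgue)" by (rule integral_completion[symmetric]) measurable
  also have "\<dots> = (\<integral>x. f x * fourier_integral g x \<partial>lebesgue)"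
    unfolding g'(4)
  proof (rule integral_cong_AE)
    show "AE x in lebesgue. f' x * fourier_integral g' x = f x * fourier_integral g' x"
      using f'(3) by eventually_elim simp
  qed measurable
  finally show ?thesis .
qed

lemma multiplication_formula:
  fixes f g :: "'a::euclidean_space \<Rightarrow> complex"
  assumes fh: "has_fourier_transform f h" and gk: "has_fourier_transform g k"
  shows "(\<integral>x. h x * g x \<partial>lebesgue) = (\<integral>x. f x * k x \<partial>lebesgue)"
proof -
  note f = has_fourier_transformD[OF fh] and g = has_fourier_transformD[OF gk]
  note cut = cutoff_tendsto_seq[OF _ filterlim_real_sequentially]
  have F: "energy lebesgue (fourier_integral (cutoff (real n) u)) < \<infinity>" if "u \<in> L2" for n and u :: "'a \<Rightarrow> complex"
    using Plancherel_cutoff[OF that] L2_energy[OF cutoff_L2[OF that]] by simp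
  have "(\<lambda>n. \<integral>x. fourier_integral (cutoff (real n) f) x * cutoff (real n) g x \<partial>lebesgue) \<longlonglongrightarrow> (\<integral>x. h x * g x \<partial>lebesgue)"
    by (rule integral_mult_tendsto[OF f(4) g(3) _ _ f(6) g(5) _ _ f(7) cut[OF g(1)]])
       (intro cutoff_fourier_measurable f g L2_measurable cutoff_L2 L2_energy F)+
  moreover have "(\<lambda>n. \<integral>x. cutoff (real n) f x * fourier_integral (cutoff (real n) g) x \<partial>lebesgue) \<longlonglongrightarrow> (\<integral>x. f x * k x \<partial>lebesgue)"
    by (rule integral_mult_tendsto[OF f(3) g(4) _ _ f(5) g(6) _ _ cut[OF f(1)] g(7)])
       (intro cutoff_fourier_measurable f g L2_measurable cutoff_L2 L2_energy F)+
  moreover have "(\<integral>x. fourier_integral (cutoff (real n) f) x * cutoff (real n) g x \<partial>lebesgue) =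
      (\<integral>x. cutoff (real n) f x * fourier_integral (cutoff (real n) g) x \<partial>lebesgue)" for n
    by (intro multiplication_formula_integrable cutoff_integrable f g)
  ultimately show ?thesis by (simp add: LIMSEQ_unique)
qed

text \<open>The inverse transform is the conjugate of the transform of the conjugate. Expand the squared
  distance of \<open>cnj k\<close> and \<open>g\<close>: by Plancherel both squares equal the energy of \<open>g\<close>, and by the
  multiplication formula the mixed term is the energy of \<open>h\<close>, which is the same number. Hence the
  distance is 0.\<close>

lemma fourier_inversion:
  assumes gh: "has_fourier_transform g h" and hk: "has_fourier_transform (\<lambda>\<xi>. cnj (h \<xi>)) k"
  shows "AE x in lebesgue. cnj (k x) = g x"
proof -
  note g = has_fourier_transformD[OF gh] and k = has_fourier_transformD[OF hk]
  note [measurable] = g(3,4) k(4)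
  let ?e = "enn2real (energy lebesgue g)"
  have ek: "energy lebesgue k = energy lebesgue g"
    using Plancherel[OF hk] Plancherel[OF gh] by (simp add: energy_cnj)
  have "(\<integral>x. k x * g x \<partial>lebesgue) = (\<integral>x. cnj (h x) * h x \<partial>lebesgue)"
    by (rule multiplication_formula[OF hk gh])
  also have "\<dots> = (\<integral>x. complex_of_real ((norm (h x))\<^sup>2) \<partial>lebesgue)"
    by (intro Bochner_Integration.integral_cong refl) (simp only: complex_norm_square mult.commute)
  also have "\<dots> = complex_of_real ?e"
    using integral_norm_sq[OF g(4)] Plancherel[OF gh] by (simp del: of_real_power)
  finally have kg: "(\<integral>x. k x * g x \<partial>lebesgue) = complex_of_real ?e" .
  have ikg: "integrable lebesgue (\<lambda>x. k x * g x)" by (rule integrable_mult_L2[OF k(4) g(3) k(6) g(5)])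
  have ik: "integrable lebesgue (\<lambda>x. (norm (k x))\<^sup>2)" and ig: "integrable lebesgue (\<lambda>x. (norm (g x))\<^sup>2)"
    using k(6) g(5) by (simp_all add: integrable_norm_sq_iff)
  \<comment> \<open>The mixed term contains \<open>k x * g x\<close> without conjugation, as in the multiplication formula.\<close>
  have pt: "(norm (cnj (k x) - g x))\<^sup>2 = (norm (k x))\<^sup>2 + (norm (g x))\<^sup>2 - 2 * Re (k x * g x)" for x
    unfolding cmod_power2 by (simp add: algebra_simps power2_eq_square)
  have "(\<integral>x. (norm (cnj (k x) - g x))\<^sup>2 \<partial>lebesgue) =
     (\<integral>x. (norm (k x))\<^sup>2 \<partial>lebesgue) + (\<integral>x. (norm (g x))\<^sup>2 \<partial>lebesgue) - 2 * Re (\<integral>x. k x * g x \<partial>lebesgue)"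
    unfolding pt integral_Re[OF ikg, symmetric] Bochner_Integration.integral_add[OF ik ig, symmetric] integral_mult_right_zero[symmetric]
    by (intro Bochner_Integration.integral_diff Bochner_Integration.integrable_add ik ig integrable_mult_right integrable_Re ikg)
  also have "\<dots> = 0"
    unfolding integral_norm_sq[OF k(4)] integral_norm_sq[OF g(3)] kg ek by simp
  finally have z: "(\<integral>x. (norm (cnj (k x) - g x))\<^sup>2 \<partial>lebesgue) = 0" .
  have "(\<lambda>x. cnj (k x) - g x) \<in> L2" by (intro L2_diff L2_cnj k g)
  then have "energy lebesgue (\<lambda>x. cnj (k x) - g x) = 0"
    using z by (subst (asm) integral_norm_sq) (auto simp: L2_iff enn2real_eq_0_iff)
  then show ?thesis by (subst (asm) energy_eq_0_iff) auto
qed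

lemma fourier_transform_surjective:
  fixes h :: "'a::euclidean_space \<Rightarrow> complex"
  assumes h: "h \<in> L2"
  obtains g where "has_fourier_transform g h"
proof -
  obtain k where k: "has_fourier_transform (\<lambda>x. cnj (h x)) k"
    by (rule fourier_transform_exists[OF L2_cnj[OF h]])
  obtain m where m: "has_fourier_transform (\<lambda>x. cnj (k x)) m"
    by (rule fourier_transform_exists[OF L2_cnj[OF has_fourier_transformD(2)[OF k]]])
  have "AE x in lebesgue. cnj (m x) = cnj (h x)" by (rule fourier_inversion[OF k m])
  then have "AE x in lebesgue. m x = h x" by eventually_elim simp
  then have "has_fourier_transform (\<lambda>x. cnj (k x)) h"
    by (intro has_fourier_transform_cong_AE[OF m has_fourier_transformD(3)[OF m] L2_measurable[OF h]]) auto
  then show thesis by (rule that)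
qed

lemma lborel_distr_uminus_euclidean: "distr lborel borel (uminus :: 'a \<Rightarrow> 'a::euclidean_space) = lborel"
proof -
  have "(lborel :: 'a measure) = density (distr lborel borel (\<lambda>x. 0 + (-1) *\<^sub>R x)) (\<lambda>_. ennreal (\<bar>-1\<bar> ^ DIM('a)))"
    using lborel_affine[of "-1" "0::'a"] by simp
  then show ?thesis by (simp add: density_1)
qed

lemma uminus_measurable_lebesgue [measurable]: "uminus \<in> measurable lebesgue (lebesgue :: 'a::euclidean_space measure)"
  using lebesgue_affine_measurable[where c="\<lambda>_::'a. -1" and t=0]
  by (simp add: sum_negf euclidean_representation)

lemma AE_lebesgue_uminus:
  assumes "AE x in (lebesgue :: 'a::euclidean_space measure). P x"
  shows "AE x in (lebesgue :: 'a measure). P (- x)"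
proof -
  obtain N where N: "N \<in> null_sets (lborel :: 'a measure)" "{x. \<not> P x} \<subseteq> N"
    using assms unfolding AE_completion_iff by (auto simp: eventually_ae_filter)
  have Nb: "N \<in> sets borel" using N by (auto simp: null_sets_def)
  have "emeasure lborel (uminus -` N) = emeasure (distr lborel borel uminus) N"
    using Nb by (subst emeasure_distr) auto
  then have "uminus -` N \<in> null_sets (lborel :: 'a measure)"
    using N Nb measurable_sets[of uminus borel borel N] by (simp add: lborel_distr_uminus_euclidean null_sets_def)
  then have "AE x in (lborel :: 'a measure). P (- x)"
    by (rule AE_I') (use N(2) in auto)
  then show ?thesis by (rule AE_completion)
qed

text \<open>Conjugating a function reflects and conjugates its transform, so the transform of a conjugate
  is square integrable by reflection invariance.\<close>

lemma energy_uminus_arg: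
  fixes f :: "'a::euclidean_space \<Rightarrow> complex"
  assumes f: "f \<in> borel_measurable lebesgue"
  shows "energy lebesgue (\<lambda>x. f (- x)) = energy lebesgue f"
proof -
  obtain f' where f'[measurable]: "f' \<in> borel_measurable borel" and ae: "AE x in lebesgue. f x = f' x"
    by (rule borel_representative[OF f])
  have "energy lebesgue (\<lambda>x. f (- x)) = energy lborel (\<lambda>x. f' (- x))"
    unfolding energy_lebesgue[symmetric]
    by (rule energy_cong_AE) (use AE_lebesgue_uminus[OF ae] in \<open>eventually_elim, simp\<close>)
  also have "\<dots> = energy (distr lborel borel uminus) f'"
    unfolding energy_def by (subst nn_integral_distr) auto
  also have "\<dots> = energy lebesgue f'" by (simp add: lborel_distr_uminus_euclidean energy_lebesgue)
  also have "\<dots> = energy lebesgue f" by (rule energy_cong_AE) (use ae in \<open>eventually_elim, simp\<close>)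
  finally show ?thesis .
qed

lemma fourier_integral_cnj: "fourier_integral (\<lambda>x. cnj (g x)) \<xi> = cnj (fourier_integral g (- \<xi>))"
proof -
  have "(\<integral>x. cis (- (\<xi> \<bullet> x)) * cnj (g x) \<partial>lebesgue) = (\<integral>x. cnj (cis (- (- \<xi> \<bullet> x)) * g x) \<partial>lebesgue)"
    by (simp add: cis_cnj)
  also have "\<dots> = cnj (\<integral>x. cis (- (- \<xi> \<bullet> x)) * g x \<partial>lebesgue)"
    by (rule integral_bounded_linear'[OF bounded_linear_cnj bounded_linear_cnj]) simp
  finally show ?thesis by (simp add: fourier_integral_def)
qed

lemma has_fourier_transform_cnj:
  assumes gh: "has_fourier_transform g h"
  shows "has_fourier_transform (\<lambda>x. cnj (g x)) (\<lambda>\<xi>. cnj (h (- \<xi>)))"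
proof -
  note g = has_fourier_transformD[OF gh]
  have "(\<lambda>\<xi>. h (- \<xi>)) \<in> L2"
    using measurable_compose[OF uminus_measurable_lebesgue g(4)] energy_uminus_arg[OF g(4)] g(6) by (simp add: L2_iff)
  then have hL: "(\<lambda>\<xi>. cnj (h (- \<xi>))) \<in> L2" by (rule L2_cnj)
  have e: "energy lebesgue (\<lambda>\<xi>. fourier_integral (cutoff R (\<lambda>x. cnj (g x))) \<xi> - cnj (h (- \<xi>))) =
    energy lebesgue (\<lambda>\<xi>. fourier_integral (cutoff R g) \<xi> - h \<xi>)" for R
  proof -
    have "cutoff R (\<lambda>x. cnj (g x)) = (\<lambda>x. cnj (cutoff R g x))" by (auto simp: cutoff_def indicator_def)
    then have "energy lebesgue (\<lambda>\<xi>. fourier_integral (cutoff R (\<lambda>x. cnj (g x))) \<xi> - cnj (h (- \<xi>))) =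
      energy lebesgue (\<lambda>\<xi>. cnj (fourier_integral (cutoff R g) (- \<xi>) - h (- \<xi>)))"
      by (simp add: fourier_integral_cnj)
    also have "\<dots> = energy lebesgue (\<lambda>\<xi>. fourier_integral (cutoff R g) (- \<xi>) - h (- \<xi>))"
      by (rule energy_cnj)
    also have "\<dots> = energy lebesgue (\<lambda>\<xi>. fourier_integral (cutoff R g) \<xi> - h \<xi>)"
      using cutoff_fourier_measurable[OF g(1)] g(4) by (intro energy_uminus_arg[of "\<lambda>\<xi>. fourier_integral (cutoff R g) \<xi> - h \<xi>"]) auto
    finally show ?thesis .
  qed
  show ?thesis using gh hL L2_cnj[OF g(1)] by (simp add: has_fourier_transform_iff e)
qed

text \<open>A preimage under the Fourier transform is a priori complex valued. The transform of a real function
  is Hermitian, and stays so after multiplication by a real even function; therefore the conjugate of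
  the preimage has the same transform, and so has its real part.\<close>

lemma even_multiplier_preserves_real:
  fixes u :: "'a::euclidean_space \<Rightarrow> real" and m :: "'a \<Rightarrow> real"
  assumes ug: "has_fourier_transform (\<lambda>x. complex_of_real (u x)) g"
    and even: "\<And>\<xi>. m (- \<xi>) = m \<xi>" and L: "(\<lambda>\<xi>. complex_of_real (m \<xi>) * g \<xi>) \<in> L2"
  obtains w where "w \<in> L2" "has_fourier_transform (\<lambda>x. complex_of_real (w x)) (\<lambda>\<xi>. complex_of_real (m \<xi>) * g \<xi>)"
proof -
  let ?h = "\<lambda>\<xi>. complex_of_real (m \<xi>) * g \<xi>"
  obtain w where w: "has_fourier_transform w ?h" by (rule fourier_transform_surjective[OF L])
  have "AE \<xi> in lebesgue. g \<xi> = cnj (g (- \<xi>))"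
    using fourier_transform_unique[OF ug] has_fourier_transform_cnj[OF ug] by simp
  then have "AE \<xi> in lebesgue. cnj (?h (- \<xi>)) = ?h \<xi>" by eventually_elim (simp add: even)
  then have "has_fourier_transform (\<lambda>x. cnj (w x)) ?h"
    by (intro has_fourier_transform_cong_AE[OF has_fourier_transform_cnj[OF w] _ L2_measurable[OF L]])
       (auto intro: L2_measurable L2_cnj has_fourier_transformD(1)[OF w])
  from has_fourier_transform_scaleR[OF has_fourier_transform_add[OF w this], of "1/2"]
  have "has_fourier_transform (\<lambda>x. (1/2) *\<^sub>R (w x + cnj (w x))) (\<lambda>\<xi>. (1/2) *\<^sub>R (?h \<xi> + ?h \<xi>))" .
  moreover have "(\<lambda>x. (1/2) *\<^sub>R (w x + cnj (w x))) = (\<lambda>x. complex_of_real (Re (w x)))"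
    by (rule ext) (simp add: complex_eq_iff)
  moreover have "(\<lambda>\<xi>. (1/2) *\<^sub>R (?h \<xi> + ?h \<xi>)) = ?h"
    by (rule ext) (simp add: complex_eq_iff)
  ultimately have R: "has_fourier_transform (\<lambda>x. complex_of_real (Re (w x))) ?h" by simp
  have "(\<lambda>x. Re (w x)) \<in> L2"
    by (rule L2_bound[OF _ has_fourier_transformD(1)[OF w]])
       (use has_fourier_transformD(3)[OF w] in \<open>auto simp: abs_Re_le_cmod\<close>)
  then show thesis using R by (rule that)
qed

section \<open>The fractional Laplacian and its bilinear form\<close>

lemma has_frac_laplacianD:
  assumes "has_frac_laplacian \<sigma> u w"
  shows "u \<in> L2" "w \<in> L2" "u \<in> borel_measurable lebesgue" "w \<in> borel_measurable lebesgue"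
    "energy lebesgue u < \<infinity>" "energy lebesgue w < \<infinity>"
  using assms by (auto simp: has_frac_laplacian_def L2_iff)

text \<open>The Fourier transform of \<open>u\<close> is determined up to null sets only; this allows the multiplier
  relation to be used with a representative of choice.\<close>

lemma has_frac_laplacianE:
  assumes uw: "has_frac_laplacian \<sigma> u w" and ug: "has_fourier_transform (\<lambda>x. complex_of_real (u x)) g"
  shows "has_fourier_transform (\<lambda>x. complex_of_real (w x)) (\<lambda>\<xi>. complex_of_real (norm \<xi> powr (2 * \<sigma>)) * g \<xi>)"
proof -
  obtain g' h where g': "has_fourier_transform (\<lambda>x. complex_of_real (u x)) g'"
    and h: "has_fourier_transform (\<lambda>x. complex_of_real (w x)) h"
    and ae: "AE \<xi> in lebesgue. h \<xi> = complex_of_real (norm \<xi> powr (2 * \<sigma>)) * g' \<xi>"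
    using uw by (auto simp: has_frac_laplacian_def)
  have [measurable]: "g \<in> borel_measurable lebesgue" by (rule has_fourier_transformD(4)[OF ug])
  have m: "(\<lambda>\<xi>::'a. complex_of_real (norm \<xi> powr (2 * \<sigma>))) \<in> borel_measurable lebesgue"
    by (rule measurable_completion) measurable
  have "AE \<xi> in lebesgue. g' \<xi> = g \<xi>" by (rule fourier_transform_unique[OF g' ug])
  with ae have "AE \<xi> in lebesgue. h \<xi> = complex_of_real (norm \<xi> powr (2 * \<sigma>)) * g \<xi>"
    by eventually_elim simp
  then show ?thesis
    by (intro has_fourier_transform_cong_AE[OF h has_fourier_transformD(3)[OF h] borel_measurable_times[OF m]]) auto
qed

lemma has_frac_laplacianI:
  assumes "u \<in> L2" "w \<in> L2" "has_fourier_transform (\<lambda>x. complex_of_real (u x)) g"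
    "has_fourier_transform (\<lambda>x. complex_of_real (w x)) (\<lambda>\<xi>. complex_of_real (norm \<xi> powr (2 * \<sigma>)) * g \<xi>)"
  shows "has_frac_laplacian \<sigma> u w"
  unfolding has_frac_laplacian_def using assms by blast

lemma has_frac_laplacian_unique:
  assumes "has_frac_laplacian \<sigma> u w" "has_frac_laplacian \<sigma> u w'"
  shows "AE x in lebesgue. w x = w' x"
proof -
  obtain g where g: "has_fourier_transform (\<lambda>x. complex_of_real (u x)) g"
    by (rule fourier_transform_exists[OF L2_of_real[OF has_frac_laplacianD(1)[OF assms(1)]]])
  have "AE x in lebesgue. complex_of_real (w x) = complex_of_real (w' x)"
    by (rule fourier_transform_injective[OF has_frac_laplacianE[OF assms(1) g] has_frac_laplacianE[OF assms(2) g]]) simp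
  then show ?thesis by simp
qed

lemma has_frac_laplacian_add:
  assumes "has_frac_laplacian \<sigma> u w" "has_frac_laplacian \<sigma> u' w'"
  shows "has_frac_laplacian \<sigma> (\<lambda>x. u x + u' x) (\<lambda>x. w x + w' x)"
proof -
  obtain g where g: "has_fourier_transform (\<lambda>x. complex_of_real (u x)) g"
    by (rule fourier_transform_exists[OF L2_of_real[OF has_frac_laplacianD(1)[OF assms(1)]]])
  obtain g' where g': "has_fourier_transform (\<lambda>x. complex_of_real (u' x)) g'"
    by (rule fourier_transform_exists[OF L2_of_real[OF has_frac_laplacianD(1)[OF assms(2)]]])
  show ?thesis
    using has_fourier_transform_add[OF g g']
      has_fourier_transform_add[OF has_frac_laplacianE[OF assms(1) g] has_frac_laplacianE[OF assms(2) g']]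
      has_frac_laplacianD(1,2)[OF assms(1)] has_frac_laplacianD(1,2)[OF assms(2)]
    by (intro has_frac_laplacianI[of _ _ "\<lambda>\<xi>. g \<xi> + g' \<xi>"]) (simp_all add: L2_add distrib_left)
qed

lemma has_frac_laplacian_mult:
  assumes "has_frac_laplacian \<sigma> u w"
  shows "has_frac_laplacian \<sigma> (\<lambda>x. c * u x) (\<lambda>x. c * w x)"
proof -
  obtain g where g: "has_fourier_transform (\<lambda>x. complex_of_real (u x)) g"
    by (rule fourier_transform_exists[OF L2_of_real[OF has_frac_laplacianD(1)[OF assms(1)]]])
  show ?thesis
    using has_fourier_transform_scaleR[OF g, of c] has_fourier_transform_scaleR[OF has_frac_laplacianE[OF assms(1) g], of c]
      has_frac_laplacianD(1,2)[OF assms(1)]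
    by (intro has_frac_laplacianI[of _ _ "\<lambda>\<xi>. c *\<^sub>R g \<xi>"]) (simp_all add: L2_mult scaleR_conv_of_real mult.left_commute)
qed

text \<open>The only obstruction to the existence of \<open>(-\<Delta>)\<^sup>\<sigma> u\<close> in \<open>L\<^sup>2\<close> is the integrability on the Fourier side.
  Absolute values are shown to belong to \<open>Hs\<close> by this criterion.\<close>

lemma has_frac_laplacian_exists:
  assumes u: "u \<in> L2" and g: "has_fourier_transform (\<lambda>x. complex_of_real (u x)) g"
    and fin: "energy lebesgue (\<lambda>\<xi>. complex_of_real (norm \<xi> powr (2 * \<sigma>)) * g \<xi>) < \<infinity>"
  obtains w where "has_frac_laplacian \<sigma> u w"
proof -
  have m: "(\<lambda>\<xi>::'a. complex_of_real (norm \<xi> powr (2 * \<sigma>))) \<in> borel_measurable lebesgue"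
    by (rule measurable_completion) measurable
  have "(\<lambda>\<xi>. complex_of_real (norm \<xi> powr (2 * \<sigma>)) * g \<xi>) \<in> L2"
    using fin borel_measurable_times[OF m has_fourier_transformD(4)[OF g]] by (simp add: L2_iff)
  then obtain w where "w \<in> L2" "has_fourier_transform (\<lambda>x. complex_of_real (w x)) (\<lambda>\<xi>. complex_of_real (norm \<xi> powr (2 * \<sigma>)) * g \<xi>)"
    using even_multiplier_preserves_real[OF g, of "\<lambda>\<xi>. norm \<xi> powr (2 * \<sigma>)"] by auto
  then show thesis using u g that has_frac_laplacianI by blast
qed

lemma has_frac_laplacian_energy:
  assumes "has_frac_laplacian \<sigma> u w" "has_fourier_transform (\<lambda>x. complex_of_real (u x)) g"
  shows "energy lebesgue w = energy lebesgue (\<lambda>\<xi>. complex_of_real (norm \<xi> powr (2 * \<sigma>)) * g \<xi>)"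
  using Plancherel[OF has_frac_laplacianE[OF assms]] by (simp add: energy_of_real)

text \<open>The multiplier vanishes at the origin only.\<close>

lemma has_frac_laplacian_zero:
  assumes uw: "has_frac_laplacian \<sigma> u w" and z: "AE x in lebesgue. w x = 0"
  shows "AE x in lebesgue. u x = 0"
proof -
  obtain g where g: "has_fourier_transform (\<lambda>x. complex_of_real (u x)) g"
    by (rule fourier_transform_exists[OF L2_of_real[OF has_frac_laplacianD(1)[OF uw]]])
  note h = has_frac_laplacianE[OF uw g]
  have "energy lebesgue w = 0" using z has_frac_laplacianD(4)[OF uw] by (simp add: energy_eq_0_iff)
  then have "energy lebesgue (\<lambda>\<xi>. complex_of_real (norm \<xi> powr (2 * \<sigma>)) * g \<xi>) = 0"
    using has_frac_laplacian_energy[OF uw g] by simp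
  then have 1: "AE \<xi> in lebesgue. complex_of_real (norm \<xi> powr (2 * \<sigma>)) * g \<xi> = 0"
    using has_fourier_transformD(4)[OF h] by (simp add: energy_eq_0_iff)
  have 2: "AE \<xi> in lebesgue. \<xi> \<noteq> (0::'a)"
    by (intro AE_completion AE_lborel_singleton)
  from 1 2 have "AE \<xi> in lebesgue. g \<xi> = 0" by eventually_elim simp
  then have "energy lebesgue g = 0" using has_fourier_transformD(4)[OF g] by (simp add: energy_eq_0_iff)
  then have "energy lebesgue u = 0" using Plancherel[OF g] by (simp add: energy_of_real)
  then show ?thesis using has_frac_laplacianD(3)[OF uw] by (simp add: energy_eq_0_iff)
qed

lemma Hs_iff: "u \<in> Hs s \<longleftrightarrow> (\<exists>w. has_frac_laplacian (s / 2) u w)"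
  unfolding Hs_def using has_frac_laplacianD by blast

lemma Hs_frac_laplacian: "u \<in> Hs s \<Longrightarrow> has_frac_laplacian (s / 2) u (frac_laplacian (s / 2) u)"
  unfolding Hs_iff frac_laplacian_def by (rule someI_ex[where P="has_frac_laplacian (s / 2) u"])

lemma Hs_add: "u \<in> Hs s \<Longrightarrow> v \<in> Hs s \<Longrightarrow> (\<lambda>x. u x + v x) \<in> Hs s"
  unfolding Hs_iff using has_frac_laplacian_add by blast

lemma Hs_mult: "u \<in> Hs s \<Longrightarrow> (\<lambda>x. c * u x) \<in> Hs s"
  unfolding Hs_iff using has_frac_laplacian_mult by blast

lemma Hs_diff: "u \<in> Hs s \<Longrightarrow> v \<in> Hs s \<Longrightarrow> (\<lambda>x. u x - v x) \<in> Hs s"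
  using Hs_add[of u s "\<lambda>x. (-1) * v x"] Hs_mult[of v s "-1"] by simp

lemma Hs_tilde_Hs: "u \<in> Hs_tilde s \<Omega> \<Longrightarrow> u \<in> Hs s"
  by (simp add: Hs_tilde_def)

lemma Hs_tilde_add: "u \<in> Hs_tilde s \<Omega> \<Longrightarrow> v \<in> Hs_tilde s \<Omega> \<Longrightarrow> (\<lambda>x. u x + v x) \<in> Hs_tilde s \<Omega>"
  unfolding Hs_tilde_def by (auto intro: Hs_add elim: eventually_elim2)

lemma Hs_tilde_mult: "u \<in> Hs_tilde s \<Omega> \<Longrightarrow> (\<lambda>x. c * u x) \<in> Hs_tilde s \<Omega>"
  unfolding Hs_tilde_def by (auto intro: Hs_mult elim: eventually_mono)

lemma Hs_tilde_diff: "u \<in> Hs_tilde s \<Omega> \<Longrightarrow> v \<in> Hs_tilde s \<Omega> \<Longrightarrow> (\<lambda>x. u x - v x) \<in> Hs_tilde s \<Omega>"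
  using Hs_tilde_add[of u s \<Omega> "\<lambda>x. (-1) * v x"] Hs_tilde_mult[of v s \<Omega> "-1"] by simp

text \<open>The pairing is defined with chosen representatives; by uniqueness any others may be used, which
  makes bilinearity accessible.\<close>

lemma frac_pairing_eq:
  assumes "has_frac_laplacian (s / 2) u w" "has_frac_laplacian (s / 2) v z"
  shows "frac_pairing s u v = (\<integral>x. w x * z x \<partial>lebesgue)"
proof -
  have u: "has_frac_laplacian (s / 2) u (frac_laplacian (s / 2) u)" "has_frac_laplacian (s / 2) v (frac_laplacian (s / 2) v)"
    using assms by (auto intro!: Hs_frac_laplacian simp: Hs_iff)
  show ?thesis
    unfolding frac_pairing_def
  proof (rule integral_cong_AE)
    show "AE x in lebesgue. frac_laplacian (s / 2) u x * frac_laplacian (s / 2) v x = w x * z x"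
      using has_frac_laplacian_unique[OF u(1) assms(1)] has_frac_laplacian_unique[OF u(2) assms(2)]
      by eventually_elim simp
  qed (intro borel_measurable_times has_frac_laplacianD(4)[OF u(1)] has_frac_laplacianD(4)[OF u(2)]
        has_frac_laplacianD(4)[OF assms(1)] has_frac_laplacianD(4)[OF assms(2)])+
qed

lemma frac_pairing_commute: "frac_pairing s u v = frac_pairing s v u"
  by (simp add: frac_pairing_def mult.commute)

lemma frac_pairing_add_left:
  assumes "u \<in> Hs s" "u' \<in> Hs s" "v \<in> Hs s"
  shows "frac_pairing s (\<lambda>x. u x + u' x) v = frac_pairing s u v + frac_pairing s u' v"
proof -
  obtain w w' z where w: "has_frac_laplacian (s / 2) u w" "has_frac_laplacian (s / 2) u' w'" "has_frac_laplacian (s / 2) v z"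
    using assms by (auto simp: Hs_iff)
  have "integrable lebesgue (\<lambda>x. w x * z x)" "integrable lebesgue (\<lambda>x. w' x * z x)"
    by (intro integrable_mult_L2 has_frac_laplacianD[OF w(1)] has_frac_laplacianD[OF w(2)] has_frac_laplacianD[OF w(3)])+
  then show ?thesis
    by (simp add: frac_pairing_eq[OF has_frac_laplacian_add[OF w(1,2)] w(3)] frac_pairing_eq[OF w(1,3)] frac_pairing_eq[OF w(2,3)] distrib_right)
qed

lemma frac_pairing_mult_left:
  assumes "u \<in> Hs s" "v \<in> Hs s"
  shows "frac_pairing s (\<lambda>x. c * u x) v = c * frac_pairing s u v"
proof -
  obtain w z where w: "has_frac_laplacian (s / 2) u w" "has_frac_laplacian (s / 2) v z"
    using assms by (auto simp: Hs_iff)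
  show ?thesis
    by (simp add: frac_pairing_eq[OF has_frac_laplacian_mult[OF w(1)] w(2)] frac_pairing_eq[OF w] mult.assoc)
qed

lemma frac_pairing_self:
  assumes "has_frac_laplacian (s / 2) u w"
  shows "ennreal (frac_pairing s u u) = energy lebesgue w" "0 \<le> frac_pairing s u u"
proof -
  have "frac_pairing s u u = enn2real (energy lebesgue w)"
    using integral_norm_sq[OF has_frac_laplacianD(4)[OF assms]]
    by (simp add: frac_pairing_eq[OF assms assms] power2_eq_square)
  then show "ennreal (frac_pairing s u u) = energy lebesgue w" "0 \<le> frac_pairing s u u"
    using has_frac_laplacianD(6)[OF assms] by simp_all
qed

lemma frac_pairing_self_zero:
  assumes u: "u \<in> Hs s" and z: "frac_pairing s u u \<le> 0"
  shows "AE x in lebesgue. u x = 0"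
proof -
  obtain w where w: "has_frac_laplacian (s / 2) u w" using u by (auto simp: Hs_iff)
  have "energy lebesgue w = 0" using frac_pairing_self[OF w] z by simp
  then show ?thesis
    using has_frac_laplacianD(4)[OF w] by (intro has_frac_laplacian_zero[OF w]) (simp add: energy_eq_0_iff)
qed

lemma Hs_tilde_norm_sq: "(Hs_tilde_norm s u)\<^sup>2 = frac_pairing s u u"
  by (simp add: Hs_tilde_norm_def L2_norm_def frac_pairing_def power2_eq_square)

section \<open>Absolute values do not increase the energy\<close>

text \<open>The constant in \<open>c \<cdot> \<lambda>\<^sup>s = \<integral>\<^sub>0\<^sup>\<infinity> (1 - e\<^sup>-\<^sup>t\<^sup>\<lambda>) t\<^sup>-\<^sup>1\<^sup>-\<^sup>s dt\<close>, the formula that subordinates the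
  fractional Laplacian to the heat semigroup. It equals \<open>\<Gamma>(1 - s) / s\<close>; being finite and nonzero, it
  cancels from inequalities between energies.\<close>

definition bernstein_const :: "real \<Rightarrow> ennreal" where
  "bernstein_const s = (\<integral>\<^sup>+t. ennreal (indicator {0<..} t * ((1 - exp (- t)) * t powr (- 1 - s))) \<partial>lborel)"

lemma bernstein_const_finite:
  assumes s: "0 < s" "s < 1"
  shows "bernstein_const s < \<infinity>"
proof -
  have "((\<lambda>t. t powr (- s)) has_integral (1 powr (- s + 1) / (- s + 1))) {0..1}"
    using s by (intro has_integral_powr_from_0) auto
  from nn_integral_has_integral_lebesgue'[OF _ this]
  have 1: "(\<integral>\<^sup>+t. ennreal (t powr (- s)) * indicator {0..1} t \<partial>lborel) < \<infinity>" by simp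
  have "((\<lambda>t. t powr (- 1 - s)) has_integral (- (1 powr (- 1 - s + 1)) / (- 1 - s + 1))) {1..}"
    using s by (intro has_integral_powr_to_inf) auto
  from nn_integral_has_integral_lebesgue'[OF _ this]
  have 2: "(\<integral>\<^sup>+t. ennreal (t powr (- 1 - s)) * indicator {1..} t \<partial>lborel) < \<infinity>" by simp
  have "bernstein_const s \<le> (\<integral>\<^sup>+t. ennreal (t powr (- s)) * indicator {0..1} t + ennreal (t powr (- 1 - s)) * indicator {1..} t \<partial>lborel)"
    unfolding bernstein_const_def
  proof (rule nn_integral_mono)
    fix t :: real
    show "ennreal (indicator {0<..} t * ((1 - exp (- t)) * t powr (- 1 - s))) \<le>
      ennreal (t powr (- s)) * indicator {0..1} t + ennreal (t powr (- 1 - s)) * indicator {1..} t"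
    proof -
      consider "t \<le> 0" | "0 < t" "t \<le> 1" | "1 < t" by linarith
      then show ?thesis
      proof cases
        case 2
        have "(1 - exp (- t)) * t powr (- 1 - s) \<le> t * t powr (- 1 - s)"
          using exp_ge_add_one_self[of "- t"] by (intro mult_right_mono) auto
        also have "\<dots> = t powr (- s)" using 2 powr_add[of t 1 "- 1 - s"] by simp
        finally have "ennreal ((1 - exp (- t)) * t powr (- 1 - s)) \<le> ennreal (t powr (- s))" by (rule ennreal_leI)
        also have "\<dots> \<le> ennreal (t powr (- s)) + ennreal (t powr (- 1 - s)) * indicator {1..} t" by simp
        finally show ?thesis using 2 by simp
      next
        case 3
        have "(1 - exp (- t)) * t powr (- 1 - s) \<le> 1 * t powr (- 1 - s)" by (intro mult_right_mono) auto
        then show ?thesis using 3 by (simp add: ennreal_leI)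
      qed simp
    qed
  qed
  also have "\<dots> < \<infinity>" using 1 2 by (simp add: nn_integral_add)
  finally show ?thesis .
qed

lemma bernstein_const_pos: "bernstein_const s \<noteq> 0"
proof
  assume "bernstein_const s = 0"
  then have "AE t in lborel. ennreal (indicator {0<..} t * ((1 - exp (- t)) * t powr (- 1 - s))) = 0"
    unfolding bernstein_const_def by (subst (asm) nn_integral_0_iff_AE) auto
  then have "AE t in lborel. t \<notin> {0<..<1::real}"
  proof eventually_elim
    fix t :: real assume *: "ennreal (indicator {0<..} t * ((1 - exp (- t)) * t powr (- 1 - s))) = 0"
    show "t \<notin> {0<..<1}"
    proof
      assume "t \<in> {0<..<1}"
      then have "0 < indicator {0<..} t * ((1 - exp (- t)) * t powr (- 1 - s))" by simp
      with * show False by (simp only: ennreal_eq_0_iff)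
    qed
  qed
  then have "{0<..<1::real} \<in> null_sets lborel" by (subst AE_iff_null_sets) auto
  then show False by (simp add: null_sets_def)
qed

text \<open>Scaling \<open>t\<close> by \<open>1 / r\<^sup>2\<close> reduces the integral to the one with \<open>r = 1\<close>.\<close>

lemma bernstein_powr:
  fixes r s :: real
  assumes r: "0 \<le> r" and s: "0 < s"
  shows "(\<integral>\<^sup>+t. ennreal (indicator {0<..} t * ((1 - exp (- t * r\<^sup>2)) * t powr (- 1 - s))) \<partial>lborel)
      = ennreal ((r powr s)\<^sup>2) * bernstein_const s"
proof (cases "r = 0")
  case False
  with r have r0: "0 < r" by simp
  let ?f = "\<lambda>t. ennreal (indicator {0<..} t * ((1 - exp (- t * r\<^sup>2)) * t powr (- 1 - s)))"
  define c where "c = 1 / r\<^sup>2"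
  have c: "0 < c" using r0 by (simp add: c_def)
  have "(\<integral>\<^sup>+t. ?f t \<partial>lborel) = ennreal \<bar>c\<bar> * (\<integral>\<^sup>+t. ?f (0 + c * t) \<partial>lborel)"
    using c by (intro nn_integral_real_affine) auto
  also have "\<dots> = ennreal c * (\<integral>\<^sup>+t. ennreal (c powr (- 1 - s)) * ennreal (indicator {0<..} t * ((1 - exp (- t)) * t powr (- 1 - s))) \<partial>lborel)"
  proof -
    have "?f (0 + c * t) = ennreal (c powr (- 1 - s)) * ennreal (indicator {0<..} t * ((1 - exp (- t)) * t powr (- 1 - s)))" for t
    proof (cases "0 < t")
      case True
      have "c * t * r\<^sup>2 = t" using r0 by (simp add: c_def)
      then have "(1 - exp (- (0 + c * t) * r\<^sup>2)) * (0 + c * t) powr (- 1 - s) = c powr (- 1 - s) * ((1 - exp (- t)) * t powr (- 1 - s))"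
        using True c by (simp add: powr_mult)
      then show ?thesis using True c by (simp add: ennreal_mult)
    next
      case False
      then show ?thesis using c by (simp add: zero_less_mult_iff)
    qed
    then show ?thesis using c by simp
  qed
  also have "\<dots> = ennreal (c * c powr (- 1 - s)) * bernstein_const s"
    unfolding bernstein_const_def using c by (simp add: nn_integral_cmult ennreal_mult mult.assoc)
  also have "c * c powr (- 1 - s) = c powr (- s)" using c powr_add[of c 1 "- 1 - s"] by simp
  also have "c powr (- s) = (r\<^sup>2) powr s"
    using r0 by (simp add: c_def powr_minus powr_divide)
  also have "(r\<^sup>2) powr s = (r powr s)\<^sup>2" by (simp only: power2_eq_square powr_mult)
  finally show ?thesis .
qed simp

lemma frac_energy_subordination:
  fixes G :: "'a::euclidean_space \<Rightarrow> complex"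
  assumes G[measurable]: "G \<in> borel_measurable borel" and s: "0 < s"
  shows "energy lborel (\<lambda>\<xi>. complex_of_real (norm \<xi> powr s) * G \<xi>) * bernstein_const s =
    (\<integral>\<^sup>+t. ennreal (indicator {0<..} t * t powr (- 1 - s)) *
        (\<integral>\<^sup>+\<xi>. ennreal ((1 - exp (- t * (norm \<xi>)\<^sup>2)) * (norm (G \<xi>))\<^sup>2) \<partial>lborel) \<partial>lborel)"
proof -
  let ?F = "\<lambda>t (\<xi>::'a). ennreal (indicator {0<..} t * ((1 - exp (- t * (norm \<xi>)\<^sup>2)) * t powr (- 1 - s))) * ennreal ((norm (G \<xi>))\<^sup>2)"
  have "energy lborel (\<lambda>\<xi>. complex_of_real (norm \<xi> powr s) * G \<xi>) * bernstein_const s =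
     (\<integral>\<^sup>+\<xi>. (ennreal ((norm \<xi> powr s)\<^sup>2) * bernstein_const s) * ennreal ((norm (G \<xi>))\<^sup>2) \<partial>lborel)"
    unfolding energy_def
    by (subst nn_integral_multc[symmetric]) (auto simp: norm_mult power_mult_distrib ennreal_mult mult_ac)
  also have "\<dots> = (\<integral>\<^sup>+\<xi>. (\<integral>\<^sup>+t. ?F t \<xi> \<partial>lborel) \<partial>lborel)"
    by (simp only: bernstein_powr[OF norm_ge_zero s, symmetric]) (simp add: nn_integral_multc)
  also have "\<dots> = (\<integral>\<^sup>+t. (\<integral>\<^sup>+\<xi>. ?F t \<xi> \<partial>lborel) \<partial>lborel)"
    by (rule lborel_pair.Fubini') measurable
  also have "\<dots> = (\<integral>\<^sup>+t. ennreal (indicator {0<..} t * t powr (- 1 - s)) *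
        (\<integral>\<^sup>+\<xi>. ennreal ((1 - exp (- t * (norm \<xi>)\<^sup>2)) * (norm (G \<xi>))\<^sup>2) \<partial>lborel) \<partial>lborel)"
  proof (rule nn_integral_cong)
    fix t :: real
    have "?F t \<xi> = ennreal (indicator {0<..} t * t powr (- 1 - s)) * ennreal ((1 - exp (- t * (norm \<xi>)\<^sup>2)) * (norm (G \<xi>))\<^sup>2)" for \<xi>
      by (cases "0 < t") (simp_all add: mult_ac flip: ennreal_mult)
    then show "(\<integral>\<^sup>+\<xi>. ?F t \<xi> \<partial>lborel) = ennreal (indicator {0<..} t * t powr (- 1 - s)) *
        (\<integral>\<^sup>+\<xi>. ennreal ((1 - exp (- t * (norm \<xi>)\<^sup>2)) * (norm (G \<xi>))\<^sup>2) \<partial>lborel)"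
      by (simp add: nn_integral_cmult)
  qed
  finally show ?thesis .
qed

text \<open>By the heat identity the two sides are the integrals of \<open>u x * u y\<close> and of \<open>\<bar>u x\<bar> * \<bar>u y\<bar>\<close> against the
  positive heat kernel.\<close>

lemma heat_energy_abs:
  fixes u :: "'a::euclidean_space \<Rightarrow> real"
  assumes u[measurable]: "u \<in> borel_measurable borel" and ui: "integrable lborel u" and t: "0 < t"
  shows "(\<integral>\<^sup>+\<xi>. ennreal (exp (- t * (norm \<xi>)\<^sup>2) * (norm (fourier_integral (\<lambda>x. complex_of_real (u x)) \<xi>))\<^sup>2) \<partial>lborel) \<le>
    (\<integral>\<^sup>+\<xi>. ennreal (exp (- t * (norm \<xi>)\<^sup>2) * (norm (fourier_integral (\<lambda>x. complex_of_real \<bar>u x\<bar>) \<xi>))\<^sup>2) \<partial>lborel)"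
proof -
  let ?P = "lborel \<Otimes>\<^sub>M lborel :: ('a \<times> 'a) measure"
  have Q: "integrable lborel (\<lambda>\<xi>. exp (- t * (norm \<xi>)\<^sup>2) * (norm (fourier_integral (\<lambda>x. complex_of_real (v x)) \<xi>))\<^sup>2)"
      "(\<integral>\<xi>. exp (- t * (norm \<xi>)\<^sup>2) * (norm (fourier_integral (\<lambda>x. complex_of_real (v x)) \<xi>))\<^sup>2 \<partial>lborel) =
        (\<integral>p. heat t (fst p - snd p) * (v (fst p) * v (snd p)) \<partial>?P)"
    if v: "v \<in> borel_measurable borel" "integrable lborel v" for v :: "'a \<Rightarrow> real"
  proof -
    have m: "(\<lambda>x. complex_of_real (v x)) \<in> borel_measurable borel" using v by simp
    have i: "integrable lborel (\<lambda>x. complex_of_real (v x))" using v by (simp add: complex_of_real_integrable_eq)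
    show "integrable lborel (\<lambda>\<xi>. exp (- t * (norm \<xi>)\<^sup>2) * (norm (fourier_integral (\<lambda>x. complex_of_real (v x)) \<xi>))\<^sup>2)"
      by (rule Fourier_heat_identity(1)[OF m i t])
    have "complex_of_real (\<integral>\<xi>. exp (- t * (norm \<xi>)\<^sup>2) * (norm (fourier_integral (\<lambda>x. complex_of_real (v x)) \<xi>))\<^sup>2 \<partial>lborel) =
      (\<integral>p. complex_of_real (heat t (fst p - snd p) * (v (fst p) * v (snd p))) \<partial>?P)"
      unfolding Fourier_heat_identity(2)[OF m i t] by simp
    also have "\<dots> = complex_of_real (\<integral>p. heat t (fst p - snd p) * (v (fst p) * v (snd p)) \<partial>?P)"
      by (rule integral_complex_of_real)
    finally show "(\<integral>\<xi>. exp (- t * (norm \<xi>)\<^sup>2) * (norm (fourier_integral (\<lambda>x. complex_of_real (v x)) \<xi>))\<^sup>2 \<partial>lborel) =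
        (\<integral>p. heat t (fst p - snd p) * (v (fst p) * v (snd p)) \<partial>?P)"
      by (simp only: of_real_eq_iff)
  qed
  have au: "(\<lambda>x. \<bar>u x\<bar>) \<in> borel_measurable borel" "integrable lborel (\<lambda>x. \<bar>u x\<bar>)" using ui by auto
  have K: "heat t z \<le> (4 * pi * t) powr (- (real DIM('a) / 2))" for z :: 'a
    unfolding heat_def using t by (intro mult_left_le) auto
  have ia: "integrable ?P (\<lambda>p. heat t (fst p - snd p) * (v (fst p) * v (snd p)))"
    if v[measurable]: "v \<in> borel_measurable borel" and vi: "integrable lborel v" for v :: "'a \<Rightarrow> real"
  proof (rule Bochner_Integration.integrable_bound)
    show "integrable ?P (\<lambda>p. (4 * pi * t) powr (- (real DIM('a) / 2)) * (case p of (x, y) \<Rightarrow> v x * v y))"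
      by (intro integrable_mult_right integrable_pair_mult lborel.sigma_finite_measure_axioms vi)
    show "AE p in ?P. norm (heat t (fst p - snd p) * (v (fst p) * v (snd p))) \<le>
        norm ((4 * pi * t) powr (- (real DIM('a) / 2)) * (case p of (x, y) \<Rightarrow> v x * v y))"
      by (intro AE_I2) (auto simp: abs_mult case_prod_unfold intro!: mult_right_mono K)
  qed measurable
  have "(\<integral>p. heat t (fst p - snd p) * (u (fst p) * u (snd p)) \<partial>?P) \<le> (\<integral>p. heat t (fst p - snd p) * (\<bar>u (fst p)\<bar> * \<bar>u (snd p)\<bar>) \<partial>?P)"
    by (intro integral_mono ia[OF u ui] ia[OF au] mult_left_mono heat_nonneg) (simp flip: abs_mult)
  then have "ennreal (\<integral>\<xi>. exp (- t * (norm \<xi>)\<^sup>2) * (norm (fourier_integral (\<lambda>x. complex_of_real (u x)) \<xi>))\<^sup>2 \<partial>lborel) \<le>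
    ennreal (\<integral>\<xi>. exp (- t * (norm \<xi>)\<^sup>2) * (norm (fourier_integral (\<lambda>x. complex_of_real \<bar>u x\<bar>) \<xi>))\<^sup>2 \<partial>lborel)"
    unfolding Q(2)[OF u ui] Q(2)[OF au] by (rule ennreal_leI)
  moreover have "(\<integral>\<^sup>+\<xi>. ennreal (exp (- t * (norm \<xi>)\<^sup>2) * (norm (fourier_integral (\<lambda>x. complex_of_real (v x)) \<xi>))\<^sup>2) \<partial>lborel) =
    ennreal (\<integral>\<xi>. exp (- t * (norm \<xi>)\<^sup>2) * (norm (fourier_integral (\<lambda>x. complex_of_real (v x)) \<xi>))\<^sup>2 \<partial>lborel)"
    if "v \<in> borel_measurable borel" "integrable lborel v" for v :: "'a \<Rightarrow> real"
    by (rule nn_integral_eq_integral[OF Q(1)[OF that]]) auto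
  ultimately show ?thesis using u ui au by simp
qed

text \<open>Since \<open>u\<close> and \<open>\<bar>u\<bar>\<close> have the same \<open>L\<^sup>2\<close> norm, the increase of the damped energy at every time is a
  decrease of its complement, the integral against \<open>1 - exp (- t \<bar>\<xi>\<bar>\<^sup>2)\<close>. Subordination sums these
  inequalities up to the fractional energy.\<close>

lemma frac_energy_abs:
  fixes u :: "'a::euclidean_space \<Rightarrow> real"
  assumes u: "integrable lebesgue u" and u2: "energy lebesgue u < \<infinity>" and s: "0 < s" "s < 1"
  shows "energy lebesgue (\<lambda>\<xi>. complex_of_real (norm \<xi> powr s) * fourier_integral (\<lambda>x. complex_of_real \<bar>u x\<bar>) \<xi>)
     \<le> energy lebesgue (\<lambda>\<xi>. complex_of_real (norm \<xi> powr s) * fourier_integral (\<lambda>x. complex_of_real (u x)) \<xi>)"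
proof -
  have um: "u \<in> borel_measurable lebesgue" using u by auto
  obtain v where v[measurable]: "v \<in> borel_measurable borel" and ae: "AE x in lborel. u x = v x"
    using completion_ex_borel_measurable_real[OF um] by auto
  then have ae: "AE x in lebesgue. u x = v x" by (intro AE_completion)
  have vm[measurable]: "v \<in> borel_measurable lebesgue" by (rule measurable_completion) simp
  have "integrable lebesgue v" using u integrable_cong_AE[OF um vm ae] by simp
  then have vi: "integrable lborel v" using integrable_completion[of v lborel] by simp
  have vci: "integrable lborel (\<lambda>x. complex_of_real (v x))" "integrable lborel (\<lambda>x. complex_of_real \<bar>v x\<bar>)"
    using vi by (simp_all add: complex_of_real_integrable_eq)
  have ev: "energy lborel v < \<infinity>"
  proof -
    have "AE x in lebesgue. norm (u x) = norm (v x)" using ae by eventually_elim simp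
    from energy_cong_AE[OF this] show ?thesis using u2 by (simp add: energy_lebesgue)
  qed
  let ?G = "fourier_integral (\<lambda>x. complex_of_real (v x))" and ?H = "fourier_integral (\<lambda>x. complex_of_real \<bar>v x\<bar>)"
  have [measurable]: "?G \<in> borel_measurable borel" "?H \<in> borel_measurable borel"
    by (intro fourier_integral_measurable; measurable)+
  have F: "fourier_integral (\<lambda>x. complex_of_real (u x)) = ?G" "fourier_integral (\<lambda>x. complex_of_real \<bar>u x\<bar>) = ?H"
    using um ae by (intro fourier_integral_cong_AE; auto)+
  have eG: "energy lborel ?G = energy lborel v" and eH: "energy lborel ?H = energy lborel v"
    using Plancherel_borel[OF _ vci(1)] Plancherel_borel[OF _ vci(2)] ev
    by (simp_all add: energy_def)
  have split: "(\<integral>\<^sup>+\<xi>. ennreal (exp (- t * (norm \<xi>)\<^sup>2) * (norm (W \<xi>))\<^sup>2) \<partial>lborel) +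
      (\<integral>\<^sup>+\<xi>. ennreal ((1 - exp (- t * (norm \<xi>)\<^sup>2)) * (norm (W \<xi>))\<^sup>2) \<partial>lborel) = energy lborel W"
    if [measurable]: "W \<in> borel_measurable borel" and t: "0 < t" for W :: "'a \<Rightarrow> complex" and t
    unfolding energy_def using t
    by (subst nn_integral_add[symmetric]) (auto simp flip: ennreal_plus simp: left_diff_distrib mult_left_le_one_le)
  have le: "(\<integral>\<^sup>+\<xi>. ennreal ((1 - exp (- t * (norm \<xi>)\<^sup>2)) * (norm (?H \<xi>))\<^sup>2) \<partial>lborel) \<le>
     (\<integral>\<^sup>+\<xi>. ennreal ((1 - exp (- t * (norm \<xi>)\<^sup>2)) * (norm (?G \<xi>))\<^sup>2) \<partial>lborel)" if t: "0 < t" for t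
  proof -
    let ?e = "\<lambda>W. \<integral>\<^sup>+\<xi>. ennreal (exp (- t * (norm \<xi>)\<^sup>2) * (norm (W \<xi> :: complex))\<^sup>2) \<partial>lborel"
    let ?d = "\<lambda>W. \<integral>\<^sup>+\<xi>. ennreal ((1 - exp (- t * (norm \<xi>)\<^sup>2)) * (norm (W \<xi> :: complex))\<^sup>2) \<partial>lborel"
    have "?e ?H + ?d ?H = ?e ?G + ?d ?G" using split[of ?G t] split[of ?H t] t by (simp add: eG eH)
    also have "\<dots> \<le> ?e ?H + ?d ?G" by (intro add_right_mono heat_energy_abs v vi t)
    finally have "?e ?H + ?d ?H \<le> ?e ?H + ?d ?G" .
    moreover have "?e ?H < \<infinity>"
    proof -
      have "?e ?H \<le> ?e ?H + ?d ?H" by simp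
      also have "\<dots> = energy lborel v" unfolding split[OF \<open>?H \<in> _\<close> t] by (rule eH)
      finally show ?thesis using ev by simp
    qed
    ultimately show ?thesis by (auto simp: ennreal_add_left_cancel_le)
  qed
  have "energy lborel (\<lambda>\<xi>. complex_of_real (norm \<xi> powr s) * ?H \<xi>) * bernstein_const s \<le>
      energy lborel (\<lambda>\<xi>. complex_of_real (norm \<xi> powr s) * ?G \<xi>) * bernstein_const s"
    unfolding frac_energy_subordination[OF \<open>?G \<in> _\<close> s(1)] frac_energy_subordination[OF \<open>?H \<in> _\<close> s(1)]
  proof (rule nn_integral_mono)
    fix t :: real
    show "ennreal (indicator {0<..} t * t powr (- 1 - s)) * (\<integral>\<^sup>+\<xi>. ennreal ((1 - exp (- t * (norm \<xi>)\<^sup>2)) * (norm (?H \<xi>))\<^sup>2) \<partial>lborel)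
      \<le> ennreal (indicator {0<..} t * t powr (- 1 - s)) * (\<integral>\<^sup>+\<xi>. ennreal ((1 - exp (- t * (norm \<xi>)\<^sup>2)) * (norm (?G \<xi>))\<^sup>2) \<partial>lborel)"
    proof (cases "0 < t")
      case True
      then show ?thesis by (intro mult_left_mono le) auto
    qed simp
  qed
  then show ?thesis
    unfolding F energy_lebesgue
    using bernstein_const_pos[of s] bernstein_const_finite[OF s]
    by (simp add: mult.commute[of _ "bernstein_const s"] ennreal_mult_le_mult_iff)
qed

lemma bounded_support_integrable:
  fixes u :: "'a::euclidean_space \<Rightarrow> 'b::{euclidean_space, real_normed_field}"
  assumes "u \<in> L2" "bounded S" "AE x in lebesgue. x \<notin> S \<longrightarrow> u x = 0"
  shows "integrable lebesgue u"
proof -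
  obtain r where r: "S \<subseteq> cball 0 r" using assms(2) by (auto simp: bounded_iff subset_eq)
  have "AE x in lebesgue. x \<notin> cball 0 r \<longrightarrow> u x = 0"
    using assms(3) by eventually_elim (use r in auto)
  then show ?thesis by (rule integrable_bounded_support[OF assms(1) lmeasurable_cball])
qed

text \<open>For functions of bounded support the truncations are eventually constant, so the abstract
  transform is the Fourier integral, to which the heat identity applies.\<close>

lemma bounded_support_fourier_transform:
  fixes u :: "'a::euclidean_space \<Rightarrow> complex"
  assumes u: "u \<in> L2" and S: "bounded S" and z: "AE x in lebesgue. x \<notin> S \<longrightarrow> u x = 0"
  shows "has_fourier_transform u (fourier_integral u)"
proof -
  have i: "integrable lebesgue u" by (rule bounded_support_integrable[OF assms])
  obtain r where r: "S \<subseteq> cball 0 r" using S by (auto simp: bounded_iff subset_eq)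
  have eq: "fourier_integral (cutoff R u) = fourier_integral u" if "r \<le> R" for R
  proof (intro fourier_integral_cong_AE L2_measurable cutoff_L2 u)
    show "AE x in lebesgue. cutoff R u x = u x"
      using z
    proof eventually_elim
      fix x assume "x \<notin> S \<longrightarrow> u x = 0"
      moreover have "x \<notin> cball 0 R \<Longrightarrow> x \<notin> S" using r that by auto
      ultimately show "cutoff R u x = u x" by (auto simp: cutoff_def indicator_def)
    qed
  qed
  have "energy lebesgue (fourier_integral u) = energy lebesgue u"
    by (rule Plancherel_integrable[OF i L2_energy[OF u]])
  then have "fourier_integral u \<in> L2"
    using fourier_integral_borel_measurable[OF i] L2_energy[OF u] by (simp add: L2_iff)
  moreover have "((\<lambda>R. energy lebesgue (\<lambda>\<xi>. fourier_integral (cutoff R u) \<xi> - fourier_integral u \<xi>)) \<longlongrightarrow> 0) at_top"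
    using eventually_ge_at_top[of r]
    by (intro tendsto_eventually, eventually_elim) (simp add: eq energy_def)
  ultimately show ?thesis using u by (simp add: has_fourier_transform_iff)
qed

lemma Hs_L2: "u \<in> Hs s \<Longrightarrow> u \<in> L2"
  by (simp add: Hs_def)

lemma Hs_tilde_fourier:
  fixes u :: "'a::euclidean_space \<Rightarrow> real"
  assumes u: "u \<in> L2" "AE x in lebesgue. x \<notin> closure \<Omega> \<longrightarrow> u x = 0" and \<Omega>: "bounded \<Omega>"
  shows "integrable lebesgue u"
    "has_fourier_transform (\<lambda>x. complex_of_real (u x)) (fourier_integral (\<lambda>x. complex_of_real (u x)))"
proof -
  show "integrable lebesgue u"
    by (rule bounded_support_integrable[OF u(1) bounded_closure[OF \<Omega>] u(2)])
  show "has_fourier_transform (\<lambda>x. complex_of_real (u x)) (fourier_integral (\<lambda>x. complex_of_real (u x)))"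
    by (rule bounded_support_fourier_transform[OF L2_of_real[OF u(1)] bounded_closure[OF \<Omega>]]) (use u(2) in simp)
qed

lemma Hs_tilde_abs:
  fixes u :: "'a::euclidean_space \<Rightarrow> real"
  assumes u: "u \<in> Hs_tilde s \<Omega>" and \<Omega>: "bounded \<Omega>" and s: "0 < s" "s < 1"
  shows "(\<lambda>x. \<bar>u x\<bar>) \<in> Hs_tilde s \<Omega>"
    "frac_pairing s (\<lambda>x. \<bar>u x\<bar>) (\<lambda>x. \<bar>u x\<bar>) \<le> frac_pairing s u u"
proof -
  have uH: "u \<in> Hs s" and z: "AE x in lebesgue. x \<notin> closure \<Omega> \<longrightarrow> u x = 0"
    using u by (auto simp: Hs_tilde_def)
  have uL: "u \<in> L2" by (rule Hs_L2[OF uH])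
  obtain w where w: "has_frac_laplacian (s / 2) u w" using uH by (auto simp: Hs_iff)
  have um: "u \<in> borel_measurable lebesgue" by (rule L2_measurable[OF uL])
  then have am: "(\<lambda>x. \<bar>u x\<bar>) \<in> borel_measurable lebesgue" by simp
  have aL: "(\<lambda>x. \<bar>u x\<bar>) \<in> L2" by (rule L2_bound[OF am uL]) simp
  have az: "AE x in lebesgue. x \<notin> closure \<Omega> \<longrightarrow> \<bar>u x\<bar> = 0" using z by eventually_elim simp
  note F = Hs_tilde_fourier[OF uL z \<Omega>] and Fa = Hs_tilde_fourier[OF aL az \<Omega>]
  have le: "energy lebesgue (\<lambda>\<xi>. complex_of_real (norm \<xi> powr (2 * (s / 2))) * fourier_integral (\<lambda>x. complex_of_real \<bar>u x\<bar>) \<xi>) \<le> energy lebesgue w"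
    unfolding has_frac_laplacian_energy[OF w F(2)]
    using frac_energy_abs[OF F(1) L2_energy[OF uL] s] by simp
  then have "energy lebesgue (\<lambda>\<xi>. complex_of_real (norm \<xi> powr (2 * (s / 2))) * fourier_integral (\<lambda>x. complex_of_real \<bar>u x\<bar>) \<xi>) < \<infinity>"
    using has_frac_laplacianD(6)[OF w] by (rule le_less_trans)
  then obtain a where a: "has_frac_laplacian (s / 2) (\<lambda>x. \<bar>u x\<bar>) a"
    by (rule has_frac_laplacian_exists[OF aL Fa(2)])
  then have "(\<lambda>x. \<bar>u x\<bar>) \<in> Hs s" by (auto simp: Hs_iff)
  then show "(\<lambda>x. \<bar>u x\<bar>) \<in> Hs_tilde s \<Omega>" using az by (simp add: Hs_tilde_def)
  have "energy lebesgue a \<le> energy lebesgue w"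
    using le by (simp add: has_frac_laplacian_energy[OF a Fa(2)])
  then show "frac_pairing s (\<lambda>x. \<bar>u x\<bar>) (\<lambda>x. \<bar>u x\<bar>) \<le> frac_pairing s u u"
    unfolding frac_pairing_self(1)[OF a, symmetric] frac_pairing_self(1)[OF w, symmetric]
    using frac_pairing_self(2)[OF w] by simp
qed

lemma neg_part_abs: "neg_part v = (\<lambda>x. (1/2) * (\<bar>v x\<bar> - v x))"
  by (auto simp: neg_part_def min_def)

lemma Hs_tilde_neg_part:
  assumes u: "u \<in> Hs_tilde s \<Omega>" and "bounded \<Omega>" "0 < s" "s < 1"
  shows "neg_part u \<in> Hs_tilde s \<Omega>"
  unfolding neg_part_abs by (intro Hs_tilde_mult Hs_tilde_diff Hs_tilde_abs assms)

lemma frac_pairing_diff_left: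
  assumes "u \<in> Hs s" "u' \<in> Hs s" "v \<in> Hs s"
  shows "frac_pairing s (\<lambda>x. u x - u' x) v = frac_pairing s u v - frac_pairing s u' v"
  using frac_pairing_add_left[OF assms(1) Hs_mult[OF assms(2), of "-1"] assms(3)]
    frac_pairing_mult_left[OF assms(2,3), of "-1"] by simp

lemma frac_pairing_diff_right:
  assumes "u \<in> Hs s" "u' \<in> Hs s" "v \<in> Hs s"
  shows "frac_pairing s v (\<lambda>x. u x - u' x) = frac_pairing s v u - frac_pairing s v u'"
  using frac_pairing_diff_left[OF assms] by (simp add: frac_pairing_commute)

lemma frac_pairing_add_right:
  assumes "u \<in> Hs s" "u' \<in> Hs s" "v \<in> Hs s"
  shows "frac_pairing s v (\<lambda>x. u x + u' x) = frac_pairing s v u + frac_pairing s v u'"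
  using frac_pairing_add_left[OF assms] by (simp add: frac_pairing_commute)

lemma frac_pairing_mult_right:
  assumes "u \<in> Hs s" "v \<in> Hs s"
  shows "frac_pairing s v (\<lambda>x. c * u x) = c * frac_pairing s v u"
  using frac_pairing_mult_left[OF assms] by (simp add: frac_pairing_commute)

text \<open>Writing \<open>u\<^sup>-\<close> as half of \<open>\<bar>u\<bar> - u\<close>, the claim becomes \<open>\<langle>(-\<Delta>)\<^sup>s \<bar>u\<bar>, \<bar>u\<bar>\<rangle> \<le> \<langle>(-\<Delta>)\<^sup>s u, u\<rangle>\<close>. It is
  the inequality \<open>\<langle>(-\<Delta>)\<^sup>s u\<^sup>+, u\<^sup>-\<rangle> \<le> 0\<close> in disguise, and the only order-theoretic property of the
  fractional Laplacian behind the comparison of supersolutions.\<close>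

lemma frac_pairing_neg_part:
  assumes u: "u \<in> Hs_tilde s \<Omega>" and "bounded \<Omega>" "0 < s" "s < 1"
  shows "frac_pairing s u (neg_part u) \<le> - frac_pairing s (neg_part u) (neg_part u)"
proof -
  let ?a = "\<lambda>x. \<bar>u x\<bar>"
  have H: "u \<in> Hs s" "?a \<in> Hs s" using u Hs_tilde_abs[OF assms] by (auto intro: Hs_tilde_Hs)
  have d: "(\<lambda>x. ?a x - u x) \<in> Hs s" by (intro Hs_diff H)
  have 1: "frac_pairing s u (neg_part u) = (1/2) * (frac_pairing s u ?a - frac_pairing s u u)"
    unfolding neg_part_abs by (simp only: frac_pairing_mult_right[OF d H(1)] frac_pairing_diff_right[OF H(2,1,1)])
  have "frac_pairing s (neg_part u) (neg_part u) = (1/2) * ((1/2) * frac_pairing s (\<lambda>x. ?a x - u x) (\<lambda>x. ?a x - u x))"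
    unfolding neg_part_abs by (simp only: frac_pairing_mult_right[OF d Hs_mult[OF d]] frac_pairing_mult_left[OF d d])
  also have "frac_pairing s (\<lambda>x. ?a x - u x) (\<lambda>x. ?a x - u x) =
      frac_pairing s ?a ?a - frac_pairing s ?a u - (frac_pairing s u ?a - frac_pairing s u u)"
    by (simp only: frac_pairing_diff_left[OF H(2,1) d] frac_pairing_diff_right[OF H(2,1,2)] frac_pairing_diff_right[OF H(2,1,1)])
  finally show ?thesis
    using Hs_tilde_abs(2)[OF assms] frac_pairing_commute[of s ?a u] unfolding 1 by simp
qed

section \<open>The fractional Poincare inequality\<close>

lemma one_minus_exp_le_powr:
  fixes x s :: real
  assumes "0 \<le> x" "0 < s" "s < 1"
  shows "1 - exp (- x) \<le> x powr s"
proof (cases "x \<le> 1")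
  case True
  have "1 - exp (- x) \<le> x" using exp_ge_add_one_self[of "- x"] by simp
  also have "x \<le> x powr s"
  proof (cases "x = 0")
    case False
    then have "x powr 1 \<le> x powr s" using assms True by (intro powr_mono') auto
    then show ?thesis using assms(1) by simp
  qed simp
  finally show ?thesis .
next
  case False
  then have "1 \<le> x powr s" using assms by (intro ge_one_powr_ge_zero) auto
  then show ?thesis by (smt (verit) exp_gt_zero)
qed

text \<open>Functions supported in a fixed bounded set cannot concentrate at low frequencies: their Fourier
  integral is bounded by a multiple of their \<open>L\<^sup>2\<close> norm. Hence, for large \<open>t\<close>, at most half of the energy of
  \<open>u\<close> is seen by \<open>exp (- t \<bar>\<xi>\<bar>\<^sup>2)\<close>, and the other half is at most \<open>t\<^sup>s\<close> times the fractional energy.\<close>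

lemma fractional_Poincare:
  fixes \<Omega> :: "'a::euclidean_space set"
  assumes \<Omega>: "bounded \<Omega>" and s: "0 < s" "s < 1"
  obtains C where "0 \<le> C" "\<And>u. u \<in> Hs_tilde s \<Omega> \<Longrightarrow> energy lebesgue u \<le> ennreal (C * frac_pairing s u u)"
proof -
  let ?S = "closure \<Omega>"
  define c where "c = (2 * pi) powr (- (real DIM('a) / 2))"
  define M where "M = measure lebesgue ?S"
  have S: "?S \<in> lmeasurable" using \<Omega> by (intro lmeasurable_compact) (simp add: compact_closure)
  have [measurable]: "?S \<in> sets lebesgue" using S by auto
  have M: "emeasure lebesgue ?S = ennreal M" "0 \<le> M"
    using S unfolding M_def by (simp_all add: emeasure_eq_measure2)
  \<comment> \<open>The time \<open>t\<close> is chosen such that the Gaussian integral is \<open>1 / A\<close>, small enough to make the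
    low-frequency part at most half of the energy.\<close>
  define A where "A = 2 * c\<^sup>2 * M + 1"
  have A: "1 \<le> A" using M by (simp add: A_def)
  define t where "t = pi * A powr (2 / real DIM('a))"
  have t: "0 < t" using A by (simp add: t_def)
  have "pi / t = A powr (- (2 / real DIM('a)))" using A by (simp add: t_def powr_minus field_simps)
  then have "(pi / t) powr (real DIM('a) / 2) = A powr (- (2 / real DIM('a)) * (real DIM('a) / 2))"
    by (simp only: powr_powr)
  also have "- (2 / real DIM('a)) * (real DIM('a) / 2) = - 1" by simp
  also have "A powr (- 1) = 1 / A" using A by (simp add: powr_minus_divide)
  finally have tA: "(pi / t) powr (real DIM('a) / 2) = 1 / A" .
  have cM: "c\<^sup>2 * M * (pi / t) powr (real DIM('a) / 2) \<le> 1 / 2"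
    using A unfolding tA by (simp add: A_def field_simps)
  show thesis
  proof (rule that[of "2 * t powr s"])
    fix u :: "'a \<Rightarrow> real" assume u: "u \<in> Hs_tilde s \<Omega>"
    have uH: "u \<in> Hs s" and z: "AE x in lebesgue. x \<notin> ?S \<longrightarrow> u x = 0"
      using u by (auto simp: Hs_tilde_def)
    have uL: "u \<in> L2" by (rule Hs_L2[OF uH])
    have [measurable]: "u \<in> borel_measurable lebesgue" by (rule L2_measurable[OF uL])
    obtain w where w: "has_frac_laplacian (s / 2) u w" using uH by (auto simp: Hs_iff)
    note F = Hs_tilde_fourier[OF uL z \<Omega>]
    let ?u = "\<lambda>x. complex_of_real (u x)"
    let ?G = "fourier_integral ?u"
    have iu: "integrable lebesgue ?u" using F(1) by (simp add: complex_of_real_integrable_eq)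
    have [measurable]: "?G \<in> borel_measurable borel" by (rule fourier_integral_borel[OF iu])
    define I where "I = (\<integral>x. \<bar>u x\<bar> \<partial>lebesgue)"
    have I0: "0 \<le> I" unfolding I_def by simp
    define e where "e = enn2real (energy lebesgue u)"
    have e: "energy lebesgue u = ennreal e" "0 \<le> e" using L2_energy[OF uL] by (simp_all add: e_def)
    have I: "I\<^sup>2 \<le> M * e"
    proof -
      have "ennreal I = (\<integral>\<^sup>+x. ennreal (norm (indicator ?S x * u x)) \<partial>lebesgue)"
        unfolding I_def
      proof (subst nn_integral_eq_integral[symmetric])
        show "(\<integral>\<^sup>+x. ennreal \<bar>u x\<bar> \<partial>lebesgue) = (\<integral>\<^sup>+x. ennreal (norm (indicator ?S x * u x)) \<partial>lebesgue)"
          by (rule nn_integral_cong_AE) (use z in \<open>eventually_elim, auto simp: indicator_def\<close>)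
      qed (use F(1) in auto)
      then have "(ennreal I)\<^sup>2 \<le> energy lebesgue (\<lambda>x. indicator ?S x :: real) * energy lebesgue u"
        using energy_mult_le[of "\<lambda>x. indicator ?S x :: real" lebesgue u] by simp
      also have "energy lebesgue (\<lambda>x. indicator ?S x :: real) = (\<integral>\<^sup>+x. indicator ?S x \<partial>lebesgue)"
        unfolding energy_def by (intro nn_integral_cong) (auto simp: indicator_def)
      also have "\<dots> = ennreal M" using M by simp
      finally show ?thesis using I0 M e by (simp add: ennreal_power flip: ennreal_mult)
    qed
    have G: "norm (?G \<xi>) \<le> c * I" for \<xi>
    proof -
      have "norm (\<integral>x. cis (- (\<xi> \<bullet> x)) * ?u x \<partial>lebesgue) \<le> (\<integral>x. norm (cis (- (\<xi> \<bullet> x)) * ?u x) \<partial>lebesgue)"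
        by (rule integral_norm_bound)
      then show ?thesis unfolding fourier_integral_def c_def I_def by (simp add: norm_mult mult_left_mono)
    qed
    have low: "(\<integral>\<^sup>+\<xi>. ennreal (exp (- t * (norm \<xi>)\<^sup>2) * (norm (?G \<xi>))\<^sup>2) \<partial>lborel) \<le> ennreal (e / 2)"
    proof -
      have "(\<integral>\<^sup>+\<xi>. ennreal (exp (- t * (norm \<xi>)\<^sup>2) * (norm (?G \<xi>))\<^sup>2) \<partial>lborel) \<le>
          (\<integral>\<^sup>+\<xi>. ennreal ((c * I)\<^sup>2 * exp (- t * (norm (\<xi>::'a))\<^sup>2)) \<partial>lborel)"
      proof (intro nn_integral_mono ennreal_leI)
        fix \<xi> :: 'a
        have "(norm (?G \<xi>))\<^sup>2 \<le> (c * I)\<^sup>2" by (intro power_mono G) auto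
        then have "exp (- t * (norm \<xi>)\<^sup>2) * (norm (?G \<xi>))\<^sup>2 \<le> exp (- t * (norm \<xi>)\<^sup>2) * (c * I)\<^sup>2" by (intro mult_left_mono) auto
        then show "exp (- t * (norm \<xi>)\<^sup>2) * (norm (?G \<xi>))\<^sup>2 \<le> (c * I)\<^sup>2 * exp (- t * (norm \<xi>)\<^sup>2)" by (simp only: mult.commute)
      qed
      also have "\<dots> = ennreal ((c * I)\<^sup>2 * (pi / t) powr (real DIM('a) / 2))"
        unfolding Gaussian_integral(2)[OF t, where 'a='a, symmetric] integral_mult_right_zero[symmetric]
        by (rule nn_integral_eq_integral[OF integrable_mult_right[OF Gaussian_integral(1)[OF t]]]) auto
      also have "(c * I)\<^sup>2 * (pi / t) powr (real DIM('a) / 2) \<le> (c\<^sup>2 * (M * e)) * (pi / t) powr (real DIM('a) / 2)"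
        unfolding power_mult_distrib by (intro mult_right_mono mult_left_mono I) auto
      also have "\<dots> = (c\<^sup>2 * M * (pi / t) powr (real DIM('a) / 2)) * e" by simp
      also have "\<dots> \<le> (1 / 2) * e" by (intro mult_right_mono cM e)
      finally show ?thesis by (simp add: ennreal_leI)
    qed
    have high: "(\<integral>\<^sup>+\<xi>. ennreal ((1 - exp (- t * (norm \<xi>)\<^sup>2)) * (norm (?G \<xi>))\<^sup>2) \<partial>lborel) \<le> ennreal (t powr s * frac_pairing s u u)"
    proof -
      have "(\<integral>\<^sup>+\<xi>. ennreal ((1 - exp (- t * (norm \<xi>)\<^sup>2)) * (norm (?G \<xi>))\<^sup>2) \<partial>lborel) \<le>
        (\<integral>\<^sup>+\<xi>. ennreal (t powr s) * ennreal ((norm (complex_of_real (norm \<xi> powr (2 * (s / 2))) * ?G \<xi>))\<^sup>2) \<partial>lborel)"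
      proof (intro nn_integral_mono)
        fix \<xi> :: 'a
        have "1 - exp (- (t * (norm \<xi>)\<^sup>2)) \<le> (t * (norm \<xi>)\<^sup>2) powr s"
          using t s by (intro one_minus_exp_le_powr) auto
        also have "\<dots> = t powr s * (norm \<xi> powr s)\<^sup>2" by (simp add: powr_mult power2_eq_square)
        finally have "(1 - exp (- t * (norm \<xi>)\<^sup>2)) * (norm (?G \<xi>))\<^sup>2 \<le> t powr s * (norm \<xi> powr s)\<^sup>2 * (norm (?G \<xi>))\<^sup>2"
          by (intro mult_right_mono) auto
        then show "ennreal ((1 - exp (- t * (norm \<xi>)\<^sup>2)) * (norm (?G \<xi>))\<^sup>2) \<le>
           ennreal (t powr s) * ennreal ((norm (complex_of_real (norm \<xi> powr (2 * (s / 2))) * ?G \<xi>))\<^sup>2)"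
          by (simp add: norm_mult power_mult_distrib ennreal_leI mult.assoc flip: ennreal_mult)
      qed
      also have "\<dots> = ennreal (t powr s) * energy lebesgue w"
        unfolding has_frac_laplacian_energy[OF w F(2)] unfolding energy_lebesgue unfolding energy_def
        by (intro nn_integral_cmult) measurable
      also have "\<dots> = ennreal (t powr s * frac_pairing s u u)"
        unfolding frac_pairing_self(1)[OF w, symmetric] using frac_pairing_self(2)[OF w] by (simp add: ennreal_mult)
      finally show ?thesis .
    qed
    have "ennreal e = energy lborel ?G"
      using Plancherel[OF F(2)] e by (simp add: energy_of_real energy_lebesgue)
    also have "\<dots> = (\<integral>\<^sup>+\<xi>. ennreal (exp (- t * (norm \<xi>)\<^sup>2) * (norm (?G \<xi>))\<^sup>2) \<partial>lborel) +
        (\<integral>\<^sup>+\<xi>. ennreal ((1 - exp (- t * (norm \<xi>)\<^sup>2)) * (norm (?G \<xi>))\<^sup>2) \<partial>lborel)"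
      unfolding energy_def using t
      by (subst nn_integral_add[symmetric]) (auto simp flip: ennreal_plus simp: left_diff_distrib mult_left_le_one_le)
    also have "\<dots> \<le> ennreal (e / 2) + ennreal (t powr s * frac_pairing s u u)" by (intro add_mono low high)
    also have "\<dots> = ennreal (e / 2 + t powr s * frac_pairing s u u)"
      using e frac_pairing_self(2)[OF w] by (simp flip: ennreal_plus)
    finally have "e \<le> e / 2 + t powr s * frac_pairing s u u"
      using e frac_pairing_self(2)[OF w] by (subst (asm) ennreal_le_iff) auto
    then have "e \<le> 2 * t powr s * frac_pairing s u u" by simp
    then show "energy lebesgue u \<le> ennreal (2 * t powr s * frac_pairing s u u)"
      unfolding e by (rule ennreal_leI)
  qed simp
qed

section \<open>Completeness of the energy space\<close>

lemma L2_limit: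
  fixes f :: "nat \<Rightarrow> 'a::euclidean_space \<Rightarrow> 'b::euclidean_space"
  assumes f: "\<And>k. f k \<in> L2" and g[measurable]: "g \<in> borel_measurable lebesgue"
    and lim: "(\<lambda>k. energy lebesgue (\<lambda>x. f k x - g x)) \<longlonglongrightarrow> 0"
  shows "g \<in> L2"
proof -
  obtain k where k: "energy lebesgue (\<lambda>x. f k x - g x) < 1"
    using order_tendstoD(2)[OF lim, of 1] by (auto simp: eventually_sequentially)
  have [measurable]: "f k \<in> borel_measurable lebesgue" by (rule L2_measurable[OF f])
  have "energy lebesgue g \<le> 2 * energy lebesgue (f k) + 2 * energy lebesgue (\<lambda>x. f k x - g x)"
    using energy_diff[of "f k" lebesgue "\<lambda>x. f k x - g x"] by simp
  also have "\<dots> < \<infinity>"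
    using less_trans[OF k ennreal_one_less_top] L2_energy[OF f[of k]] by (auto simp: ennreal_mult_less_top)
  finally show ?thesis by (simp add: L2_iff)
qed

lemma has_frac_laplacian_diff:
  assumes "has_frac_laplacian \<sigma> u w" "has_frac_laplacian \<sigma> u' w'"
  shows "has_frac_laplacian \<sigma> (\<lambda>x. u x - u' x) (\<lambda>x. w x - w' x)"
  using has_frac_laplacian_add[OF assms(1) has_frac_laplacian_mult[OF assms(2), of "-1"]] by simp

text \<open>A multiplication operator is closed: on each ball the multiplier is bounded, so both sides of the
  relation converge there.\<close>

lemma multiplier_limit:
  fixes g h :: "nat \<Rightarrow> 'a::euclidean_space \<Rightarrow> complex" and m :: "'a \<Rightarrow> real"
  assumes m[measurable]: "m \<in> borel_measurable borel" and bd: "\<And>\<xi> R. norm \<xi> \<le> R \<Longrightarrow> \<bar>m \<xi>\<bar> \<le> B R"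
    and mes[measurable]: "\<And>k. g k \<in> borel_measurable lebesgue" "G \<in> borel_measurable lebesgue" "H \<in> borel_measurable lebesgue"
    and lg: "(\<lambda>k. energy lebesgue (\<lambda>x. g k x - G x)) \<longlonglongrightarrow> 0"
    and lh: "(\<lambda>k. energy lebesgue (\<lambda>x. complex_of_real (m x) * g k x - H x)) \<longlonglongrightarrow> 0"
  shows "AE \<xi> in lebesgue. H \<xi> = complex_of_real (m \<xi>) * G \<xi>"
proof -
  have [measurable]: "(\<lambda>x. complex_of_real (m x)) \<in> borel_measurable lebesgue"
    by (rule measurable_completion) measurable
  have "AE \<xi> in lebesgue. norm \<xi> \<le> real R \<longrightarrow> H \<xi> = complex_of_real (m \<xi>) * G \<xi>" for R :: nat
  proof -
    have cb[measurable]: "cball 0 (real R) \<in> sets (lebesgue :: 'a measure)" by auto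
    let ?\<chi> = "\<lambda>\<xi>::'a. indicator (cball 0 (real R)) \<xi> :: complex"
    have [measurable]: "?\<chi> \<in> borel_measurable lebesgue" by (rule borel_measurable_indicator[OF cb])
    let ?D = "\<lambda>\<xi>. ?\<chi> \<xi> * (complex_of_real (m \<xi>) * G \<xi> - H \<xi>)"
    have "energy lebesgue ?D \<le> 2 * energy lebesgue (\<lambda>x. complex_of_real (m x) * g k x - H x)
        + 2 * (ennreal ((B (real R))\<^sup>2) * energy lebesgue (\<lambda>x. g k x - G x))" for k
    proof -
      let ?X = "\<lambda>\<xi>. ?\<chi> \<xi> * (complex_of_real (m \<xi>) * g k \<xi> - H \<xi>)"
      let ?Y = "\<lambda>\<xi>. ?\<chi> \<xi> * (complex_of_real (m \<xi>) * (g k \<xi> - G \<xi>))"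
      have "?D = (\<lambda>\<xi>. ?X \<xi> - ?Y \<xi>)" by (auto simp: algebra_simps)
      then have D: "energy lebesgue ?D \<le> 2 * energy lebesgue ?X + 2 * energy lebesgue ?Y"
        using energy_diff[of ?X lebesgue ?Y] by simp
      have X: "energy lebesgue ?X \<le> energy lebesgue (\<lambda>x. complex_of_real (m x) * g k x - H x)"
        by (intro energy_mono_AE AE_I2) (simp add: indicator_def)
      have Y: "energy lebesgue ?Y \<le> energy lebesgue (\<lambda>x. B (real R) *\<^sub>R (g k x - G x))"
      proof (intro energy_mono_AE AE_I2)
        fix x :: 'a
        have "\<bar>m x\<bar> \<le> \<bar>B (real R)\<bar>" if "norm x \<le> real R" using bd[OF that] by linarith
        then show "norm (?Y x) \<le> norm (B (real R) *\<^sub>R (g k x - G x))"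
          by (auto simp: indicator_def norm_mult intro!: mult_right_mono)
      qed
      have B: "energy lebesgue (\<lambda>x. B (real R) *\<^sub>R (g k x - G x)) = ennreal ((B (real R))\<^sup>2) * energy lebesgue (\<lambda>x. g k x - G x)"
        by (rule energy_scaleR) measurable
      show ?thesis
        by (rule order_trans[OF D]) (intro add_mono mult_left_mono X Y[unfolded B], simp_all)
    qed
    moreover have "(\<lambda>k. 2 * energy lebesgue (\<lambda>x. complex_of_real (m x) * g k x - H x)
        + 2 * (ennreal ((B (real R))\<^sup>2) * energy lebesgue (\<lambda>x. g k x - G x))) \<longlonglongrightarrow> 2 * 0 + 2 * (ennreal ((B (real R))\<^sup>2) * 0)"
      by (intro tendsto_add tendsto_mult_ennreal tendsto_const lg lh) auto
    ultimately have "energy lebesgue ?D \<le> 2 * 0 + 2 * (ennreal ((B (real R))\<^sup>2) * 0)"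
      by (intro LIMSEQ_le_const) auto
    then have "energy lebesgue ?D = 0" by simp
    then have "AE \<xi> in lebesgue. ?D \<xi> = 0" by (subst (asm) energy_eq_0_iff) auto
    then show ?thesis by eventually_elim (auto simp: indicator_def)
  qed
  then have "AE \<xi> in lebesgue. \<forall>R::nat. norm \<xi> \<le> real R \<longrightarrow> H \<xi> = complex_of_real (m \<xi>) * G \<xi>"
    unfolding AE_all_countable by blast
  then show ?thesis
  proof eventually_elim
    fix \<xi> :: 'a assume *: "\<forall>R::nat. norm \<xi> \<le> real R \<longrightarrow> H \<xi> = complex_of_real (m \<xi>) * G \<xi>"
    show "H \<xi> = complex_of_real (m \<xi>) * G \<xi>" using * real_arch_simple[of "norm \<xi>"] by blast
  qed
qed

text \<open>The Poincare inequality makes a Cauchy sequence in the energy also Cauchy in \<open>L\<^sup>2\<close>. The limits of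
  the functions and of their fractional Laplacians belong together because multiplication by
  \<open>\<bar>\<xi>\<bar>\<^sup>s\<close> is closed.\<close>

lemma Hs_tilde_complete:
  fixes v :: "nat \<Rightarrow> 'a::euclidean_space \<Rightarrow> real"
  assumes \<Omega>: "bounded \<Omega>" and s: "0 < s" "s < 1" and v: "\<And>k. v k \<in> Hs_tilde s \<Omega>"
    and Cauchy: "\<And>e. 0 < e \<Longrightarrow> \<exists>N. \<forall>m\<ge>N. \<forall>n\<ge>N. frac_pairing s (\<lambda>x. v m x - v n x) (\<lambda>x. v m x - v n x) < e"
  obtains V r where "V \<in> Hs_tilde s \<Omega>"
    "(\<lambda>k. frac_pairing s (\<lambda>x. v k x - V x) (\<lambda>x. v k x - V x)) \<longlonglongrightarrow> 0"
    "strict_mono r" "AE x in lebesgue. (\<lambda>k. v (r k) x) \<longlonglongrightarrow> V x"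
proof -
  obtain C where C: "0 \<le> C" "\<And>u. u \<in> Hs_tilde s \<Omega> \<Longrightarrow> energy lebesgue u \<le> ennreal (C * frac_pairing s u u)"
    using fractional_Poincare[OF \<Omega> s] by blast
  have "\<exists>w. has_frac_laplacian (s / 2) (v k) w" for k using v[of k] by (auto simp: Hs_tilde_def Hs_iff)
  then obtain w where w: "\<And>k. has_frac_laplacian (s / 2) (v k) (w k)" by metis
  note vw = has_frac_laplacianD[OF w]
  have Ew: "ennreal (frac_pairing s (\<lambda>x. v m x - v n x) (\<lambda>x. v m x - v n x)) = energy lebesgue (\<lambda>x. w m x - w n x)" for m n
    by (rule frac_pairing_self(1)[OF has_frac_laplacian_diff[OF w w]])
  have E0: "0 \<le> frac_pairing s (\<lambda>x. v m x - v n x) (\<lambda>x. v m x - v n x)" for m n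
    by (rule frac_pairing_self(2)[OF has_frac_laplacian_diff[OF w w]])
  obtain W q where W: "W \<in> borel_measurable lebesgue" "(\<lambda>k. energy lebesgue (\<lambda>x. w k x - W x)) \<longlonglongrightarrow> 0"
      and "strict_mono q" "AE x in lebesgue. (\<lambda>k. w (q k) x) \<longlonglongrightarrow> W x"
  proof (rule Riesz_Fischer[of w lebesgue])
    fix e :: real assume e: "0 < e"
    then show "\<exists>N. \<forall>m\<ge>N. \<forall>n\<ge>N. energy lebesgue (\<lambda>x. w m x - w n x) < ennreal e"
      unfolding Ew[symmetric] using Cauchy[OF e] E0 by (simp add: ennreal_less_iff)
  qed (auto intro: vw)
  obtain V r where V: "V \<in> borel_measurable lebesgue" "(\<lambda>k. energy lebesgue (\<lambda>x. v k x - V x)) \<longlonglongrightarrow> 0"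
      and r: "strict_mono r" "AE x in lebesgue. (\<lambda>k. v (r k) x) \<longlonglongrightarrow> V x"
  proof (rule Riesz_Fischer[of v lebesgue])
    fix e :: real assume e: "0 < e"
    then have "0 < e / (C + 1)" using C(1) by simp
    from Cauchy[OF this] obtain N where
      N: "\<And>m n. m \<ge> N \<Longrightarrow> n \<ge> N \<Longrightarrow> frac_pairing s (\<lambda>x. v m x - v n x) (\<lambda>x. v m x - v n x) < e / (C + 1)"
      by blast
    show "\<exists>N. \<forall>m\<ge>N. \<forall>n\<ge>N. energy lebesgue (\<lambda>x. v m x - v n x) < ennreal e"
    proof (intro exI allI impI)
      fix m n assume mn: "m \<ge> N" "n \<ge> N"
      let ?p = "frac_pairing s (\<lambda>x. v m x - v n x) (\<lambda>x. v m x - v n x)"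
      have "C * ?p \<le> (C + 1) * ?p" using E0[of m n] by (intro mult_right_mono) auto
      also have "\<dots> < e" using N[OF mn] C(1) by (simp add: field_simps)
      finally have "ennreal (C * ?p) < ennreal e" using C(1) E0[of m n] by (simp add: ennreal_less_iff)
      then show "energy lebesgue (\<lambda>x. v m x - v n x) < ennreal e"
        using C(2)[OF Hs_tilde_diff[OF v v]] by (rule le_less_trans[rotated])
    qed
  qed (auto intro: vw)
  have VL: "V \<in> L2" by (rule L2_limit[OF vw(1) V])
  have WL: "W \<in> L2" by (rule L2_limit[OF vw(2) W])
  have "\<exists>g. has_fourier_transform (\<lambda>x. complex_of_real (v k x)) g" for k
    using fourier_transform_exists[OF L2_of_real[OF vw(1)[of k]]] by blast
  then obtain g where g: "\<And>k. has_fourier_transform (\<lambda>x. complex_of_real (v k x)) (g k)" by metis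
  note h = has_frac_laplacianE[OF w g]
  obtain G where G: "has_fourier_transform (\<lambda>x. complex_of_real (V x)) G" by (rule fourier_transform_exists[OF L2_of_real[OF VL]])
  obtain H where H: "has_fourier_transform (\<lambda>x. complex_of_real (W x)) H" by (rule fourier_transform_exists[OF L2_of_real[OF WL]])
  have dist: "energy lebesgue (\<lambda>x. complex_of_real (a x) - complex_of_real (b x)) = energy lebesgue (\<lambda>x. a x - b x)" for a b :: "'a \<Rightarrow> real"
    using energy_of_real[of lebesgue "\<lambda>x. a x - b x"] by simp
  have lg: "(\<lambda>k. energy lebesgue (\<lambda>x. g k x - G x)) \<longlonglongrightarrow> 0"
    using V(2) unfolding Plancherel[OF has_fourier_transform_diff[OF g G]] dist .
  have lh: "(\<lambda>k. energy lebesgue (\<lambda>\<xi>. complex_of_real (norm \<xi> powr (2 * (s / 2))) * g k \<xi> - H \<xi>)) \<longlonglongrightarrow> 0"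
    using W(2) unfolding Plancherel[OF has_fourier_transform_diff[OF h H]] dist .
  have HG: "AE \<xi> in lebesgue. H \<xi> = complex_of_real (norm \<xi> powr (2 * (s / 2))) * G \<xi>"
  proof (rule multiplier_limit[where B="\<lambda>R. R powr s" and g=g])
    show "\<bar>norm \<xi> powr (2 * (s / 2))\<bar> \<le> R powr s" if "norm \<xi> \<le> R" for \<xi> :: 'a and R
      using that s by (simp add: powr_mono2)
  qed (use lg lh in \<open>auto intro: has_fourier_transformD(4)[OF g] has_fourier_transformD(4)[OF G] has_fourier_transformD(4)[OF H]\<close>)
  have VW: "has_frac_laplacian (s / 2) V W"
    unfolding has_frac_laplacian_def using VL WL G H HG by blast
  have z: "AE x in lebesgue. x \<notin> closure \<Omega> \<longrightarrow> V x = 0"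
  proof -
    have "AE x in lebesgue. \<forall>k. x \<notin> closure \<Omega> \<longrightarrow> v k x = 0"
      unfolding AE_all_countable using v by (auto simp: Hs_tilde_def)
    with r(2) show ?thesis
    proof eventually_elim
      fix x assume lim: "(\<lambda>k. v (r k) x) \<longlonglongrightarrow> V x" and 0: "\<forall>k. x \<notin> closure \<Omega> \<longrightarrow> v k x = 0"
      show "x \<notin> closure \<Omega> \<longrightarrow> V x = 0"
      proof
        assume "x \<notin> closure \<Omega>"
        then have "(\<lambda>k. v (r k) x) = (\<lambda>_. 0)" using 0 by simp
        then show "V x = 0" using lim by (simp add: LIMSEQ_const_iff)
      qed
    qed
  qed
  have "V \<in> Hs_tilde s \<Omega>" using VW z by (auto simp: Hs_tilde_def Hs_iff)
  moreover have "(\<lambda>k. frac_pairing s (\<lambda>x. v k x - V x) (\<lambda>x. v k x - V x)) \<longlonglongrightarrow> 0"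
  proof -
    have "(\<lambda>k. ennreal (frac_pairing s (\<lambda>x. v k x - V x) (\<lambda>x. v k x - V x))) \<longlonglongrightarrow> 0"
      using W(2) unfolding frac_pairing_self(1)[OF has_frac_laplacian_diff[OF w VW]] .
    then show ?thesis
      by (subst (asm) ennreal_tendsto_0_iff) (rule frac_pairing_self(2)[OF has_frac_laplacian_diff[OF w VW]])
  qed
  ultimately show thesis using r by (rule that)
qed

section \<open>Minimisation of the energy over the obstacle set\<close>

lemma affine_nonneg_at_0:
  fixes a b :: real
  assumes "\<And>t. 0 < t \<Longrightarrow> t \<le> 1 \<Longrightarrow> 0 \<le> a + t * b"
  shows "0 \<le> a"
proof (rule tendsto_lowerbound)
  have "((\<lambda>t. a + t * b) \<longlongrightarrow> a + 0 * b) (at_right 0)" by (intro tendsto_intros)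
  then show "((\<lambda>t. a + t * b) \<longlongrightarrow> a) (at_right 0)" by simp
  show "\<forall>\<^sub>F t in at_right 0. 0 \<le> a + t * b"
    by (rule eventually_at_rightI[of 0 1]) (use assms in auto)
qed simp

lemma frac_pairing_nonneg: "0 \<le> frac_pairing s u u"
  by (simp add: frac_pairing_def)

lemma frac_pairing_quadratic:
  assumes "u \<in> Hs s" "d \<in> Hs s"
  shows "frac_pairing s (\<lambda>x. u x + t * d x) (\<lambda>x. u x + t * d x) =
    frac_pairing s u u + 2 * t * frac_pairing s u d + t\<^sup>2 * frac_pairing s d d"
proof -
  note td = Hs_mult[OF assms(2), of t]
  show ?thesis
    unfolding frac_pairing_add_left[OF assms(1) td Hs_add[OF assms(1) td]] frac_pairing_add_right[OF assms(1) td assms(1)]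
      frac_pairing_add_right[OF assms(1) td td] frac_pairing_mult_left[OF assms(2,1)] frac_pairing_mult_right[OF assms(2,1)]
      frac_pairing_mult_left[OF assms(2) td] frac_pairing_mult_right[OF assms(2,2)]
    by (simp add: frac_pairing_commute[of s d u] power2_eq_square)
qed

lemma frac_pairing_Cauchy_Schwarz:
  assumes u: "u \<in> Hs s" "v \<in> Hs s"
  shows "(frac_pairing s u v)\<^sup>2 \<le> frac_pairing s u u * frac_pairing s v v"
proof -
  let ?a = "frac_pairing s u u" and ?b = "frac_pairing s u v" and ?c = "frac_pairing s v v"
  have q: "0 \<le> ?a + 2 * t * ?b + t\<^sup>2 * ?c" for t
    unfolding frac_pairing_quadratic[OF u, symmetric] by (rule frac_pairing_nonneg)
  show ?thesis
  proof (cases "?c = 0")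
    case True
    have "?b = 0"
    proof (rule ccontr)
      assume b: "?b \<noteq> 0"
      show False using q[of "- (?a + 1) / (2 * ?b)"] b True by simp argo
    qed
    then show ?thesis using True by simp
  next
    case False
    then have c: "0 < ?c" using frac_pairing_nonneg[of s v] by simp
    have "0 \<le> ?a + 2 * (- ?b / ?c) * ?b + (- ?b / ?c)\<^sup>2 * ?c" by (rule q)
    also have "\<dots> = ?a - ?b\<^sup>2 / ?c" using c by (simp add: power2_eq_square)
    finally show ?thesis using c by (simp add: field_simps)
  qed
qed

locale obstacle_problem =
  fixes s :: real and \<Omega> :: "'a::euclidean_space set" and \<psi> :: "'a \<Rightarrow> real" and f :: "('a \<Rightarrow> real) \<Rightarrow> real"
  assumes s: "0 < s" "s < 1" and bounded: "bounded \<Omega>" and f: "f \<in> Hs_tilde_dual s \<Omega>"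
begin

abbreviation "H \<equiv> Hs_tilde s \<Omega>"
abbreviation "K \<equiv> obstacle_set s \<Omega> \<psi>"
abbreviation "E \<equiv> frac_pairing s"

lemma f_add: "u \<in> H \<Longrightarrow> v \<in> H \<Longrightarrow> f (\<lambda>x. u x + v x) = f u + f v"
  and f_mult: "u \<in> H \<Longrightarrow> f (\<lambda>x. c * u x) = c * f u"
  using f by (auto simp: Hs_tilde_dual_def)

lemma f_diff: "u \<in> H \<Longrightarrow> v \<in> H \<Longrightarrow> f (\<lambda>x. u x - v x) = f u - f v"
  using f_add[of u "\<lambda>x. (-1) * v x"] f_mult[of v "-1"] Hs_tilde_mult[of v s \<Omega> "-1"] by simp

lemma f_bounded:
  obtains C where "0 \<le> C" "\<And>u. u \<in> H \<Longrightarrow> \<bar>f u\<bar> \<le> C * sqrt (E u u)"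
proof -
  obtain C where C: "\<And>u. u \<in> H \<Longrightarrow> \<bar>f u\<bar> \<le> C * Hs_tilde_norm s u"
    using f unfolding Hs_tilde_dual_def by blast
  have n: "Hs_tilde_norm s u = sqrt (E u u)" for u
    unfolding Hs_tilde_norm_sq[symmetric] by (simp add: Hs_tilde_norm_def L2_norm_def)
  have "\<bar>f u\<bar> \<le> \<bar>C\<bar> * sqrt (E u u)" if "u \<in> H" for u
  proof -
    have "C * sqrt (E u u) \<le> \<bar>C\<bar> * sqrt (E u u)"
      by (intro mult_right_mono) (simp_all add: frac_pairing_nonneg)
    with C[OF that] show ?thesis unfolding n by linarith
  qed
  then show thesis by (intro that[of "\<bar>C\<bar>"]) auto
qed

lemma K_H: "u \<in> K \<Longrightarrow> u \<in> H" by (simp add: obstacle_set_def)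

lemma H_Hs: "u \<in> H \<Longrightarrow> u \<in> Hs s" by (rule Hs_tilde_Hs)

lemma K_I: "u \<in> H \<Longrightarrow> AE x in lebesgue. x \<in> \<Omega> \<longrightarrow> \<psi> x \<le> u x \<Longrightarrow> u \<in> K"
  by (simp add: obstacle_set_def)

lemma K_AE: "u \<in> K \<Longrightarrow> AE x in lebesgue. x \<in> \<Omega> \<longrightarrow> \<psi> x \<le> u x"
  by (simp add: obstacle_set_def)

lemma K_convex:
  assumes "u \<in> K" "v \<in> K" "0 \<le> t" "t \<le> 1"
  shows "(\<lambda>x. u x + t * (v x - u x)) \<in> K"
proof (rule K_I)
  show "(\<lambda>x. u x + t * (v x - u x)) \<in> H"
    using assms by (intro Hs_tilde_add Hs_tilde_mult Hs_tilde_diff K_H)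
  show "AE x in lebesgue. x \<in> \<Omega> \<longrightarrow> \<psi> x \<le> u x + t * (v x - u x)"
    using K_AE[OF assms(1)] K_AE[OF assms(2)]
  proof eventually_elim
    fix x assume *: "x \<in> \<Omega> \<longrightarrow> \<psi> x \<le> u x" "x \<in> \<Omega> \<longrightarrow> \<psi> x \<le> v x"
    show "x \<in> \<Omega> \<longrightarrow> \<psi> x \<le> u x + t * (v x - u x)"
    proof
      assume "x \<in> \<Omega>"
      then have "(1 - t) * \<psi> x + t * \<psi> x \<le> (1 - t) * u x + t * v x"
        using * assms by (intro add_mono mult_left_mono) auto
      then show "\<psi> x \<le> u x + t * (v x - u x)" by (simp add: algebra_simps)
    qed
  qed
qed

lemma K_min:
  assumes "u \<in> K" "v \<in> K"
  shows "(\<lambda>x. u x - neg_part (\<lambda>x. v x - u x) x) \<in> K"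
proof (rule K_I)
  show "(\<lambda>x. u x - neg_part (\<lambda>x. v x - u x) x) \<in> H"
    using assms bounded s by (intro Hs_tilde_diff Hs_tilde_neg_part K_H)
  show "AE x in lebesgue. x \<in> \<Omega> \<longrightarrow> \<psi> x \<le> u x - neg_part (\<lambda>x. v x - u x) x"
    using K_AE[OF assms(1)] K_AE[OF assms(2)] by eventually_elim (auto simp: neg_part_def min_def)
qed

definition J :: "('a \<Rightarrow> real) \<Rightarrow> real" where "J v = E v v / 2 - f v"

lemma J_expand:
  assumes "u \<in> H" "d \<in> H"
  shows "J (\<lambda>x. u x + t * d x) = J u + t * (E u d - f d) + t\<^sup>2 / 2 * E d d"
  unfolding J_def using assms
  by (simp add: frac_pairing_quadratic H_Hs f_add f_mult Hs_tilde_mult algebra_simps)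

text \<open>The first variation of the energy along the segment from the minimiser to \<open>v\<close> is nonnegative.\<close>

lemma minimiser_solution:
  assumes V: "V \<in> K" and min: "\<And>v. v \<in> K \<Longrightarrow> J V \<le> J v"
  shows "obstacle_solution s \<Omega> \<psi> f V"
  unfolding obstacle_solution_def
proof (intro conjI ballI V)
  fix v assume v: "v \<in> K"
  let ?d = "\<lambda>x. v x - V x"
  have d: "?d \<in> H" by (intro Hs_tilde_diff K_H v V)
  show "0 \<le> E V ?d - f ?d"
  proof (rule affine_nonneg_at_0)
    fix t :: real assume t: "0 < t" "t \<le> 1"
    have "J V \<le> J (\<lambda>x. V x + t * ?d x)" using t by (intro min K_convex V v) auto
    also have "\<dots> = J V + t * (E V ?d - f ?d) + t\<^sup>2 / 2 * E ?d ?d" by (rule J_expand[OF K_H[OF V] d])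
    finally have "0 \<le> t * ((E V ?d - f ?d) + t * (E ?d ?d / 2))" by (simp add: power2_eq_square algebra_simps)
    then show "0 \<le> (E V ?d - f ?d) + t * (E ?d ?d / 2)" using t by (simp add: zero_le_mult_iff)
  qed
qed

lemma J_bounded_below: obtains m where "\<And>v. v \<in> H \<Longrightarrow> m \<le> J v"
proof -
  obtain C where C: "\<And>u. u \<in> H \<Longrightarrow> \<bar>f u\<bar> \<le> C * sqrt (E u u)" using f_bounded by blast
  have "- (C\<^sup>2 / 2) \<le> J v" if v: "v \<in> H" for v
  proof -
    have "0 \<le> (sqrt (E v v) - C)\<^sup>2" by simp
    also have "\<dots> = E v v - 2 * (C * sqrt (E v v)) + C\<^sup>2"
      by (simp add: power2_diff frac_pairing_nonneg)
    finally show ?thesis using C[OF v] unfolding J_def by linarith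
  qed
  then show thesis by (rule that)
qed

text \<open>The parallelogram identity, in the form that makes minimising sequences Cauchy.\<close>

lemma J_midpoint:
  assumes a: "a \<in> H" and b: "b \<in> H"
  shows "E (\<lambda>x. a x - b x) (\<lambda>x. a x - b x) = 4 * (J a + J b - 2 * J (\<lambda>x. b x + (1/2) * (a x - b x)))"
proof -
  let ?d = "\<lambda>x. a x - b x"
  have d: "?d \<in> H" by (intro Hs_tilde_diff a b)
  have "J a = J (\<lambda>x. b x + 1 * ?d x)" by simp
  also have "\<dots> = J b + (E b ?d - f ?d) + E ?d ?d / 2" using J_expand[OF b d, of 1] by simp
  finally have 1: "J a = J b + (E b ?d - f ?d) + E ?d ?d / 2" .
  have 2: "J (\<lambda>x. b x + (1/2) * ?d x) = J b + (1/2) * (E b ?d - f ?d) + (1/8) * E ?d ?d"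
    using J_expand[OF b d, of "1/2"] by (simp add: power2_eq_square)
  show ?thesis unfolding 1 2 by (simp add: field_simps)
qed

lemma J_tendsto:
  assumes V: "V \<in> H" and v: "\<And>k. v k \<in> H"
    and lim: "(\<lambda>k. E (\<lambda>x. v k x - V x) (\<lambda>x. v k x - V x)) \<longlonglongrightarrow> 0"
  shows "(\<lambda>k. J (v k)) \<longlonglongrightarrow> J V"
proof -
  let ?d = "\<lambda>k x. v k x - V x"
  let ?e = "\<lambda>k. sqrt (E (?d k) (?d k))"
  have d: "?d k \<in> H" for k by (intro Hs_tilde_diff v V)
  have e: "?e \<longlonglongrightarrow> 0" using tendsto_real_sqrt[OF lim] by simp
  obtain C where C: "\<And>u. u \<in> H \<Longrightarrow> \<bar>f u\<bar> \<le> C * sqrt (E u u)" using f_bounded by blast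
  have J: "J (v k) = J V + (E V (?d k) - f (?d k)) + E (?d k) (?d k) / 2" for k
    using J_expand[OF V d[of k], of 1] by simp
  have fd: "(\<lambda>k. f (?d k)) \<longlonglongrightarrow> 0"
  proof (rule Lim_null_comparison)
    show "\<forall>\<^sub>F k in sequentially. norm (f (?d k)) \<le> C * ?e k" using C[OF d] by simp
    show "(\<lambda>k. C * ?e k) \<longlonglongrightarrow> 0" using tendsto_mult_right_zero[OF e] by simp
  qed
  have Ed: "(\<lambda>k. E V (?d k)) \<longlonglongrightarrow> 0"
  proof (rule Lim_null_comparison)
    have "norm (E V (?d k)) \<le> sqrt (E V V) * ?e k" for k
      using real_sqrt_le_mono[OF frac_pairing_Cauchy_Schwarz[OF H_Hs[OF V] H_Hs[OF d[of k]]]]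
      by (simp add: real_sqrt_mult)
    then show "\<forall>\<^sub>F k in sequentially. norm (E V (?d k)) \<le> sqrt (E V V) * ?e k" by simp
    show "(\<lambda>k. sqrt (E V V) * ?e k) \<longlonglongrightarrow> 0" using tendsto_mult_right_zero[OF e] by simp
  qed
  have "(\<lambda>k. J V + (E V (?d k) - f (?d k)) + E (?d k) (?d k) / 2) \<longlonglongrightarrow> J V + (0 - 0) + 0 / 2"
    by (intro tendsto_intros Ed fd lim) simp
  then show ?thesis by (simp add: J)
qed

text \<open>The direct method: the midpoint of two nearly optimal functions is admissible, hence not much
  better than they are, which by the parallelogram identity forces them to be close in energy.\<close>

lemma obstacle_solution_exists:
  assumes "K \<noteq> {}"
  obtains V where "obstacle_solution s \<Omega> \<psi> f V"
proof -
  define m where "m = Inf (J ` K)"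
  obtain m0 where m0: "\<And>v. v \<in> H \<Longrightarrow> m0 \<le> J v" using J_bounded_below by blast
  have bdd: "bdd_below (J ` K)" by (rule bdd_belowI2[of K m0]) (auto intro: m0 K_H)
  have m_le: "m \<le> J v" if "v \<in> K" for v unfolding m_def using that bdd by (simp add: cInf_lower)
  \<comment> \<open>A minimising sequence with a rate, so that the Cauchy property can be read off.\<close>
  have "\<exists>v\<in>K. J v < m + inverse (real (Suc k))" for k
    using cInf_lessD[of "J ` K" "m + inverse (real (Suc k))"] assms unfolding m_def by auto
  then obtain v where v: "\<And>k. v k \<in> K" "\<And>k. J (v k) < m + inverse (real (Suc k))" by metis
  have dist: "E (\<lambda>x. v i x - v j x) (\<lambda>x. v i x - v j x) < 4 * (inverse (real (Suc i)) + inverse (real (Suc j)))" for i j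
  proof -
    have "m \<le> J (\<lambda>x. v j x + (1/2) * (v i x - v j x))" by (intro m_le K_convex v) auto
    moreover have "4 * (a + b - 2 * X) < 4 * (p + q)" if "m \<le> X" "a < m + p" "b < m + q" for a b X p q :: real
      using that by argo
    ultimately show ?thesis unfolding J_midpoint[OF K_H[OF v(1)] K_H[OF v(1)]] using v(2) by blast
  qed
  obtain V r where V: "V \<in> H" and lim: "(\<lambda>k. E (\<lambda>x. v k x - V x) (\<lambda>x. v k x - V x)) \<longlonglongrightarrow> 0"
    and r: "strict_mono r" "AE x in lebesgue. (\<lambda>k. v (r k) x) \<longlonglongrightarrow> V x"
  proof (rule Hs_tilde_complete[OF bounded s, of v])
    fix e :: real assume e: "0 < e"
    obtain N where N: "inverse (real (Suc N)) < e / 8" using reals_Archimedean[of "e/8"] e by auto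
    show "\<exists>N. \<forall>m\<ge>N. \<forall>n\<ge>N. E (\<lambda>x. v m x - v n x) (\<lambda>x. v m x - v n x) < e"
    proof (intro exI allI impI)
      fix i j assume "N \<le> i" "N \<le> j"
      then have "inverse (real (Suc i)) \<le> inverse (real (Suc N))" "inverse (real (Suc j)) \<le> inverse (real (Suc N))"
        by (auto intro!: le_imp_inverse_le)
      then show "E (\<lambda>x. v i x - v j x) (\<lambda>x. v i x - v j x) < e" using dist[of i j] N by argo
    qed
  qed (auto intro: K_H v)
  have "AE x in lebesgue. \<forall>k. x \<in> \<Omega> \<longrightarrow> \<psi> x \<le> v k x"
    unfolding AE_all_countable using K_AE[OF v(1)] by blast
  with r(2) have "AE x in lebesgue. x \<in> \<Omega> \<longrightarrow> \<psi> x \<le> V x"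
    by eventually_elim (auto intro: LIMSEQ_le_const)
  then have VK: "V \<in> K" by (rule K_I[OF V])
  have "(\<lambda>k. J (v k)) \<longlonglongrightarrow> J V" by (rule J_tendsto[OF V K_H[OF v(1)] lim])
  moreover have "(\<lambda>k. m + inverse (real (Suc k))) \<longlonglongrightarrow> m + 0" by (intro tendsto_intros LIMSEQ_inverse_real_of_nat)
  ultimately have "J V \<le> m + 0" using v(2) by (intro LIMSEQ_le) (auto intro: less_imp_le)
  then have "obstacle_solution s \<Omega> \<psi> f V" using m_le by (intro minimiser_solution VK) fastforce
  then show thesis by (rule that)
qed

section \<open>Characterisations of the solution\<close>

lemma solutionD:
  "obstacle_solution s \<Omega> \<psi> f u \<Longrightarrow> v \<in> K \<Longrightarrow> 0 \<le> E u (\<lambda>x. v x - u x) - f (\<lambda>x. v x - u x)"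
  by (simp add: obstacle_solution_def)

text \<open>Raising \<open>u\<close> on \<open>\<Omega>\<close> respects the obstacle, so \<open>u + \<phi>\<close> is admissible.\<close>

lemma solution_supersolution:
  assumes "obstacle_solution s \<Omega> \<psi> f u"
  shows "supersolution s \<Omega> f u"
  unfolding supersolution_def
proof (intro conjI ballI impI)
  have u: "u \<in> K" using assms by (simp add: obstacle_solution_def)
  then show "u \<in> H" by (rule K_H)
  fix \<phi> assume \<phi>: "\<phi> \<in> H" "AE x in lebesgue. x \<in> \<Omega> \<longrightarrow> 0 \<le> \<phi> x"
  have "(\<lambda>x. u x + \<phi> x) \<in> K"
  proof (rule K_I)
    show "AE x in lebesgue. x \<in> \<Omega> \<longrightarrow> \<psi> x \<le> u x + \<phi> x"
      using K_AE[OF u] \<phi>(2) by eventually_elim auto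
  qed (intro Hs_tilde_add K_H u \<phi>)
  from solutionD[OF assms this] show "0 \<le> E u \<phi> - f \<phi>" by simp
qed

lemma supersolutionD:
  "supersolution s \<Omega> f u \<Longrightarrow> \<phi> \<in> H \<Longrightarrow> AE x in lebesgue. x \<in> \<Omega> \<longrightarrow> 0 \<le> \<phi> x \<Longrightarrow> 0 \<le> E u \<phi> - f \<phi>"
  by (simp add: supersolution_def)

lemma neg_part_nonneg: "0 \<le> neg_part v x"
  by (simp add: neg_part_def)

text \<open>With \<open>n = (v - u)\<^sup>-\<close>, the functions \<open>u + n\<close> and \<open>u - n = min u v\<close> are both admissible, so the
  variational inequality holds for \<open>n\<close> and for \<open>- n\<close>.\<close>

lemma solution_complementarity:
  assumes a: "obstacle_solution s \<Omega> \<psi> f u" and v: "v \<in> K"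
  shows "E u (neg_part (\<lambda>x. v x - u x)) - f (neg_part (\<lambda>x. v x - u x)) = 0"
proof (rule antisym)
  let ?n = "neg_part (\<lambda>x. v x - u x)"
  have u: "u \<in> K" using a by (simp add: obstacle_solution_def)
  have n: "?n \<in> H" using bounded s by (intro Hs_tilde_neg_part Hs_tilde_diff K_H u v)
  show "0 \<le> E u ?n - f ?n"
    by (rule supersolutionD[OF solution_supersolution[OF a] n]) (simp add: neg_part_nonneg)
  have "0 \<le> E u (\<lambda>x. (u x - ?n x) - u x) - f (\<lambda>x. (u x - ?n x) - u x)"
    by (rule solutionD[OF a K_min[OF u v]])
  also have "(\<lambda>x. (u x - ?n x) - u x) = (\<lambda>x. (-1) * ?n x)" by auto
  also have "E u (\<lambda>x. (-1) * ?n x) - f (\<lambda>x. (-1) * ?n x) = - (E u ?n - f ?n)"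
    unfolding frac_pairing_mult_right[OF H_Hs[OF n] H_Hs[OF K_H[OF u]]] f_mult[OF n] by simp
  finally show "E u ?n - f ?n \<le> 0" by simp
qed

text \<open>Split \<open>v - u\<close> into its positive part, which a supersolution handles, and its negative part, on which
  the residual vanishes.\<close>

lemma complementarity_solution:
  assumes u: "u \<in> K" and sup: "supersolution s \<Omega> f u"
    and c: "\<And>v. v \<in> K \<Longrightarrow> E u (neg_part (\<lambda>x. v x - u x)) - f (neg_part (\<lambda>x. v x - u x)) = 0"
  shows "obstacle_solution s \<Omega> \<psi> f u"
  unfolding obstacle_solution_def
proof (intro conjI ballI u)
  fix v assume v: "v \<in> K"
  let ?d = "\<lambda>x. v x - u x"
  let ?n = "neg_part ?d"
  have d: "?d \<in> H" by (intro Hs_tilde_diff K_H u v)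
  have n: "?n \<in> H" using bounded s by (intro Hs_tilde_neg_part d)
  have p: "(\<lambda>x. ?d x + ?n x) \<in> H" by (intro Hs_tilde_add d n)
  have "0 \<le> E u (\<lambda>x. ?d x + ?n x) - f (\<lambda>x. ?d x + ?n x)"
    by (rule supersolutionD[OF sup p]) (simp add: neg_part_def min_def)
  also have "\<dots> = (E u ?d - f ?d) + (E u ?n - f ?n)"
    unfolding frac_pairing_add_right[OF H_Hs[OF d] H_Hs[OF n] H_Hs[OF K_H[OF u]]] f_add[OF d n] by simp
  finally show "0 \<le> E u ?d - f ?d" using c[OF v] by simp
qed

text \<open>Test the inequality for \<open>U\<close> and the complementarity of \<open>u\<close> with \<open>n = (U - u)\<^sup>-\<close>: the difference gives
  \<open>0 \<le> \<langle>(-\<Delta>)\<^sup>s (U - u), n\<rangle> \<le> - \<langle>(-\<Delta>)\<^sup>s n, n\<rangle>\<close>, so \<open>n\<close> vanishes.\<close>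

lemma solution_least_supersolution:
  assumes a: "obstacle_solution s \<Omega> \<psi> f u" and U: "U \<in> K" "supersolution s \<Omega> f U"
  shows "AE x in lebesgue. x \<in> \<Omega> \<longrightarrow> u x \<le> U x"
proof -
  let ?d = "\<lambda>x. U x - u x"
  let ?n = "neg_part ?d"
  have u: "u \<in> K" using a by (simp add: obstacle_solution_def)
  have d: "?d \<in> H" by (intro Hs_tilde_diff K_H u U)
  have n: "?n \<in> H" using bounded s by (intro Hs_tilde_neg_part d)
  have "0 \<le> E U ?n - f ?n" by (rule supersolutionD[OF U(2) n]) (simp add: neg_part_nonneg)
  moreover have "E u ?n - f ?n = 0" by (rule solution_complementarity[OF a U(1)])
  moreover have "E ?d ?n = E U ?n - E u ?n"
    by (rule frac_pairing_diff_left[OF H_Hs[OF K_H[OF U(1)]] H_Hs[OF K_H[OF u]] H_Hs[OF n]])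
  moreover have "E ?d ?n \<le> - E ?n ?n" by (rule frac_pairing_neg_part[OF d bounded s])
  ultimately have "E ?n ?n \<le> 0" by linarith
  then have "AE x in lebesgue. ?n x = 0" by (rule frac_pairing_self_zero[OF H_Hs[OF n]])
  then show ?thesis by eventually_elim (auto simp: neg_part_def min_def split: if_splits)
qed

text \<open>Let \<open>V\<close> be the solution. It is itself the least supersolution, so \<open>u\<close> and \<open>V\<close> agree on \<open>\<Omega>\<close>. To
  exclude a difference on the boundary, which may have positive measure, note that \<open>u - V\<close> and
  \<open>V - u\<close> are both admissible test functions for the supersolutions \<open>u\<close> and \<open>V\<close>; hence the residuals
  of \<open>u\<close> and of \<open>V\<close> vanish on \<open>u - V\<close>, and \<open>u - V\<close> has energy 0.\<close>

lemma least_supersolution_solution: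
  assumes u: "u \<in> K" and sup: "supersolution s \<Omega> f u"
    and least: "\<And>U. U \<in> K \<Longrightarrow> supersolution s \<Omega> f U \<Longrightarrow> AE x in lebesgue. x \<in> \<Omega> \<longrightarrow> u x \<le> U x"
  shows "obstacle_solution s \<Omega> \<psi> f u"
proof -
  obtain V where V: "obstacle_solution s \<Omega> \<psi> f V" using obstacle_solution_exists u by blast
  have VK: "V \<in> K" using V by (simp add: obstacle_solution_def)
  have Vs: "supersolution s \<Omega> f V" by (rule solution_supersolution[OF V])
  let ?d = "\<lambda>x. u x - V x"
  have d: "?d \<in> H" by (intro Hs_tilde_diff K_H u VK)
  have eq: "AE x in lebesgue. x \<in> \<Omega> \<longrightarrow> u x = V x"
    using least[OF VK Vs] solution_least_supersolution[OF V u sup] by eventually_elim auto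
  have zero: "E W ?d - f ?d = 0" if W: "W \<in> H" "supersolution s \<Omega> f W" for W
  proof -
    have "0 \<le> E W ?d - f ?d"
      by (rule supersolutionD[OF W(2) d]) (use eq in \<open>eventually_elim, auto\<close>)
    moreover have "0 \<le> E W (\<lambda>x. (-1) * ?d x) - f (\<lambda>x. (-1) * ?d x)"
      by (rule supersolutionD[OF W(2) Hs_tilde_mult[OF d]]) (use eq in \<open>eventually_elim, auto\<close>)
    ultimately show ?thesis
      unfolding frac_pairing_mult_right[OF H_Hs[OF d] H_Hs[OF W(1)]] f_mult[OF d] by simp
  qed
  have "E ?d ?d = E u ?d - E V ?d"
    by (rule frac_pairing_diff_left[OF H_Hs[OF K_H[OF u]] H_Hs[OF K_H[OF VK]] H_Hs[OF d]])
  then have Ed: "E ?d ?d = 0" using zero[OF K_H[OF u] sup] zero[OF K_H[OF VK] Vs] by simp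
  show ?thesis
    unfolding obstacle_solution_def
  proof (intro conjI ballI u)
    fix v assume v: "v \<in> K"
    let ?w = "\<lambda>x. v x - V x"
    have w: "?w \<in> H" by (intro Hs_tilde_diff K_H v VK)
    have "(E ?d ?w)\<^sup>2 \<le> 0" using frac_pairing_Cauchy_Schwarz[OF H_Hs[OF d] H_Hs[OF w]] Ed by simp
    then have "E ?d ?w = 0" by simp
    moreover have "E ?d ?w = E u ?w - E V ?w"
      by (rule frac_pairing_diff_left[OF H_Hs[OF K_H[OF u]] H_Hs[OF K_H[OF VK]] H_Hs[OF w]])
    moreover have "0 \<le> E V ?w - f ?w" using V v by (simp add: obstacle_solution_def)
    ultimately have "0 \<le> E u ?w - f ?w" by simp
    moreover have "(\<lambda>x. v x - u x) = (\<lambda>x. ?w x - ?d x)" by auto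
    moreover have "E u (\<lambda>x. ?w x - ?d x) = E u ?w - E u ?d"
      by (rule frac_pairing_diff_right[OF H_Hs[OF w] H_Hs[OF d] H_Hs[OF K_H[OF u]]])
    moreover have "f (\<lambda>x. ?w x - ?d x) = f ?w - f ?d" by (rule f_diff[OF w d])
    ultimately show "0 \<le> E u (\<lambda>x. v x - u x) - f (\<lambda>x. v x - u x)"
      using zero[OF K_H[OF u] sup] by simp
  qed
qed

text \<open>Monotonicity of the fractional Laplacian gives one direction. For the other one, test with
  points of the segment from \<open>u\<close> to \<open>v\<close>, divide by the parameter and let it tend to 0.\<close>

lemma Minty:
  assumes u: "u \<in> K"
  shows "obstacle_solution s \<Omega> \<psi> f u \<longleftrightarrow> (\<forall>v\<in>K. 0 \<le> E v (\<lambda>x. v x - u x) - f (\<lambda>x. v x - u x))"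
proof
  assume a: "obstacle_solution s \<Omega> \<psi> f u"
  show "\<forall>v\<in>K. 0 \<le> E v (\<lambda>x. v x - u x) - f (\<lambda>x. v x - u x)"
  proof
    fix v assume v: "v \<in> K"
    let ?d = "\<lambda>x. v x - u x"
    have d: "?d \<in> H" by (intro Hs_tilde_diff K_H u v)
    have "E ?d ?d = E v ?d - E u ?d"
      by (rule frac_pairing_diff_left[OF H_Hs[OF K_H[OF v]] H_Hs[OF K_H[OF u]] H_Hs[OF d]])
    moreover have "0 \<le> E u ?d - f ?d" using a v by (simp add: obstacle_solution_def)
    ultimately show "0 \<le> E v ?d - f ?d" using frac_pairing_nonneg[of s ?d] by linarith
  qed
next
  assume dual: "\<forall>v\<in>K. 0 \<le> E v (\<lambda>x. v x - u x) - f (\<lambda>x. v x - u x)"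
  show "obstacle_solution s \<Omega> \<psi> f u"
    unfolding obstacle_solution_def
  proof (intro conjI ballI u)
    fix v assume v: "v \<in> K"
    let ?d = "\<lambda>x. v x - u x"
    have d: "?d \<in> H" by (intro Hs_tilde_diff K_H u v)
    show "0 \<le> E u ?d - f ?d"
    proof (rule affine_nonneg_at_0)
      fix t :: real assume t: "0 < t" "t \<le> 1"
      let ?v = "\<lambda>x. u x + t * ?d x"
      have "?v \<in> K" using t by (intro K_convex u v) auto
      then have "0 \<le> E ?v (\<lambda>x. ?v x - u x) - f (\<lambda>x. ?v x - u x)" using dual by blast
      also have "(\<lambda>x. ?v x - u x) = (\<lambda>x. t * ?d x)" by auto
      also have "E ?v (\<lambda>x. t * ?d x) - f (\<lambda>x. t * ?d x) = t * (E u ?d + t * E ?d ?d) - t * f ?d"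
        unfolding frac_pairing_add_left[OF H_Hs[OF K_H[OF u]] Hs_mult[OF H_Hs[OF d]] Hs_mult[OF H_Hs[OF d]]]
          frac_pairing_mult_left[OF H_Hs[OF d] Hs_mult[OF H_Hs[OF d]]]
          frac_pairing_mult_right[OF H_Hs[OF d] H_Hs[OF K_H[OF u]]] frac_pairing_mult_right[OF H_Hs[OF d] H_Hs[OF d]] f_mult[OF d]
        by (simp add: algebra_simps)
      finally have "0 \<le> t * ((E u ?d - f ?d) + t * E ?d ?d)" by (simp add: algebra_simps)
      then show "0 \<le> (E u ?d - f ?d) + t * E ?d ?d" using t by (simp add: zero_le_mult_iff)
    qed
  qed
qed

end

theorem theorem3p2:
  fixes s :: real and \<Omega> :: "(real ^ 'n) set" and \<psi> u :: "real ^ 'n \<Rightarrow> real"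
    and f :: "(real ^ 'n \<Rightarrow> real) \<Rightarrow> real"
  assumes s: "0 < s" "s < 1"
    and domain: "open \<Omega>" "connected \<Omega>" "\<Omega> \<noteq> {}" "bounded \<Omega>"
    and psi: "\<psi> \<in> borel_measurable (lebesgue_on \<Omega>)"
    and f: "f \<in> Hs_tilde_dual s \<Omega>"
    and u: "u \<in> obstacle_set s \<Omega> \<psi>"
  defines "a \<equiv> obstacle_solution s \<Omega> \<psi> f u"
    and "b \<equiv> supersolution s \<Omega> f u \<and>
          (\<forall>U \<in> obstacle_set s \<Omega> \<psi>. supersolution s \<Omega> f U \<longrightarrow>
             (AE x in lebesgue. x \<in> \<Omega> \<longrightarrow> u x \<le> U x))"
    and "c \<equiv> supersolution s \<Omega> f u \<and>
          (\<forall>v \<in> obstacle_set s \<Omega> \<psi>.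
             frac_pairing s u (neg_part (\<lambda>x. v x - u x)) - f (neg_part (\<lambda>x. v x - u x)) = 0)"
    and "d \<equiv> (\<forall>v \<in> obstacle_set s \<Omega> \<psi>.
             frac_pairing s v (\<lambda>x. v x - u x) - f (\<lambda>x. v x - u x) \<ge> 0)"
  shows "(a \<longleftrightarrow> b) \<and> (a \<longleftrightarrow> c) \<and> (a \<longleftrightarrow> d)"
proof -
  interpret obstacle_problem s \<Omega> \<psi> f
    using s domain(4) f by unfold_locales
  have "a \<longleftrightarrow> b"
    unfolding a_def b_def
    using solution_supersolution[of u] solution_least_supersolution[of u] least_supersolution_solution[OF u] by blast
  moreover have "a \<longleftrightarrow> c"
    unfolding a_def c_def
    using solution_supersolution[of u] solution_complementarity[of u] complementarity_solution[OF u] by blast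
  moreover have "a \<longleftrightarrow> d"
    unfolding a_def d_def by (rule Minty[OF u])
  ultimately show ?thesis by blast
qed

end
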